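(* Let $M$ be a non-orientable surface equipped with a complete euclidean or hyperbolic structure, and let $\gamma:S^1\to M$ be an orientation preserving non-null-homotopic generic regular closed curve. Assume further that $\gamma$ is reversible. Then $$W(\gamma)=I(\gamma)\in\mathbb Z,$$ where $W(\gamma)$ is the winding number of $\gamma$ and $I(\gamma)=|i_{\widetilde\gamma}(\gamma)|$ for any cover $\widetilde\gamma$ of $\gamma$, as defined in the context.
   Context: A regular closed curve is a $C^1$ immersion $\gamma:S^1\to M$; it is generic if all its self-intersection points are transversal double points. Let $w:\pi_1(M)\to\{\pm1\}$ be the orientation homomorphism; $\gamma$ is orientation preserving if $w([\gamma])=+1$. A loop $\gamma$ based at $p$ is reversible if there is an element $h$ of the centralizer of $[\gamma]$ in $\pi_1(M,p)$ with $w(h)=-1$. Let $p_M:\widetilde M\to M$ be the universal covering, where $\widetilde M$ is the euclidean plane $\mathbb E^2$ or the hyperbolic plane $\mathbb H^2$ with its standard orientation, and let $p_{S^1}:\mathbb R\to S^1$, $p_{S^1}(t)=(\cos 2\pi t,\sin 2\pi t)$. A cover of $\gamma$ is a lift $\widetilde\gamma:\mathbb R\to\widetilde M$ of $\gamma\circ p_{S^1}$ to $\widetilde M$. Let $T_0$ be the deck transformation with $T_0\circ\widetilde\gamma(t)=\widetilde\gamma(t+1)$. Double points and signs. At each double point $d$ of $\gamma$ the curve splits into two loops based at $d$; $D_\pm(\gamma)$ is the set of those $d$ for which one of these loops is null-homotopic, equivalently for which every cover $\widetilde\gamma$ has a double point $\widetilde d$ with $p_M(\widetilde d)=d$. For a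 double point $\widetilde d=\widetilde\gamma(t_1)=\widetilde\gamma(t_2)$, $t_1<t_2$, of a cover $\widetilde\gamma$, and small $\delta>0$, $\operatorname{sgn}(\widetilde\gamma,\widetilde d)=+1$ (resp. $-1$) if the arc $\widetilde\gamma((t_2-\delta,t_2+\delta))$ crosses the arc $\widetilde\gamma((t_1-\delta,t_1+\delta))$ from left to right (resp. from right to left). Define $$i_{\widetilde\gamma}(\gamma)=\sum_{d\in D_\pm(\gamma)}\operatorname{sgn}(\widetilde\gamma,\widetilde d)\in\mathbb Z,$$ where for each $d$ a double point $\widetilde d$ of $\widetilde\gamma$ over $d$ is chosen (the value does not depend on the choice; double points of $\gamma$ outside $D_\pm(\gamma)$ contribute $0$). For a deck transformation $T$, $i_{T\circ\widetilde\gamma}(\gamma)=w(T)\,i_{\widetilde\gamma}(\gamma)$, so $I(\gamma)=|i_{\widetilde\gamma}(\gamma)|$ does not depend on the cover. Winding number. $T_0$ is a nontrivial orientation-preserving fixed-point-free isometry of $\widetilde M$: a translation of $\mathbb E^2$, or a hyperbolic or parabolic isometry of $\mathbb H^2$. Let $(\varphi_s)_{s\in\mathbb R}$ be the one-parameter group of isometries (of translations, in the euclidean case) with $\varphi_1=T_0$, and let $X$ be the nowhere vanishing, $T_0$-invariant vector field on $\widetilde M$ generating it. Let $\theta:\mathbb R\to\mathbb R$ be a continuous choice of the oriented (counterclockwise positive) angle from $X(\widetilde\gamma(t))$ to $\widetilde\gamma'(t)$. Then $\frac{1}{2\pi}(\theta(1)-\theta(0))$ is an integer which is multiplied by $w(T)$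 when $\widetilde\gamma$ is replaced by $T\circ\widetilde\gamma$. For reversible $\gamma$, $W(\gamma)=\left|\frac{1}{2\pi}(\theta(1)-\theta(0))\right|$. *)

theory Defs
  imports "HOL-Analysis.Analysis"
begin

section \<open>The two model planes\<close>

text \<open>The Euclidean plane is the complex plane and the hyperbolic plane is the upper half-plane
  (curvature \<open>-1\<close>). Both carry the standard orientation of the complex plane. The half-plane model
  is conformal and its topology is the Euclidean one, so oriented angles, left and right, and
  differentiability can be read off in complex coordinates.\<close>

datatype geometry = Euclidean | Hyperbolic

fun plane :: "geometry \<Rightarrow> complex set" where
  "plane Euclidean = UNIV"
| "plane Hyperbolic = {z. Im z > 0}"

fun plane_dist :: "geometry \<Rightarrow> complex \<Rightarrow> complex \<Rightarrow> real" where
  "plane_dist Euclidean z w = dist z w"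
| "plane_dist Hyperbolic z w = arcosh (1 + (cmod (z - w))\<^sup>2 / (2 * Im z * Im w))"

definition plane_isometry :: "geometry \<Rightarrow> (complex \<Rightarrow> complex) \<Rightarrow> bool" where
  "plane_isometry G T \<longleftrightarrow> bij_betw T (plane G) (plane G) \<and>
     (\<forall>z\<in>plane G. \<forall>w\<in>plane G. plane_dist G (T z) (T w) = plane_dist G z w)"

text \<open>The determinant of the pair of columns \<open>u\<close>, \<open>v\<close>; it is positive iff \<open>v\<close> points to the left
  of \<open>u\<close>.\<close>

definition planar_det :: "complex \<Rightarrow> complex \<Rightarrow> real" where
  "planar_det u v = Im (cnj u * v)"

definition orientation_preserving_at :: "(complex \<Rightarrow> complex) \<Rightarrow> complex \<Rightarrow> bool" where
  "orientation_preserving_at T z \<longleftrightarrow>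
     (\<exists>D. (T has_derivative D) (at z) \<and> planar_det (D 1) (D \<i>) > 0)"

section \<open>Complete Euclidean and hyperbolic surfaces\<close>

definition isometric_chart ::
  "geometry \<Rightarrow> 'm::metric_space set \<Rightarrow> 'm set \<Rightarrow> ('m \<Rightarrow> complex) \<Rightarrow> bool" where
  "isometric_chart G M U f \<longleftrightarrow> openin (top_of_set M) U \<and> f ` U \<subseteq> plane G \<and> open (f ` U) \<and>
     (\<forall>x\<in>U. \<forall>y\<in>U. plane_dist G (f x) (f y) = dist x y)"

text \<open>The structure is given by its Riemannian distance: a complete metric that is locally isometric
  to the model plane and is a length metric. For complete metrics, being a length metric is
  equivalent to the existence of approximate midpoints, which is the last condition.\<close>

definition complete_geometric_surface :: "geometry \<Rightarrow> 'm::metric_space set \<Rightarrow> bool" where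
  "complete_geometric_surface G M \<longleftrightarrow>
     M \<noteq> {} \<and> connected M \<and> complete M \<and>
     (\<forall>x\<in>M. \<exists>U f. x \<in> U \<and> isometric_chart G M U f) \<and>
     (\<forall>x\<in>M. \<forall>y\<in>M. \<forall>e>0. \<exists>z\<in>M. dist x z \<le> dist x y / 2 + e \<and> dist z y \<le> dist x y / 2 + e)"

definition orientable :: "geometry \<Rightarrow> 'm::metric_space set \<Rightarrow> bool" where
  "orientable G M \<longleftrightarrow> (\<exists>A.
     (\<forall>(U, f)\<in>A. isometric_chart G M U f) \<and>
     (\<forall>x\<in>M. \<exists>(U, f)\<in>A. x \<in> U) \<and>
     (\<forall>(U, f)\<in>A. \<forall>(V, g)\<in>A. \<forall>x\<in>U \<inter> V.
        orientation_preserving_at (g \<circ> inv_into U f) (f x)))"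

text \<open>The model planes are simply connected, so a covering by one of them is universal.\<close>

definition universal_covering ::
  "geometry \<Rightarrow> 'm::metric_space set \<Rightarrow> (complex \<Rightarrow> 'm) \<Rightarrow> bool" where
  "universal_covering G M p \<longleftrightarrow> covering_space (plane G) p M \<and>
     (\<forall>z\<in>plane G. \<exists>U. open U \<and> z \<in> U \<and> U \<subseteq> plane G \<and>
        (\<forall>x\<in>U. \<forall>y\<in>U. dist (p x) (p y) = plane_dist G x y))"

definition deck_transformation ::
  "geometry \<Rightarrow> (complex \<Rightarrow> 'm) \<Rightarrow> (complex \<Rightarrow> complex) \<Rightarrow> bool" where
  "deck_transformation G p T \<longleftrightarrow>
     (\<exists>S. homeomorphism (plane G) (plane G) T S) \<and> (\<forall>z\<in>plane G. p (T z) = p z)"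

definition deck_sign :: "geometry \<Rightarrow> (complex \<Rightarrow> complex) \<Rightarrow> int" where
  "deck_sign G T = (if \<forall>z\<in>plane G. orientation_preserving_at T z then 1 else -1)"

text \<open>The orientation homomorphism \<open>w\<close>, evaluated on the class of a loop \<open>\<alpha>\<close> parametrised by
  \<open>[0,1]\<close>: the sign of the deck transformation that takes the initial point of a lift of \<open>\<alpha>\<close> to its
  final point. Another lift changes this transformation by conjugation only.\<close>

definition orientation_character ::
  "geometry \<Rightarrow> (complex \<Rightarrow> 'm) \<Rightarrow> (real \<Rightarrow> 'm) \<Rightarrow> int" where
  "orientation_character G p \<alpha> = (THE e. \<exists>\<beta> T.
     path \<beta> \<and> path_image \<beta> \<subseteq> plane G \<and> (\<forall>t\<in>{0..1}. p (\<beta> t) = \<alpha> t) \<and>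
     deck_transformation G p T \<and> T (pathstart \<beta>) = pathfinish \<beta> \<and> e = deck_sign G T)"

section \<open>Generic regular closed curves\<close>

definition circle_param :: "real \<Rightarrow> complex" where
  "circle_param t = cis (2 * pi * t)"

definition regular_closed_curve ::
  "geometry \<Rightarrow> 'm::metric_space set \<Rightarrow> (complex \<Rightarrow> 'm) \<Rightarrow> bool" where
  "regular_closed_curve G M \<gamma> \<longleftrightarrow>
     continuous_on (sphere 0 1) \<gamma> \<and> \<gamma> ` sphere 0 1 \<subseteq> M \<and>
     (\<forall>U f. isometric_chart G M U f \<longrightarrow>
        (f \<circ> \<gamma> \<circ> circle_param) C1_differentiable_on {t. \<gamma> (circle_param t) \<in> U} \<and>
        (\<forall>t. \<gamma> (circle_param t) \<in> U \<longrightarrow> vector_derivative (f \<circ> \<gamma> \<circ> circle_param) (at t) \<noteq> 0))"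

definition generic_curve ::
  "geometry \<Rightarrow> 'm::metric_space set \<Rightarrow> (complex \<Rightarrow> 'm) \<Rightarrow> bool" where
  "generic_curve G M \<gamma> \<longleftrightarrow>
     (\<forall>a\<in>sphere 0 1. \<forall>b\<in>sphere 0 1. \<forall>c\<in>sphere 0 1.
        \<gamma> a = \<gamma> b \<and> \<gamma> b = \<gamma> c \<longrightarrow> a = b \<or> b = c \<or> a = c) \<and>
     (\<forall>s t U f. circle_param s \<noteq> circle_param t \<and> \<gamma> (circle_param s) = \<gamma> (circle_param t) \<and>
        isometric_chart G M U f \<and> \<gamma> (circle_param s) \<in> U \<longrightarrow>
        planar_det (vector_derivative (f \<circ> \<gamma> \<circ> circle_param) (at s))
                   (vector_derivative (f \<circ> \<gamma> \<circ> circle_param) (at t)) \<noteq> 0)"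

definition null_homotopic_curve :: "'m::metric_space set \<Rightarrow> (complex \<Rightarrow> 'm) \<Rightarrow> bool" where
  "null_homotopic_curve M \<gamma> \<longleftrightarrow>
     (\<exists>a. homotopic_with_canon (\<lambda>_. True) (sphere 0 1) M \<gamma> (\<lambda>_. a))"

definition reversible_loop ::
  "geometry \<Rightarrow> 'm::metric_space set \<Rightarrow> (complex \<Rightarrow> 'm) \<Rightarrow> (real \<Rightarrow> 'm) \<Rightarrow> bool" where
  "reversible_loop G M p \<alpha> \<longleftrightarrow> (\<exists>h.
     path h \<and> path_image h \<subseteq> M \<and> pathstart h = pathstart \<alpha> \<and> pathfinish h = pathstart \<alpha> \<and>
     homotopic_paths M (h +++ \<alpha>) (\<alpha> +++ h) \<and> orientation_character G p h = -1)"

definition is_cover ::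
  "geometry \<Rightarrow> (complex \<Rightarrow> 'm) \<Rightarrow> (complex \<Rightarrow> 'm) \<Rightarrow> (real \<Rightarrow> complex) \<Rightarrow> bool" where
  "is_cover G p \<gamma> c \<longleftrightarrow>
     continuous_on UNIV c \<and> (\<forall>t. c t \<in> plane G \<and> p (c t) = \<gamma> (circle_param t))"

section \<open>The self-intersection index\<close>

definition sub_loop :: "(complex \<Rightarrow> 'm) \<Rightarrow> real \<Rightarrow> real \<Rightarrow> real \<Rightarrow> 'm" where
  "sub_loop \<gamma> s t = (\<lambda>u. \<gamma> (circle_param (s + u * (t - s))))"

text \<open>The set \<open>D\<^sub>\<plusminus>(\<gamma>)\<close>. The two loops at a double point are \<open>sub_loop \<gamma> s t\<close> and
  \<open>sub_loop \<gamma> t (s + 1)\<close>; both are of the form below.\<close>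

definition null_double_points :: "'m::metric_space set \<Rightarrow> (complex \<Rightarrow> 'm) \<Rightarrow> 'm set" where
  "null_double_points M \<gamma> = {d. \<exists>s t. s < t \<and> t < s + 1 \<and>
     \<gamma> (circle_param s) = d \<and> \<gamma> (circle_param t) = d \<and>
     homotopic_paths M (sub_loop \<gamma> s t) (\<lambda>_. d)}"

definition double_point_at :: "(real \<Rightarrow> complex) \<Rightarrow> complex \<Rightarrow> real \<Rightarrow> real \<Rightarrow> bool" where
  "double_point_at c e t1 t2 \<longleftrightarrow> t1 < t2 \<and> c t1 = e \<and> c t2 = e"

text \<open>The branch at \<open>t2\<close> crosses the branch at \<open>t1\<close> from left to right iff its velocity points to
  the right of the velocity at \<open>t1\<close>. For a cover of a generic non-null-homotopic curve the branches
  are transversal and \<open>t1\<close>, \<open>t2\<close> are determined by the point \<open>e\<close>.\<close>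

definition crossing_sign :: "(real \<Rightarrow> complex) \<Rightarrow> real \<Rightarrow> real \<Rightarrow> int" where
  "crossing_sign c t1 t2 =
     (let x = planar_det (vector_derivative c (at t1)) (vector_derivative c (at t2))
      in if x < 0 then 1 else if x > 0 then -1 else 0)"

definition double_point_sign :: "(real \<Rightarrow> complex) \<Rightarrow> complex \<Rightarrow> int" where
  "double_point_sign c e =
     (THE \<sigma>. \<exists>t1 t2. double_point_at c e t1 t2 \<and> \<sigma> = crossing_sign c t1 t2)"

definition cover_index ::
  "'m::metric_space set \<Rightarrow> (complex \<Rightarrow> 'm) \<Rightarrow> (complex \<Rightarrow> 'm) \<Rightarrow> (real \<Rightarrow> complex) \<Rightarrow> int" where
  "cover_index M p \<gamma> c = (\<Sum>d\<in>null_double_points M \<gamma>.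
     double_point_sign c (SOME e. p e = d \<and> (\<exists>t1 t2. double_point_at c e t1 t2)))"

definition curve_index ::
  "geometry \<Rightarrow> 'm::metric_space set \<Rightarrow> (complex \<Rightarrow> 'm) \<Rightarrow> (complex \<Rightarrow> 'm) \<Rightarrow> int" where
  "curve_index G M p \<gamma> = (THE n. \<exists>c. is_cover G p \<gamma> c \<and> n = \<bar>cover_index M p \<gamma> c\<bar>)"

section \<open>The winding number\<close>

text \<open>\<open>one_parameter_group G \<phi> X\<close>: \<open>\<phi>\<close> is a one-parameter group of isometries (of translations, in
  the Euclidean case) with generating vector field \<open>X\<close>.\<close>

definition one_parameter_group ::
  "geometry \<Rightarrow> (real \<Rightarrow> complex \<Rightarrow> complex) \<Rightarrow> (complex \<Rightarrow> complex) \<Rightarrow> bool" where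
  "one_parameter_group G \<phi> X \<longleftrightarrow>
     (\<forall>s. plane_isometry G (\<phi> s)) \<and>
     (G = Euclidean \<longrightarrow> (\<forall>s. \<exists>a. \<forall>z. \<phi> s z = z + a)) \<and>
     (\<forall>s t. \<forall>z\<in>plane G. \<phi> (s + t) z = \<phi> s (\<phi> t z)) \<and>
     (\<forall>z\<in>plane G. ((\<lambda>s. \<phi> s z) has_vector_derivative X z) (at 0))"

text \<open>\<open>cover_turning G p c v\<close>: \<open>v\<close> is the value of \<open>(\<theta>(1) - \<theta>(0)) / 2\<pi>\<close> obtained from the cover
  \<open>c\<close>, where \<open>T\<close> is the deck transformation with \<open>T (c t) = c (t + 1)\<close> and \<open>\<theta> t\<close> is the angle from
  \<open>X (c t)\<close> to \<open>c' t\<close> (on complex numbers, \<open>sgn z = z / \<bar>z\<bar>\<close>).\<close>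

definition cover_turning ::
  "geometry \<Rightarrow> (complex \<Rightarrow> 'm) \<Rightarrow> (real \<Rightarrow> complex) \<Rightarrow> real \<Rightarrow> bool" where
  "cover_turning G p c v \<longleftrightarrow> (\<exists>T \<phi> X \<theta>.
     deck_transformation G p T \<and> (\<forall>t. T (c t) = c (t + 1)) \<and>
     one_parameter_group G \<phi> X \<and> (\<forall>z\<in>plane G. \<phi> 1 z = T z) \<and>
     continuous_on UNIV \<theta> \<and>
     (\<forall>t. sgn (vector_derivative c (at t)) = cis (\<theta> t) * sgn (X (c t))) \<and>
     v = (\<theta> 1 - \<theta> 0) / (2 * pi))"

definition curve_winding ::
  "geometry \<Rightarrow> (complex \<Rightarrow> 'm) \<Rightarrow> (complex \<Rightarrow> 'm) \<Rightarrow> real" where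
  "curve_winding G p \<gamma> = (THE w. \<exists>c v. is_cover G p \<gamma> c \<and> cover_turning G p c v \<and> w = \<bar>v\<bar>)"

end

theory Submission
  imports Defs "HOL-Complex_Analysis.Complex_Analysis"
begin

text \<open>Let \<open>T\<close> be the deck transformation that shifts a cover \<open>c\<close> by one period. Being an orientation
  preserving isometry without fixed points, it becomes a translation by some \<open>b \<noteq> 0\<close> in a suitable
  injective conformal coordinate \<open>L\<close> (the identity, a parabolic normalisation, or the logarithm of a
  hyperbolic one), and in this coordinate the field \<open>X\<close> is constant. So the turning of \<open>c\<close> relative to
  \<open>X\<close> is the winding number about \<open>0\<close> of the velocity of \<open>g = L \<circ> c\<close>, a curve with
  \<open>g (t + 1) = g t + b\<close>. As in Hopf's proof of the Umlaufsatz, consider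
  \<open>(g t - g s) / (t - s)\<close> on the strip \<open>0 \<le> t - s \<le> 1\<close>: it is the velocity on the diagonal and the
  constant \<open>b\<close> on the other side, and its zeros, counted with the sign of the Jacobian, are the double
  points of \<open>c\<close> with \<open>t - s < 1\<close> counted with the crossing sign. These are exactly the double points
  of \<open>\<gamma>\<close> that split off a null-homotopic loop. Hence the turning equals the index for every cover,
  and replacing \<open>c\<close> by \<open>D \<circ> c\<close> multiplies all crossing signs by the orientation sign of \<open>D\<close>.\<close>

section \<open>Winding numbers and zeros on a rectangle\<close>

text \<open>The turning compares the velocity with a field that varies from point to point, while a
  chord of \<open>c\<close> joins two points with different field vectors. This is why
  \<open>L\<close> is needed: once the field is constant, chords and velocities can be compared with
  one fixed direction and a single map interpolates between them. Conformality of \<open>L\<close>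
  keeps angles and crossing signs, injectivity keeps the double points, and
  \<open>b \<noteq> 0\<close> keeps the far side of the strip free of zeros. The class of the curve
  enters here: orientation preservation makes \<open>T\<close> a motion, and non-null-homotopy
  forbids fixed points, so that \<open>T\<close> is neither the identity nor a rotation. The curve
  is only C1, so the secant map is merely continuous on the diagonal; but it has no zeros there, and
  counting zeros by winding numbers asks for differentiability at the zeros only. Winding number and
  index are defined by \<open>THE\<close>, hence independence of the cover, of the group and of the
  angle function has to be shown, as well as the existence of a turning value.\<close>

lemma winding_number_times:
  assumes "path p" "path q" "0 \<notin> path_image p" "0 \<notin> path_image q"
  shows "winding_number (\<lambda>t. p t * q t) 0 = winding_number p 0 + winding_number q 0"
proof -
  obtain lp where lp: "path lp" "pathfinish lp - pathstart lp = 2 * of_real pi * \<i> * winding_number p 0"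
      "\<And>t. t \<in> {0..1} \<Longrightarrow> p t = 0 + exp (lp t)"
    using winding_number_as_continuous_log[OF assms(1,3)] by blast
  obtain lq where lq: "path lq" "pathfinish lq - pathstart lq = 2 * of_real pi * \<i> * winding_number q 0"
      "\<And>t. t \<in> {0..1} \<Longrightarrow> q t = 0 + exp (lq t)"
    using winding_number_as_continuous_log[OF assms(2,4)] by blast
  have pl: "path (\<lambda>t. lp t + lq t)"
    using lp(1) lq(1) unfolding path_def by (intro continuous_intros)
  have "winding_number (\<lambda>t. p t * q t) 0 = winding_number (exp \<circ> (\<lambda>t. lp t + lq t)) 0"
    by (rule winding_number_cong) (simp add: lp(3) lq(3) exp_add)
  also have "\<dots> = ((lp 1 - lp 0) + (lq 1 - lq 0)) / (2 * of_real pi * \<i>)"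
    unfolding winding_number_compose_exp[OF pl] by (simp add: pathfinish_def pathstart_def algebra_simps)
  also have "\<dots> = winding_number p 0 + winding_number q 0"
    using lp(2) lq(2) by (simp add: pathfinish_def pathstart_def field_simps)
  finally show ?thesis .
qed

lemma winding_number_prod:
  assumes "finite I" "\<And>i. i \<in> I \<Longrightarrow> path (p i)" "\<And>i. i \<in> I \<Longrightarrow> 0 \<notin> path_image (p i)"
  shows "path (\<lambda>t. \<Prod>i\<in>I. p i t) \<and> 0 \<notin> path_image (\<lambda>t. \<Prod>i\<in>I. p i t) \<and>
     winding_number (\<lambda>t. \<Prod>i\<in>I. p i t) 0 = (\<Sum>i\<in>I. winding_number (p i) 0)"
  using assms
proof (induction I rule: finite_induct)
  case empty
  then show ?case by (auto simp: path_def path_image_def winding_number_zero_const)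
next
  case (insert x F)
  then have IH: "path (\<lambda>t. \<Prod>i\<in>F. p i t)" "0 \<notin> path_image (\<lambda>t. \<Prod>i\<in>F. p i t)"
     "winding_number (\<lambda>t. \<Prod>i\<in>F. p i t) 0 = (\<Sum>i\<in>F. winding_number (p i) 0)" by auto
  have x: "path (p x)" "0 \<notin> path_image (p x)" using insert by auto
  have "path (\<lambda>t. p x t * (\<Prod>i\<in>F. p i t))"
    using x(1) IH(1) unfolding path_def by (rule continuous_on_mult)
  moreover have "0 \<notin> path_image (\<lambda>t. p x t * (\<Prod>i\<in>F. p i t))"
    using x(2) IH(2) by (auto simp: path_image_def)
  ultimately show ?case
    using insert(1,2) winding_number_times[OF x(1) IH(1) x(2) IH(2)] IH(3) by simp
qed

text \<open>On a contractible set \<open>F\<close> has a continuous logarithm, and along a closed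
  path this logarithm returns to its initial value.\<close>

lemma winding_number_log:
  fixes F :: "'a::real_normed_vector \<Rightarrow> complex"
  assumes "continuous_on S F" "contractible S" "\<And>z. z \<in> S \<Longrightarrow> F z \<noteq> 0"
    and "path p" "path_image p \<subseteq> S" "pathfinish p = pathstart p"
  shows "winding_number (\<lambda>t. F (p t)) 0 = 0"
proof -
  obtain l where l: "continuous_on S l" "\<And>x. x \<in> S \<Longrightarrow> F x = exp (l x)"
    using continuous_logarithm_on_contractible[OF assms(1-3)] by blast
  have pl: "path (l \<circ> p)"
    using assms(4,5) l(1) continuous_on_subset path_continuous_image by blast
  have "winding_number (\<lambda>t. F (p t)) 0 = winding_number (exp \<circ> (l \<circ> p)) 0"
    by (rule winding_number_cong) (use assms(5) l(2) in \<open>auto simp: path_image_def image_subset_iff\<close>)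
  also have "\<dots> = 0"
    unfolding winding_number_compose_exp[OF pl] using assms(6) by (simp add: pathfinish_compose pathstart_compose)
  finally show ?thesis .
qed

text \<open>\<open>\<alpha>\<close> and \<open>\<beta>\<close> are the Wirtinger coefficients of
  \<open>D\<close>; which of them dominates decides whether \<open>D\<close> preserves
  orientation.\<close>

lemma planar_det_linear:
  assumes "linear D"
  obtains \<alpha> \<beta> where "\<And>v. D v = \<alpha> * v + \<beta> * cnj v"
    "planar_det (D 1) (D \<i>) = (cmod \<alpha>)\<^sup>2 - (cmod \<beta>)\<^sup>2"
proof
  define \<alpha> \<beta> where "\<alpha> = (D 1 - \<i> * D \<i>) / 2" and "\<beta> = (D 1 + \<i> * D \<i>) / 2"
  show "D v = \<alpha> * v + \<beta> * cnj v" for v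
  proof -
    have "D v = D (Re v *\<^sub>R 1 + Im v *\<^sub>R \<i>)"
      by (metis complex_eq mult.commute scaleR_conv_of_real mult.right_neutral)
    also have "\<dots> = Re v *\<^sub>R D 1 + Im v *\<^sub>R D \<i>"
      using assms by (simp add: linear_add linear_scale)
    also have "\<dots> = \<alpha> * v + \<beta> * cnj v"
      by (simp add: \<alpha>_def \<beta>_def complex_eq_iff field_simps)
    finally show ?thesis .
  qed
  show "planar_det (D 1) (D \<i>) = (cmod \<alpha>)\<^sup>2 - (cmod \<beta>)\<^sup>2"
    unfolding \<alpha>_def \<beta>_def cmod_power2
    by (simp add: planar_det_def field_simps power2_eq_square)
qed

lemma linear_injective_of_planar_det:
  assumes "linear D" "planar_det (D 1) (D \<i>) \<noteq> 0" "v \<noteq> 0"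
  shows "D v \<noteq> 0"
proof -
  obtain \<alpha> \<beta> where ab: "\<And>v. D v = \<alpha> * v + \<beta> * cnj v"
    "planar_det (D 1) (D \<i>) = (cmod \<alpha>)\<^sup>2 - (cmod \<beta>)\<^sup>2"
    using planar_det_linear[OF assms(1)] by blast
  show ?thesis
  proof
    assume "D v = 0"
    then have "\<alpha> * v = - (\<beta> * cnj v)" using ab(1) by (simp add: eq_neg_iff_add_eq_0)
    then have "cmod (\<alpha> * v) = cmod (\<beta> * cnj v)" by simp
    then have "cmod \<alpha> = cmod \<beta>" using assms(3) by (simp add: norm_mult)
    then show False using assms(2) ab(2) by simp
  qed
qed

text \<open>The dominant one of the two Wirtinger terms determines the winding number: the other
  term can be divided out without the quotient going around 0.\<close>

lemma winding_number_linear: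
  assumes "linear D" "planar_det (D 1) (D \<i>) \<noteq> 0" "path p" "0 \<notin> path_image p" "pathfinish p = pathstart p"
    and "winding_number p 0 = 1"
  shows "winding_number (\<lambda>t. D (p t)) 0 = sgn (planar_det (D 1) (D \<i>))"
proof -
  obtain \<alpha> \<beta> where ab: "\<And>v. D v = \<alpha> * v + \<beta> * cnj v"
    "planar_det (D 1) (D \<i>) = (cmod \<alpha>)\<^sup>2 - (cmod \<beta>)\<^sup>2"
    using planar_det_linear[OF assms(1)] by blast
  have aux: "winding_number (\<lambda>t. a * q t + b * cnj (q t)) 0 = winding_number q 0"
    if ab: "cmod b < cmod a" and q: "path q" "0 \<notin> path_image q" "pathfinish q = pathstart q"
    for a b q
  proof -
    have a0: "a \<noteq> 0" using ab by auto
    have q0: "t \<in> {0..1} \<Longrightarrow> q t \<noteq> 0" for t using q(2) by (auto simp: path_image_def)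
    have cq: "continuous_on {0..1} q" using q(1) by (simp add: path_def)
    have p1: "path (\<lambda>t. a * q t)" "0 \<notin> path_image (\<lambda>t. a * q t)"
      using q a0 cq by (auto simp: path_def path_image_def intro!: continuous_intros)
    \<comment> \<open>The factorisation is \<open>a * q + b * cnj q = (a * q) * r\<close>. As
      \<open>cnj q / q\<close> has modulus 1 and \<open>cmod b < cmod a\<close>, \<open>r\<close>
      stays in the unit disc about 1, which omits 0.\<close>
    define r where "r = (\<lambda>t. 1 + (b / a) * (cnj (q t) / q t))"
    have pr: "path r" unfolding path_def r_def
      by (intro continuous_intros cq) (use q0 a0 in auto)
    have rball: "path_image r \<subseteq> ball 1 1"
      using q0 ab a0 by (auto simp: path_image_def r_def dist_norm norm_mult norm_divide)
    have r0: "0 \<notin> path_image r" using rball by auto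
    have "winding_number (\<lambda>t. id (r t)) 0 = 0"
      by (rule winding_number_log[where S="ball 1 1"])
        (use pr rball q(3) in \<open>auto simp: convex_imp_contractible r_def pathfinish_def pathstart_def\<close>)
    then have wr: "winding_number r 0 = 0" by simp
    have wc: "winding_number (\<lambda>t. a * q t) 0 = winding_number q 0"
    proof -
      have "winding_number (\<lambda>t. (\<lambda>_. a) t * q t) 0 = winding_number (\<lambda>_. a) 0 + winding_number q 0"
        by (rule winding_number_times) (use a0 q in \<open>auto simp: path_def path_image_def\<close>)
      then show ?thesis using a0 by (simp add: winding_number_zero_const)
    qed
    have "winding_number (\<lambda>t. a * q t + b * cnj (q t)) 0 = winding_number (\<lambda>t. (a * q t) * r t) 0"
      by (rule winding_number_cong) (use q0 a0 in \<open>auto simp: r_def field_simps\<close>)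
    also have "\<dots> = winding_number q 0"
      using winding_number_times[OF p1(1) pr p1(2) r0] wr wc by simp
    finally show ?thesis .
  qed
  show ?thesis
  proof (cases "cmod \<beta> < cmod \<alpha>")
    case True
    then have "sgn (planar_det (D 1) (D \<i>)) = 1"
      unfolding ab(2) by (simp add: power_strict_mono)
    then show ?thesis using aux[OF True assms(3-5)] assms(6) ab(1) by simp
  next
    case False
    then have lt: "cmod \<alpha> < cmod \<beta>" using assms(2) ab(2) by force
    have "sgn (planar_det (D 1) (D \<i>)) = -1"
      unfolding ab(2) using lt by (simp add: power_strict_mono)
    \<comment> \<open>In the reversing case the roles are exchanged: \<open>D (p t)\<close> is
      \<open>\<beta>\<close> times \<open>cnj (p t)\<close> plus \<open>\<alpha>\<close> times the
      conjugate of that, and conjugation negates the winding number.\<close>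
    moreover have "winding_number (\<lambda>t. \<beta> * (cnj \<circ> p) t + \<alpha> * cnj ((cnj \<circ> p) t)) 0 = winding_number (cnj \<circ> p) 0"
      by (rule aux[OF lt]) (use assms in \<open>auto simp: pathfinish_def pathstart_def path_image_def path_def intro!: continuous_intros\<close>)
    moreover have "winding_number (cnj \<circ> p) (cnj 0) = -1"
      unfolding winding_number_cnj[OF assms(3,4)] using assms(6) by simp
    ultimately show ?thesis by (simp add: ab(1) add.commute)
  qed
qed

lemma linear_bounded_below:
  assumes "linear D" "planar_det (D 1) (D \<i>) \<noteq> 0"
  obtains m where "m > 0" "\<And>v. m * cmod v \<le> cmod (D v)"
  using linear_inj_bounded_below_pos[of D] linear_injective_of_planar_det[OF assms]
  by (metis assms(1) linear_injective_0)

text \<open>The linearisation is bounded below by a multiple of \<open>cmod (x - j)\<close>, so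
  dividing the first-order error by it still gives something that tends to 0. This limit lets a
  quotient by linearisations be extended continuously over a zero.\<close>

lemma tendsto_divide_derivative:
  assumes "(F has_derivative D) (at j)" "F j = 0" "planar_det (D 1) (D \<i>) \<noteq> 0"
  shows "((\<lambda>x. F x / D (x - j)) \<longlongrightarrow> 1) (at j)"
proof -
  have lin: "linear D" using assms(1) has_derivative_linear by blast
  obtain m where m: "m > 0" "\<And>v. m * cmod v \<le> cmod (D v)"
    using linear_bounded_below[OF lin assms(3)] by blast
  have lim: "((\<lambda>x. norm (F x - F j - D (x - j)) / norm (x - j)) \<longlongrightarrow> 0) (at j)"
    using assms(1) unfolding has_derivative_iff_norm by simp
  have "((\<lambda>x. F x / D (x - j) - 1) \<longlongrightarrow> 0) (at j)"
  proof (rule Lim_null_comparison)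
    show "\<forall>\<^sub>F x in at j. norm (F x / D (x - j) - 1) \<le> (norm (F x - F j - D (x - j)) / norm (x - j)) / m"
      unfolding eventually_at
    proof (intro exI[of _ 1] conjI ballI impI)
      fix x assume "x \<noteq> j \<and> dist x j < 1"
      then have x: "x - j \<noteq> 0" by auto
      have D0: "D (x - j) \<noteq> 0" using linear_injective_of_planar_det[OF lin assms(3) x] .
      have "norm (F x / D (x - j) - 1) = norm (F x - D (x - j)) / norm (D (x - j))"
        using D0 by (simp add: norm_divide[symmetric] diff_divide_distrib)
      also have "\<dots> \<le> norm (F x - D (x - j)) / (m * norm (x - j))"
        using m x D0 by (intro divide_left_mono) (auto intro!: mult_pos_pos simp del: norm_minus_commute)
      finally show "norm (F x / D (x - j) - 1) \<le> (norm (F x - F j - D (x - j)) / norm (x - j)) / m"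
        using assms(2) by (simp add: field_simps)
    qed simp
    show "((\<lambda>x. (norm (F x - F j - D (x - j)) / norm (x - j)) / m) \<longlongrightarrow> 0) (at j)"
      using tendsto_divide[OF lim tendsto_const[of m]] m(1) by simp
  qed
  then show ?thesis by (simp add: LIM_zero_iff)
qed

text \<open>Infinitely many zeros would accumulate at some \<open>j\<close>, itself a zero by
  closedness. There \<open>F x / D j (x - j)\<close> tends to 1, although it vanishes at zeros
  arbitrarily close to \<open>j\<close>.\<close>

lemma finite_nondegenerate_zeros:
  assumes "compact S" "continuous_on S F"
    and "\<And>x. x \<in> S \<Longrightarrow> F x = 0 \<Longrightarrow> (F has_derivative D x) (at x) \<and> planar_det (D x 1) (D x \<i>) \<noteq> 0"
  shows "finite {x \<in> S. F x = 0}"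
proof (rule ccontr)
  let ?Z = "{x \<in> S. F x = 0}"
  assume "infinite ?Z"
  then obtain j where j: "j \<in> S" "j islimpt ?Z"
    using assms(1) unfolding compact_eq_Bolzano_Weierstrass by (metis (no_types, lifting) mem_Collect_eq subsetI)
  have "closed ?Z"
    using continuous_closed_preimage_constant[OF assms(2) compact_imp_closed[OF assms(1)], of 0] by simp
  then have Fj: "F j = 0" using j(2) closed_limpt by blast
  have "\<forall>\<^sub>F x in at j. dist (F x / D j (x - j)) 1 < 1"
    using tendsto_divide_derivative[of F "D j" j] assms(3)[OF j(1) Fj] Fj
    by (metis tendstoD zero_less_one)
  then obtain d where d: "d > 0" "\<And>x. x \<noteq> j \<Longrightarrow> dist x j < d \<Longrightarrow> dist (F x / D j (x - j)) 1 < 1"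
    unfolding eventually_at by blast
  obtain x where "x \<in> ?Z" "x \<noteq> j" "dist x j < d"
    using j(2) d(1) unfolding islimpt_approachable by blast
  then show False using d(2)[of x] by simp
qed

text \<open>Dividing \<open>F\<close> by the linearisations at its zeros leaves a continuous function without zeros,
  which has a continuous logarithm on the rectangle.\<close>

proposition winding_number_rectangle_zeros:
  assumes ab: "Re a < Re b" "Im a < Im b" and cont: "continuous_on (cbox a b) F"
    and bd: "\<And>x. x \<in> cbox a b \<Longrightarrow> F x = 0 \<Longrightarrow> x \<in> box a b"
    and der: "\<And>x. x \<in> cbox a b \<Longrightarrow> F x = 0 \<Longrightarrow>
       (F has_derivative D x) (at x) \<and> planar_det (D x 1) (D x \<i>) \<noteq> 0"
  shows "winding_number (F \<circ> rectpath a b) 0 =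
     (\<Sum>x | x \<in> cbox a b \<and> F x = 0. of_real (sgn (planar_det (D x 1) (D x \<i>))))"
proof -
  define Z where "Z = {x \<in> cbox a b. F x = 0}"
  have fin: "finite Z"
    unfolding Z_def by (rule finite_nondegenerate_zeros[OF compact_cbox cont der])
  have Zder: "(F has_derivative D j) (at j)" "planar_det (D j 1) (D j \<i>) \<noteq> 0" "linear (D j)" 
      "F j = 0" "j \<in> box a b" if "j \<in> Z" for j
    using that der bd has_derivative_linear unfolding Z_def by blast+
  have D0: "D j (x - j) \<noteq> 0" if "j \<in> Z" "x \<noteq> j" for x j
    using linear_injective_of_planar_det[of "D j" "x - j"] Zder that by auto
  have contD: "continuous_on S (\<lambda>x. D j (x - j))" if "j \<in> Z" for j and S :: "complex set"
    using linear_continuous_on_compose[of S "\<lambda>x. x - j" "D j"] Zder(3)[OF that] 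
    by (simp add: continuous_intros)
  define P where "P = (\<lambda>x. \<Prod>j\<in>Z. D j (x - j))"
  \<comment> \<open>At a zero \<open>x\<close> the quotient \<open>F y / D x (y - x)\<close> tends
    to 1, so the continuous value of \<open>F / P\<close> is the reciprocal of the remaining
    factors.\<close>
  define Q where "Q = (\<lambda>x. if x \<in> Z then 1 / (\<Prod>k\<in>Z - {x}. D k (x - k)) else F x / P x)"
  have P0: "P x \<noteq> 0" if "x \<notin> Z" for x
    unfolding P_def using fin D0 that by (metis prod_zero_iff)
  have Q0: "Q x \<noteq> 0" if "x \<in> cbox a b" for x
    using that P0 fin D0 by (auto simp: Q_def Z_def)
  have contQ: "continuous_on (cbox a b) Q"
    unfolding continuous_on_eq_continuous_within
  proof
    fix x assume x: "x \<in> cbox a b"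
    show "continuous (at x within cbox a b) Q"
    proof (cases "x \<in> Z")
      case True
      let ?R = "\<lambda>y. (F y / D x (y - x)) * (1 / (\<Prod>k\<in>Z - {x}. D k (y - k)))"
      have "((\<lambda>y. (\<Prod>k\<in>Z - {x}. D k (y - k))) \<longlongrightarrow> (\<Prod>k\<in>Z - {x}. D k (x - k))) (at x)"
        using contD[of _ UNIV] by (intro tendsto_prod) (auto simp: continuous_on_eq_continuous_at isCont_def)
      then have "(?R \<longlongrightarrow> 1 * (1 / (\<Prod>k\<in>Z - {x}. D k (x - k)))) (at x)"
        using fin D0[of _ x] 
        by (intro tendsto_mult tendsto_divide tendsto_divide_derivative tendsto_const Zder[OF True])
           (auto simp: prod_zero_iff)
      then have lim: "(?R \<longlongrightarrow> Q x) (at x)" using True by (simp add: Q_def)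
      have "\<forall>\<^sub>F y in at x. y \<notin> Z"
        using islimpt_finite[OF fin, of x] unfolding islimpt_iff_eventually by simp
      then have "\<forall>\<^sub>F y in at x. ?R y = Q y"
      proof eventually_elim
        case (elim y)
        have "P y = D x (y - x) * (\<Prod>k\<in>Z - {x}. D k (y - k))"
          unfolding P_def using True fin by (simp add: prod.remove)
        then show ?case using elim by (simp add: Q_def)
      qed
      then have "(Q \<longlongrightarrow> Q x) (at x)" using lim tendsto_cong by force
      then show ?thesis
        using continuous_at_imp_continuous_at_within isCont_def by blast
    next
      case False
      have c: "continuous (at x within cbox a b) (\<lambda>y. F y / P y)"
        using cont x P0[OF False] contD unfolding P_def
        by (intro continuous_intros) (auto simp: continuous_on_eq_continuous_within)
      have "\<forall>\<^sub>F y in at x within cbox a b. y \<notin> Z"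
        using islimpt_finite[OF fin, of x] filter_leD[OF at_le[of "cbox a b" UNIV x]]
        unfolding islimpt_iff_eventually by auto
      then have "\<forall>\<^sub>F y in at x within cbox a b. F y / P y = Q y"
        by eventually_elim (simp add: Q_def)
      then show ?thesis
        using c False tendsto_cong[of "\<lambda>y. F y / P y" Q] unfolding continuous_within by (auto simp: Q_def)
    qed
  qed
  let ?p = "rectpath a b"
  have im: "path_image ?p = cbox a b - box a b"
    using ab by (simp add: path_image_rectpath_cbox_minus_box)
  have pbox: "?p t \<in> cbox a b" "?p t \<notin> Z" if "t \<in> {0..1}" for t
    using im that bd unfolding Z_def path_image_def by blast+
  have cp: "continuous_on {0..1} ?p" using path_rectpath path_def by blast
  have wQ: "winding_number (\<lambda>t. Q (?p t)) 0 = 0"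
    by (rule winding_number_log[OF contQ _ Q0]) (use im in \<open>auto intro: convex_imp_contractible\<close>)
  have pQ: "path (\<lambda>t. Q (?p t))" "0 \<notin> path_image (\<lambda>t. Q (?p t))"
    using continuous_on_compose2[OF contQ cp] pbox(1) Q0[OF pbox(1)] by (auto simp: path_def path_image_def image_subset_iff)
  have wD: "winding_number (\<lambda>t. D j (?p t - j)) 0 = of_real (sgn (planar_det (D j 1) (D j \<i>)))"
    and pD: "path (\<lambda>t. D j (?p t - j))" "0 \<notin> path_image (\<lambda>t. D j (?p t - j))" if "j \<in> Z" for j
  proof -
    have n0: "0 \<notin> path_image (\<lambda>t. ?p t - j)"
      using pbox(2) that by (auto simp: path_image_def)
    have "winding_number (\<lambda>t. ?p t - j) 0 = 1"
      using winding_number_rectpath[OF Zder(5)[OF that]] by (simp add: winding_number_offset[symmetric])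
    moreover have "path (\<lambda>t. ?p t - j)" using cp by (simp add: path_def continuous_intros)
    moreover have "pathfinish (\<lambda>t. ?p t - j) = pathstart (\<lambda>t. ?p t - j)"
      using pathstart_rectpath[of a b] pathfinish_rectpath[of a b] by (simp only: pathfinish_def pathstart_def)
    ultimately show "winding_number (\<lambda>t. D j (?p t - j)) 0 = of_real (sgn (planar_det (D j 1) (D j \<i>)))"
      using n0 Zder(2,3)[OF that] by (intro winding_number_linear)
    show "path (\<lambda>t. D j (?p t - j))"
      using continuous_on_compose2[OF contD[OF that, of UNIV] cp] by (simp add: path_def)
    show "0 \<notin> path_image (\<lambda>t. D j (?p t - j))"
      using D0[OF that] pbox(2) that by (fastforce simp: path_image_def)
  qed
  have PP: "path (\<lambda>t. P (?p t))" "0 \<notin> path_image (\<lambda>t. P (?p t))"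
    "winding_number (\<lambda>t. P (?p t)) 0 = (\<Sum>j\<in>Z. of_real (sgn (planar_det (D j 1) (D j \<i>))))"
    using winding_number_prod[of Z "\<lambda>j t. D j (?p t - j)", OF fin pD] wD unfolding P_def by auto
  have "winding_number (F \<circ> ?p) 0 = winding_number (\<lambda>t. Q (?p t) * P (?p t)) 0"
    by (rule winding_number_cong) (use pbox P0 in \<open>auto simp: Q_def\<close>)
  also have "\<dots> = (\<Sum>j\<in>Z. of_real (sgn (planar_det (D j 1) (D j \<i>))))"
    using winding_number_times[OF pQ(1) PP(1) pQ(2) PP(2)] wQ PP(3) by simp
  finally show ?thesis unfolding Z_def by simp
qed

section \<open>The secant map of a periodic curve\<close>

text \<open>The pair \<open>(s, t)\<close> is encoded as the complex number with real part
  \<open>s\<close> and imaginary part \<open>t - s\<close>; the strip becomes the set of points with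
  imaginary part in [0,1] and the diagonal the real axis.\<close>

definition secant :: "(real \<Rightarrow> complex) \<Rightarrow> (real \<Rightarrow> complex) \<Rightarrow> complex \<Rightarrow> complex" where
  "secant g g' x = (if Im x = 0 then g' (Re x) else (g (Re x + Im x) - g (Re x)) / of_real (Im x))"

text \<open>The mean value inequality for \<open>g\<close> minus its linear part at
  \<open>s\<close>. The bound is uniform in the length of the chord, which gives continuity of
  \<open>secant\<close> on the diagonal from continuity of \<open>g'\<close> alone.\<close>

lemma secant_tangent_bound:
  assumes der: "\<And>t. (g has_vector_derivative g' t) (at t)"
    and B: "\<And>r. \<bar>r - s\<bar> < d \<Longrightarrow> cmod (g' r - g' s) \<le> B" and "d > 0"
    and x: "\<bar>Re x - s\<bar> < d" "\<bar>Re x + Im x - s\<bar> < d"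
  shows "cmod (secant g g' x - g' s) \<le> B"
proof (cases "Im x = 0")
  case True
  then show ?thesis using B x by (simp add: secant_def)
next
  case False
  let ?t = "Re x + Im x"
  have sub: "closed_segment (Re x) ?t \<subseteq> {s - d<..<s + d}"
    using x by (auto simp: closed_segment_eq_real_ivl abs_less_iff)
  have "norm (g ?t - g (Re x) - (?t - Re x) *\<^sub>R g' s) \<le> norm (?t - Re x) * B"
  proof (rule vector_differentiable_bound_linearization[where S="{s - d<..<s + d}"])
    show "(g has_vector_derivative g' r) (at r within {s - d<..<s + d})" for r
      using der has_vector_derivative_at_within by blast
    show "norm (g' r - g' s) \<le> B" if "r \<in> {s - d<..<s + d}" for r
      using that B by (auto simp: abs_less_iff)
  qed (use sub \<open>d > 0\<close> in auto)
  then have le: "norm (g ?t - g (Re x) - of_real (Im x) * g' s) \<le> \<bar>Im x\<bar> * B"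
    by (simp add: scaleR_conv_of_real)
  have "secant g g' x - g' s = (g ?t - g (Re x) - of_real (Im x) * g' s) / of_real (Im x)"
    using False by (simp add: secant_def field_simps)
  then have "cmod (secant g g' x - g' s) = norm (g ?t - g (Re x) - of_real (Im x) * g' s) / \<bar>Im x\<bar>"
    by (simp add: norm_divide)
  also have "\<dots> \<le> B" using le False by (simp add: field_simps)
  finally show ?thesis .
qed

lemma continuous_on_secant:
  assumes der: "\<And>t. (g has_vector_derivative g' t) (at t)" and cont: "continuous_on UNIV g'"
  shows "continuous_on UNIV (secant g g')"
  unfolding continuous_on_eq_continuous_at[OF open_UNIV]
proof
  fix x :: complex
  have cg: "continuous_on UNIV g"
    using der has_vector_derivative_continuous continuous_at_imp_continuous_on by blast
  show "isCont (secant g g') x"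
  proof (cases "Im x = 0")
    case False
    have c: "isCont (\<lambda>x. (g (Re x + Im x) - g (Re x)) / of_real (Im x)) x"
    proof -
      have g: "isCont g t" for t using cg continuous_on_eq_continuous_at open_UNIV by blast
      have "isCont (\<lambda>x. g (Re x + Im x)) x" "isCont (\<lambda>x. g (Re x)) x"
        by (rule isCont_o2[OF _ g]; intro isCont_add isCont_Re isCont_Im continuous_ident)+
      then show ?thesis using False by (intro continuous_intros) auto
    qed
    have "\<forall>\<^sub>F y in at x. Im y \<noteq> 0"
      by (rule tendsto_imp_eventually_ne[OF _ False]) (intro tendsto_intros)
    then have "\<forall>\<^sub>F y in at x. (g (Re y + Im y) - g (Re y)) / of_real (Im y) = secant g g' y"
      by eventually_elim (simp add: secant_def)
    then have "(secant g g' \<longlongrightarrow> (g (Re x + Im x) - g (Re x)) / of_real (Im x)) (at x)"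
      using c tendsto_cong unfolding isCont_def by fastforce
    then show ?thesis using False by (simp add: isCont_def secant_def)
  next
    case True
    show ?thesis
      unfolding continuous_at_eps_delta
    proof (intro allI impI)
      fix e :: real assume e: "e > 0"
      have "isCont g' (Re x)" using cont continuous_on_eq_continuous_at open_UNIV by blast
      then obtain d where d: "d > 0" "\<And>r. \<bar>r - Re x\<bar> < d \<Longrightarrow> cmod (g' r - g' (Re x)) < e / 2"
        using e unfolding continuous_at_eps_delta dist_norm by (metis half_gt_zero real_norm_def)
      show "\<exists>d>0. \<forall>x'. dist x' x < d \<longrightarrow> dist (secant g g' x') (secant g g' x) < e"
      proof (intro exI[of _ "d/2"] conjI allI impI)
        fix y assume y: "dist y x < d / 2"
        have a: "\<bar>Re y - Re x\<bar> < d / 2" "\<bar>Im y - Im x\<bar> < d / 2"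
          using y abs_Re_le_cmod[of "y - x"] abs_Im_le_cmod[of "y - x"] by (auto simp: dist_norm)
        have "cmod (secant g g' y - g' (Re x)) \<le> e / 2"
          by (rule secant_tangent_bound[where d=d, OF der less_imp_le[OF d(2)] d(1)]) (use a True in linarith)+
        then show "dist (secant g g' y) (secant g g' x) < e"
          using e True by (simp add: dist_norm secant_def)
      qed (use d in simp)
    qed
  qed
qed

text \<open>The term of the quotient rule that differentiates the denominator carries the numerator
  as a factor, and the numerator vanishes at a zero.\<close>

lemma has_derivative_secant_zero:
  assumes der: "\<And>t. (g has_vector_derivative g' t) (at t)"
    and x: "Im x \<noteq> 0" "secant g g' x = 0"
  shows "(secant g g' has_derivative (\<lambda>v. ((Re v + Im v) *\<^sub>R g' (Re x + Im x) - Re v *\<^sub>R g' (Re x)) / of_real (Im x))) (at x)"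
proof -
  have d: "(g has_derivative (\<lambda>h. h *\<^sub>R g' t)) (at t)" for t
    using der by (simp add: has_vector_derivative_def)
  have H: "((\<lambda>y. g (Re y + Im y) - g (Re y)) has_derivative
     (\<lambda>v. (Re v + Im v) *\<^sub>R g' (Re x + Im x) - Re v *\<^sub>R g' (Re x))) (at x)"
    by (intro has_derivative_diff has_derivative_compose[OF _ d] derivative_intros)
  have I: "((\<lambda>y. complex_of_real (Im y)) has_derivative (\<lambda>v. of_real (Im v))) (at x)"
    by (intro derivative_intros)
  have "((\<lambda>y. (g (Re y + Im y) - g (Re y)) / of_real (Im y)) has_derivative
     (\<lambda>v. ((Re v + Im v) *\<^sub>R g' (Re x + Im x) - Re v *\<^sub>R g' (Re x)) / of_real (Im x))) (at x)"
    by (rule has_derivative_eq_rhs[OF has_derivative_divide'[OF H I]]) (use x in \<open>auto simp: secant_def fun_eq_iff\<close>)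
  then show ?thesis
  proof (rule has_derivative_transform_eventually)
    have "\<forall>\<^sub>F y in at x. Im y \<noteq> 0"
      by (rule tendsto_imp_eventually_ne[OF _ x(1)]) (intro tendsto_intros)
    then show "\<forall>\<^sub>F y in at x. (g (Re y + Im y) - g (Re y)) / of_real (Im y) = secant g g' y"
      by eventually_elim (simp add: secant_def)
  qed (use x in \<open>auto simp: secant_def\<close>)
qed

lemma planar_det_simps:
  "planar_det u u = 0"
  "planar_det (u - w) v = planar_det u v - planar_det w v"
  "planar_det (u / of_real r) (v / of_real r) = planar_det u v / r\<^sup>2"
  by (auto simp: planar_det_def algebra_simps power2_eq_square add_divide_distrib diff_divide_distrib Re_divide Im_divide)

text \<open>The increment over one period, divided by \<open>2 * pi\<close>, is continuous and
  integer valued, hence constant. So the turning may be measured from any starting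
  parameter.\<close>

lemma angle_lift_shift:
  assumes cont: "continuous_on UNIV \<theta>" and "\<And>t. cis (\<theta> (t + 1)) = cis (\<theta> t)"
  shows "\<theta> (s + 1) - \<theta> s = \<theta> 1 - \<theta> (0::real)"
proof -
  define \<delta> where "\<delta> t = (\<theta> (t + 1) - \<theta> t) / (2 * pi)" for t
  have int: "\<delta> t \<in> \<int>" for t
  proof -
    have "cis (\<theta> (t + 1) - \<theta> t) = 1"
      using assms(2)[of t] by (simp flip: cis_divide)
    then obtain n :: int where "\<theta> (t + 1) - \<theta> t = 2 * pi * n"
      by (auto simp: cis_conv_exp exp_eq_1 mult_ac)
    then show ?thesis by (simp add: \<delta>_def)
  qed
  have "\<delta> constant_on UNIV"
  proof (rule continuous_discrete_range_constant)
    show "continuous_on UNIV \<delta>" unfolding \<delta>_def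
      using cont by (intro continuous_intros continuous_on_compose2[OF cont]) auto
    show "\<exists>e>0. \<forall>y. y \<in> UNIV \<and> \<delta> y \<noteq> \<delta> x \<longrightarrow> e \<le> norm (\<delta> y - \<delta> x)" for x
      using int by (intro exI[of _ 1]) (metis Ints_diff Ints_nonzero_abs_ge1 diff_eq_diff_eq diff_self real_norm_def zero_less_one)
  qed simp
  then have "\<delta> s = \<delta> 0" by (metis UNIV_I constant_on_def)
  then show ?thesis by (simp add: \<delta>_def)
qed

definition self_crossings :: "(real \<Rightarrow> complex) \<Rightarrow> real \<Rightarrow> (real \<times> real) set" where
  "self_crossings g s0 = {(s, t). s0 \<le> s \<and> s < s0 + 1 \<and> s < t \<and> t < s + 1 \<and> g s = g t}"

text \<open>The zeros are counted on a fundamental rectangle of \<open>0 \<le> t - s \<le> 1\<close>, whose lateral sides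
  cancel by periodicity; \<open>s0\<close> is chosen so that no zero lies on them.\<close>

proposition turning_eq_crossings:
  fixes g :: "real \<Rightarrow> complex"
  assumes der: "\<And>t. (g has_vector_derivative g' t) (at t)" and cont: "continuous_on UNIV g'"
    and nz: "\<And>t. g' t \<noteq> 0" and per: "\<And>t. g (t + 1) = g t + b" and "b \<noteq> 0"
    and transv: "\<And>s t. s < t \<Longrightarrow> t < s + 1 \<Longrightarrow> g s = g t \<Longrightarrow> planar_det (g' s) (g' t) \<noteq> 0"
    and cont_\<theta>: "continuous_on UNIV \<theta>" and angle: "\<And>t. sgn (g' t) = cis (\<theta> t) * u"
  obtains s0 where "finite (self_crossings g s0)"
    "(\<theta> 1 - \<theta> 0) / (2 * pi) = (\<Sum>(s,t)\<in>self_crossings g s0. - sgn (planar_det (g' s) (g' t)))"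
proof -
  define F where "F = secant g g'"
  define D where "D x = (\<lambda>v. ((Re v + Im v) *\<^sub>R g' (Re x + Im x) - Re v *\<^sub>R g' (Re x)) / of_real (Im x))" for x
  have contF: "continuous_on S F" for S
    unfolding F_def using continuous_on_secant[OF der cont] continuous_on_subset by blast
  have g'per: "g' (t + 1) = g' t" for t
  proof -
    have "((\<lambda>t. g (t + 1)) has_vector_derivative g' (t + 1)) (at t)"
    proof -
      have "((\<lambda>t::real. t + 1) has_vector_derivative 1) (at t)" by (auto intro!: derivative_eq_intros)
      from vector_diff_chain_at[OF this der] show ?thesis by (simp add: o_def)
    qed
    moreover have "((\<lambda>t. g t + b) has_vector_derivative g' t) (at t)"
      by (rule has_vector_derivative_eq_rhs[OF has_vector_derivative_add[OF der has_vector_derivative_const]]) simp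
    ultimately show ?thesis using vector_derivative_unique_at per by (metis (no_types, lifting) ext)
  qed
  have F0: "F x \<noteq> 0" if "Im x = 0" for x using that nz by (simp add: F_def secant_def)
  have F1: "F x = b" if "Im x = 1" for x using that per by (simp add: F_def secant_def)
  have Fper: "F (x + 1) = F x" for x using per[of "Re x"] per[of "Re x + Im x"] g'per[of "Re x"] by (simp add: F_def secant_def algebra_simps)
  have zero_iff: "F x = 0 \<longleftrightarrow> g (Re x) = g (Re x + Im x)" if "Im x \<noteq> 0" for x
    using that by (auto simp: F_def secant_def)
  have strict: "0 < Im x \<and> Im x < 1" if "F x = 0" "0 \<le> Im x" "Im x \<le> 1" for x
    using that F0 F1 \<open>b \<noteq> 0\<close> by (metis order_le_less)
  \<comment> \<open>With \<open>u = g' s\<close> and \<open>v = g' t\<close>, the columns are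
    \<open>v - u\<close> and \<open>v\<close> up to the factor \<open>1 / (t - s)\<close>, and the
    determinant of \<open>v - u\<close> and \<open>v\<close> is minus that of \<open>u\<close> and
    \<open>v\<close>. So the sign of the Jacobian is exactly the crossing sign.\<close>
  have det: "planar_det (D x 1) (D x \<i>) = - planar_det (g' (Re x)) (g' (Re x + Im x)) / (Im x)\<^sup>2" for x
  proof -
    have "D x 1 = (g' (Re x + Im x) - g' (Re x)) / of_real (Im x)" "D x \<i> = g' (Re x + Im x) / of_real (Im x)"
      by (simp_all add: D_def)
    then show ?thesis by (simp add: planar_det_simps)
  qed
  have dd: "(F has_derivative D x) (at x) \<and> planar_det (D x 1) (D x \<i>) \<noteq> 0"
    if "F x = 0" "0 \<le> Im x" "Im x \<le> 1" for x
  proof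
    have i: "0 < Im x" "Im x < 1" using strict that by auto
    show "(F has_derivative D x) (at x)"
      using has_derivative_secant_zero[OF der] i that(1) unfolding F_def D_def by simp
    show "planar_det (D x 1) (D x \<i>) \<noteq> 0"
      unfolding det using transv[of "Re x" "Re x + Im x"] i zero_iff that(1) by auto
  qed
  have finZ: "finite {x \<in> cbox (Complex r 0) (Complex (r + 1) 1). F x = 0}" for r
    by (rule finite_nondegenerate_zeros[OF compact_cbox contF dd]) (auto simp: in_cbox_complex_iff)
  \<comment> \<open>Only finitely many zeros have their base parameter in [0,1], so some
    \<open>s0\<close> avoids all of them; by \<open>Fper\<close> the side at \<open>s0 + 1\<close>
    avoids zeros as well.\<close>
  have "infinite {0<..<1::real}" by simp
  then obtain s0 where s0: "s0 \<in> {0<..<1}" "s0 \<notin> Re ` {x \<in> cbox (Complex 0 0) (Complex (0 + 1) 1). F x = 0}"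
    using finite_imageI[OF finZ[of 0], of Re] by (meson finite_subset subsetI)
  have side0: "F x \<noteq> 0" if "Re x = s0" "0 \<le> Im x" "Im x \<le> 1" for x
    using s0 that by (auto simp: in_cbox_complex_iff image_iff)
  have side1: "F x \<noteq> 0" if "Re x = s0 + 1" "0 \<le> Im x" "Im x \<le> 1" for x
    using side0[of "x - 1"] Fper[of "x - 1"] that by auto
  let ?a1 = "Complex s0 0" and ?a2 = "Complex (s0 + 1) 0" and ?a3 = "Complex (s0 + 1) 1" and ?a4 = "Complex s0 1"
  have bdry: "x \<in> box ?a1 ?a3" if "x \<in> cbox ?a1 ?a3" "F x = 0" for x
    using that strict[of x] side0[of x] side1[of x] by (fastforce simp: in_cbox_complex_iff in_box_complex_iff order_le_less)
  have sum: "winding_number (F \<circ> rectpath ?a1 ?a3) 0 =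
     (\<Sum>x | x \<in> cbox ?a1 ?a3 \<and> F x = 0. of_real (sgn (planar_det (D x 1) (D x \<i>))))"
    by (rule winding_number_rectangle_zeros[OF _ _ contF bdry]) (use dd in \<open>auto simp: in_cbox_complex_iff\<close>)
  let ?l1 = "F \<circ> linepath ?a1 ?a2" and ?l2 = "F \<circ> linepath ?a2 ?a3"
    and ?l3 = "F \<circ> linepath ?a3 ?a4" and ?l4 = "F \<circ> linepath ?a4 ?a1"
  have line: "linepath ?a1 ?a2 t = Complex (s0 + t) 0" "linepath ?a2 ?a3 t = Complex (s0 + 1) t"
    "linepath ?a3 ?a4 t = Complex (s0 + 1 - t) 1" "linepath ?a4 ?a1 t = Complex s0 (1 - t)" for t
    by (auto simp: linepath_def complex_eq_iff algebra_simps)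
  have pl: "path (F \<circ> linepath x y)" for x y by (rule path_continuous_image[OF path_linepath contF])
  have n0: "0 \<notin> path_image ?l1" "0 \<notin> path_image ?l2" "0 \<notin> path_image ?l3" "0 \<notin> path_image ?l4"
    using F0 F1 \<open>b \<noteq> 0\<close> side0 side1 unfolding path_image_def by (auto simp: line)
  have "winding_number (F \<circ> rectpath ?a1 ?a3) 0 =
      winding_number ?l1 0 + winding_number ?l2 0 + winding_number ?l3 0 + winding_number ?l4 0"
    unfolding rectpath_def Let_def path_compose_join complex.sel using n0 pl
    by (simp add: winding_number_join path_image_join pathfinish_compose pathstart_compose)
  also have "winding_number ?l3 0 = 0"
  proof -
    have "winding_number ?l3 0 = winding_number (\<lambda>t. b) 0"
      by (rule winding_number_cong) (simp add: line F1)
    then show ?thesis using \<open>b \<noteq> 0\<close> by (simp add: winding_number_zero_const)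
  qed
  also have "winding_number ?l4 0 = - winding_number ?l2 0"
  proof -
    have "winding_number ?l4 0 = winding_number (reversepath ?l2) 0"
    proof (rule winding_number_cong)
      fix t :: real
      have "Complex s0 (1 - t) + 1 = Complex (s0 + 1) (1 - t)" by (simp add: complex_eq_iff)
      then show "?l4 t = reversepath ?l2 t"
        using Fper[of "Complex s0 (1 - t)"] by (simp add: line reversepath_def)
    qed
    then show ?thesis using winding_number_reversepath[OF pl n0(2)] by simp
  qed
  also have "winding_number ?l1 0 = of_real ((\<theta> 1 - \<theta> 0) / (2 * pi))"
  proof -
    have "u \<noteq> 0" using angle[of 0] nz[of 0] by (auto simp: sgn_zero_iff)
    then obtain w where w: "exp w = u" using exp_Ln by blast
    have cisper: "cis (\<theta> (t + 1)) = cis (\<theta> t)" for t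
      using angle[of t] angle[of "t + 1"] g'per[of t] \<open>u \<noteq> 0\<close> by simp
    \<comment> \<open>A logarithm of the velocity, built from its modulus, the given angle and a
      logarithm \<open>w\<close> of the constant \<open>u\<close>. By periodicity of
      \<open>g'\<close> only the angle contributes to \<open>q 1 - q 0\<close>.\<close>
    define q where "q t = of_real (ln (cmod (g' (s0 + t)))) + \<i> * of_real (\<theta> (s0 + t)) + w" for t
    have "path q" unfolding q_def path_def
      using nz by (intro continuous_intros continuous_on_compose2[OF cont] continuous_on_compose2[OF cont_\<theta>]) auto
    have e: "exp (q t) = g' (s0 + t)" for t
    proof -
      have "exp (q t) = of_real (cmod (g' (s0 + t))) * (cis (\<theta> (s0 + t)) * u)"
        using nz by (simp add: q_def exp_add w cis_conv_exp exp_of_real)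
      also have "\<dots> = g' (s0 + t)" unfolding angle[symmetric] using nz by (simp add: sgn_div_norm scaleR_conv_of_real)
      finally show ?thesis .
    qed
    have "winding_number ?l1 0 = winding_number (exp \<circ> q) 0"
      by (rule winding_number_cong) (simp add: line e F_def secant_def)
    also have "\<dots> = (q 1 - q 0) / (2 * of_real pi * \<i>)"
      unfolding winding_number_compose_exp[OF \<open>path q\<close>] by (simp add: pathfinish_def pathstart_def)
    also have "q 1 - q 0 = \<i> * of_real (\<theta> (s0 + 1) - \<theta> s0)"
      using g'per[of s0] by (simp add: q_def algebra_simps)
    finally show ?thesis unfolding angle_lift_shift[OF cont_\<theta> cisper] by (simp add: o_def)
  qed
  finally have turn: "winding_number (F \<circ> rectpath ?a1 ?a3) 0 = of_real ((\<theta> 1 - \<theta> 0) / (2 * pi))" by (simp add: o_def)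
  let ?Z = "{x \<in> cbox ?a1 ?a3. F x = 0}" and ?f = "\<lambda>x. (Re x, Re x + Im x)"
  have bij: "bij_betw ?f ?Z (self_crossings g s0)"
    unfolding bij_betw_def
  proof (intro conjI set_eqI iffI)
    show "inj_on ?f ?Z" by (auto simp: inj_on_def complex_eq_iff)
    fix st assume "st \<in> ?f ` ?Z"
    then obtain x where x: "x \<in> cbox ?a1 ?a3" "F x = 0" "st = ?f x" by auto
    then show "st \<in> self_crossings g s0"
      using bdry[OF x(1,2)] zero_iff[of x] by (auto simp: self_crossings_def in_box_complex_iff)
  next
    fix st assume st: "st \<in> self_crossings g s0"
    then obtain s t where [simp]: "st = (s, t)" by force
    have "st = ?f (Complex s (t - s))" by simp
    moreover have "Complex s (t - s) \<in> ?Z"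
      using st zero_iff[of "Complex s (t - s)"] by (auto simp: self_crossings_def in_cbox_complex_iff)
    ultimately show "st \<in> ?f ` ?Z" by blast
  qed
  show ?thesis
  proof
    show "finite (self_crossings g s0)" using bij finZ[of s0] bij_betw_finite by blast
    have "of_real ((\<theta> 1 - \<theta> 0) / (2 * pi)) = complex_of_real (\<Sum>x\<in>?Z. sgn (planar_det (D x 1) (D x \<i>)))"
      using sum turn by simp
    then have "(\<theta> 1 - \<theta> 0) / (2 * pi) = (\<Sum>x\<in>?Z. sgn (planar_det (D x 1) (D x \<i>)))"
      by (simp only: of_real_eq_iff)
    also have "\<dots> = (\<Sum>x\<in>?Z. (\<lambda>(s,t). - sgn (planar_det (g' s) (g' t))) (?f x))"
    proof (rule sum.cong)
      fix x assume "x \<in> ?Z"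
      then have "Im x \<noteq> 0" using bdry[of x] by (auto simp: in_box_complex_iff)
      then show "sgn (planar_det (D x 1) (D x \<i>)) = (\<lambda>(s,t). - sgn (planar_det (g' s) (g' t))) (?f x)"
        unfolding det by (auto simp: sgn_if divide_less_0_iff zero_less_divide_iff)
    qed simp
    also have "\<dots> = (\<Sum>(s,t)\<in>self_crossings g s0. - sgn (planar_det (g' s) (g' t)))"
      by (rule sum.reindex_bij_betw[OF bij])
    finally show "(\<theta> 1 - \<theta> 0) / (2 * pi) = (\<Sum>(s,t)\<in>self_crossings g s0. - sgn (planar_det (g' s) (g' t)))" .
  qed
qed

section \<open>Isometries of the model planes\<close>

definition moebius_real :: "real \<Rightarrow> real \<Rightarrow> real \<Rightarrow> real \<Rightarrow> complex \<Rightarrow> complex" where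
  "moebius_real \<alpha> \<beta> \<gamma> \<delta> z = (of_real \<alpha> * z + of_real \<beta>) / (of_real \<gamma> * z + of_real \<delta>)"

text \<open>The orientation-preserving isometries in algebraic form; hyperbolically, real matrices
  of determinant 1. The formula is prescribed on the half-plane only, since the maps to be compared
  with it are arbitrary elsewhere.\<close>

fun motion :: "geometry \<Rightarrow> (complex \<Rightarrow> complex) \<Rightarrow> bool" where
  "motion Euclidean f \<longleftrightarrow> (\<exists>u a. cmod u = 1 \<and> (\<forall>z. f z = u * z + a))"
| "motion Hyperbolic f \<longleftrightarrow> (\<exists>\<alpha> \<beta> \<gamma> \<delta>. \<alpha> * \<delta> - \<beta> * \<gamma> = 1 \<and> (\<forall>z. Im z > 0 \<longrightarrow> f z = moebius_real \<alpha> \<beta> \<gamma> \<delta> z))"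

text \<open>Reflection in the imaginary axis rather than \<open>cnj\<close>, because it maps both
  model planes to themselves.\<close>

definition mirror :: "complex \<Rightarrow> complex" where "mirror z = - cnj z"

lemma open_plane [simp]: "open (plane G)"
  by (cases G) (auto simp: open_halfspace_Im_gt)

lemma convex_plane [simp]: "convex (plane G)"
  by (cases G) (auto simp: convex_halfspace_Im_gt)

lemma connected_plane [simp]: "connected (plane G)"
  by (simp add: convex_connected)

lemma i_in_plane [simp]: "\<i> \<in> plane G"
  by (cases G) auto

lemma mirror_mirror [simp]: "mirror (mirror z) = z" by (simp add: mirror_def)

lemma mirror_in_plane [simp]: "mirror z \<in> plane G \<longleftrightarrow> z \<in> plane G"
  by (cases G) (auto simp: mirror_def)

lemma moebius_real_denominator:
  assumes "\<alpha> * \<delta> - \<beta> * \<gamma> = (1::real)" "Im z > 0"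
  shows "of_real \<gamma> * z + of_real \<delta> \<noteq> 0"
proof
  assume 0: "of_real \<gamma> * z + of_real \<delta> = 0"
  then have "Im (of_real \<gamma> * z + of_real \<delta>) = 0" by simp
  then have "\<gamma> * Im z = 0" by simp
  then have "\<gamma> = 0" using assms(2) by simp
  then show False using 0 assms(1) by simp
qed

lemma Im_moebius_real:
  assumes "\<alpha> * \<delta> - \<beta> * \<gamma> = 1" "Im z > 0"
  shows "Im (moebius_real \<alpha> \<beta> \<gamma> \<delta> z) = Im z / (cmod (of_real \<gamma> * z + of_real \<delta>))\<^sup>2"
proof -
  have "(\<alpha> * Im z) * (\<gamma> * Re z + \<delta>) - (\<alpha> * Re z + \<beta>) * (\<gamma> * Im z) = (\<alpha> * \<delta> - \<beta> * \<gamma>) * Im z"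
    by (simp add: algebra_simps)
  then show ?thesis
    using assms(1) by (simp add: moebius_real_def Im_divide cmod_power2)
qed

lemma moebius_real_diff:
  assumes "\<alpha> * \<delta> - \<beta> * \<gamma> = 1" "Im z > 0" "Im w > 0"
  shows "moebius_real \<alpha> \<beta> \<gamma> \<delta> z - moebius_real \<alpha> \<beta> \<gamma> \<delta> w =
    (z - w) / ((of_real \<gamma> * z + of_real \<delta>) * (of_real \<gamma> * w + of_real \<delta>))"
proof -
  have "complex_of_real (\<alpha> * \<delta> - \<beta> * \<gamma>) = 1" using assms(1) by simp
  then have e: "complex_of_real \<alpha> * of_real \<delta> = 1 + of_real \<beta> * of_real \<gamma>" by (simp add: algebra_simps)
  have "(of_real \<alpha> * z + of_real \<beta>) * (of_real \<gamma> * w + of_real \<delta>) - (of_real \<alpha> * w + of_real \<beta>) * (of_real \<gamma> * z + of_real \<delta>)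
     = (of_real \<alpha> * of_real \<delta> - of_real \<beta> * of_real \<gamma>) * (z - w)"
    by (simp add: algebra_simps)
  also have "\<dots> = z - w" using e by simp
  finally show ?thesis
    using moebius_real_denominator[OF assms(1,2)] moebius_real_denominator[OF assms(1,3)]
    unfolding moebius_real_def by (simp add: diff_frac_eq)
qed

text \<open>Composition is multiplication of the coefficient matrices.\<close>

lemma moebius_real_compose:
  assumes "\<alpha> * \<delta> - \<beta> * \<gamma> = 1" "\<alpha>' * \<delta>' - \<beta>' * \<gamma>' = 1" "Im z > 0"
  shows "moebius_real \<alpha> \<beta> \<gamma> \<delta> (moebius_real \<alpha>' \<beta>' \<gamma>' \<delta>' z) =
    moebius_real (\<alpha> * \<alpha>' + \<beta> * \<gamma>') (\<alpha> * \<beta>' + \<beta> * \<delta>') (\<gamma> * \<alpha>' + \<delta> * \<gamma>') (\<gamma> * \<beta>' + \<delta> * \<delta>') z"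
proof -
  let ?d = "of_real \<gamma>' * z + of_real \<delta>'" and ?n = "of_real \<alpha>' * z + of_real \<beta>'"
  have d: "?d \<noteq> 0" using moebius_real_denominator assms by blast
  have "moebius_real \<alpha> \<beta> \<gamma> \<delta> (?n / ?d) = (of_real \<alpha> * ?n + of_real \<beta> * ?d) / (of_real \<gamma> * ?n + of_real \<delta> * ?d)"
  proof -
    have "of_real \<alpha> * (?n / ?d) + of_real \<beta> = (of_real \<alpha> * ?n + of_real \<beta> * ?d) / ?d"
      "of_real \<gamma> * (?n / ?d) + of_real \<delta> = (of_real \<gamma> * ?n + of_real \<delta> * ?d) / ?d"
      using d by (simp_all add: field_simps)
    then show ?thesis using d unfolding moebius_real_def[of \<alpha>] by simp
  qed
  then show ?thesis by (simp add: moebius_real_def algebra_simps)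
qed

lemma motion_in_plane:
  assumes "motion G f" "z \<in> plane G"
  shows "f z \<in> plane G"
proof (cases G)
  case Hyperbolic
  then obtain \<alpha> \<beta> \<gamma> \<delta> where f: "\<alpha> * \<delta> - \<beta> * \<gamma> = 1" "\<And>z. Im z > 0 \<Longrightarrow> f z = moebius_real \<alpha> \<beta> \<gamma> \<delta> z"
    using assms by auto
  then show ?thesis
    using assms Hyperbolic Im_moebius_real[OF f(1), of z] moebius_real_denominator[OF f(1), of z] by simp
qed simp

lemma motion_dist:
  assumes "motion G f" "z \<in> plane G" "w \<in> plane G"
  shows "plane_dist G (f z) (f w) = plane_dist G z w"
proof (cases G)
  case Euclidean
  then obtain u a where "cmod u = 1" "\<And>z. f z = u * z + a" using assms by auto
  then show ?thesis using Euclidean by (simp add: dist_norm norm_mult flip: right_diff_distrib)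
next
  case Hyperbolic
  then obtain \<alpha> \<beta> \<gamma> \<delta> where f: "\<alpha> * \<delta> - \<beta> * \<gamma> = 1" "\<And>z. Im z > 0 \<Longrightarrow> f z = moebius_real \<alpha> \<beta> \<gamma> \<delta> z"
    using assms by auto
  have z: "Im z > 0" "Im w > 0" using assms Hyperbolic by auto
  let ?a = "cmod (of_real \<gamma> * z + of_real \<delta>)" and ?b = "cmod (of_real \<gamma> * w + of_real \<delta>)"
  have "(cmod (f z - f w))\<^sup>2 / (2 * Im (f z) * Im (f w)) = ((cmod (z - w))\<^sup>2 / (?a\<^sup>2 * ?b\<^sup>2)) / (2 * (Im z / ?a\<^sup>2) * (Im w / ?b\<^sup>2))"
    using z f(2) moebius_real_diff[OF f(1) z] Im_moebius_real[OF f(1)]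
    by (simp add: norm_divide norm_mult power_divide power_mult_distrib)
  also have "\<dots> = (cmod (z - w))\<^sup>2 / (2 * Im z * Im w)"
    using moebius_real_denominator[OF f(1) z(1)] moebius_real_denominator[OF f(1) z(2)] by (simp add: field_simps)
  finally show ?thesis using Hyperbolic by simp
qed

lemma motion_compose:
  assumes "motion G f" "motion G g"
  shows "motion G (\<lambda>z. f (g z))"
proof (cases G)
  case Euclidean
  then obtain u a v b where "cmod u = 1" "\<And>z. f z = u * z + a" "cmod v = 1" "\<And>z. g z = v * z + b"
    using assms by auto
  then have "cmod (u * v) = 1 \<and> (\<forall>z. f (g z) = (u * v) * z + (u * b + a))"
    by (simp add: norm_mult algebra_simps)
  then show ?thesis using Euclidean by auto
next
  case Hyperbolic
  then obtain \<alpha> \<beta> \<gamma> \<delta> \<alpha>' \<beta>' \<gamma>' \<delta>' where f: "\<alpha> * \<delta> - \<beta> * \<gamma> = 1" "\<And>z. Im z > 0 \<Longrightarrow> f z = moebius_real \<alpha> \<beta> \<gamma> \<delta> z"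
    and g: "\<alpha>' * \<delta>' - \<beta>' * \<gamma>' = 1" "\<And>z. Im z > 0 \<Longrightarrow> g z = moebius_real \<alpha>' \<beta>' \<gamma>' \<delta>' z"
    using assms by auto
  have "(\<alpha> * \<alpha>' + \<beta> * \<gamma>') * (\<gamma> * \<beta>' + \<delta> * \<delta>') - (\<alpha> * \<beta>' + \<beta> * \<delta>') * (\<gamma> * \<alpha>' + \<delta> * \<gamma>') =
     (\<alpha> * \<delta> - \<beta> * \<gamma>) * (\<alpha>' * \<delta>' - \<beta>' * \<gamma>')" by (simp add: algebra_simps)
  then have "(\<alpha> * \<alpha>' + \<beta> * \<gamma>') * (\<gamma> * \<beta>' + \<delta> * \<delta>') - (\<alpha> * \<beta>' + \<beta> * \<delta>') * (\<gamma> * \<alpha>' + \<delta> * \<gamma>') = 1"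
    using f(1) g(1) by simp
  moreover have "f (g z) = moebius_real (\<alpha> * \<alpha>' + \<beta> * \<gamma>') (\<alpha> * \<beta>' + \<beta> * \<delta>') (\<gamma> * \<alpha>' + \<delta> * \<gamma>') (\<gamma> * \<beta>' + \<delta> * \<delta>') z"
    if "Im z > 0" for z
    using moebius_real_compose[OF f(1) g(1) that] f(2) g(2) that motion_in_plane[OF assms(2), of z] Hyperbolic by auto
  ultimately show ?thesis using Hyperbolic by (simp, blast)
qed

text \<open>This is what allows two reversing maps to be composed: \<open>f (g z)\<close> equals
  \<open>f \<circ> mirror\<close> applied to \<open>mirror (g z)\<close>, and the latter is the
  mirror conjugate of \<open>g \<circ> mirror\<close>.\<close>

lemma motion_mirror_conj:
  assumes "motion G f"
  shows "motion G (\<lambda>z. mirror (f (mirror z)))"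
proof (cases G)
  case Euclidean
  then obtain u a where "cmod u = 1" "\<And>z. f z = u * z + a" using assms by auto
  then have "cmod (cnj u) = 1 \<and> (\<forall>z. mirror (f (mirror z)) = cnj u * z + mirror a)"
    by (simp add: mirror_def)
  then show ?thesis unfolding Euclidean motion.simps by blast
next
  case Hyperbolic
  then obtain \<alpha> \<beta> \<gamma> \<delta> where f: "\<alpha> * \<delta> - \<beta> * \<gamma> = 1" "\<And>z. Im z > 0 \<Longrightarrow> f z = moebius_real \<alpha> \<beta> \<gamma> \<delta> z"
    using assms by auto
  have "\<alpha> * \<delta> - (-\<beta>) * (-\<gamma>) = 1 \<and> (\<forall>z. Im z > 0 \<longrightarrow> mirror (f (mirror z)) = moebius_real \<alpha> (-\<beta>) (-\<gamma>) \<delta> z)"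
    using f by (auto simp: mirror_def moebius_real_def) (metis minus_diff_eq minus_divide_left)
  then show ?thesis using Hyperbolic by (simp, blast)
qed

lemma motion_inverse:
  assumes "motion G f"
  obtains g where "motion G g" "\<And>z. z \<in> plane G \<Longrightarrow> g (f z) = z" "\<And>z. z \<in> plane G \<Longrightarrow> f (g z) = z"
proof (cases G)
  case Euclidean
  then obtain u a where f: "cmod u = 1" "\<And>z. f z = u * z + a" using assms by auto
  then have "u \<noteq> 0" by auto
  show ?thesis
  proof (rule that[of "\<lambda>z. z / u - a / u"])
    have "cmod (1 / u) = 1 \<and> (\<forall>z. z / u - a / u = (1 / u) * z + (- a / u))" using f by (simp add: norm_divide)
    then show "motion G (\<lambda>z. z / u - a / u)" using Euclidean by auto
  qed (use f \<open>u \<noteq> 0\<close> in \<open>auto simp: field_simps\<close>)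
next
  case Hyperbolic
  then obtain \<alpha> \<beta> \<gamma> \<delta> where f: "\<alpha> * \<delta> - \<beta> * \<gamma> = 1" "\<And>z. Im z > 0 \<Longrightarrow> f z = moebius_real \<alpha> \<beta> \<gamma> \<delta> z"
    using assms by auto
  let ?g = "moebius_real \<delta> (-\<beta>) (-\<gamma>) \<alpha>"
  have d: "\<delta> * \<alpha> - (-\<beta>) * (-\<gamma>) = 1" "\<delta> * \<alpha> - \<beta> * \<gamma> = 1" "\<alpha> * \<delta> = 1 + \<beta> * \<gamma>" "\<delta> * \<alpha> = 1 + \<beta> * \<gamma>" using f(1) by (auto simp: algebra_simps)
  show ?thesis
  proof (rule that[of ?g])
    show g: "motion G ?g" unfolding Hyperbolic motion.simps using d(1) by blast
    fix z assume "z \<in> plane G"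
    then have z: "Im z > 0" using Hyperbolic by simp
    show "?g (f z) = z"
      unfolding f(2)[OF z] moebius_real_compose[OF d(1) f(1) z] using d by (simp add: moebius_real_def mult.commute)
    have "Im (?g z) > 0" using motion_in_plane[OF g] z Hyperbolic by auto
    then have "f (?g z) = moebius_real \<alpha> \<beta> \<gamma> \<delta> (?g z)" by (rule f(2))
    then show "f (?g z) = z"
      unfolding moebius_real_compose[OF f(1) d(1) z] using d by (simp add: moebius_real_def mult.commute)
  qed
qed

lemma motion_has_field_derivative:
  assumes "motion G f" "z \<in> plane G"
  obtains d where "(f has_field_derivative d) (at z)" "d \<noteq> 0"
proof (cases G)
  case Euclidean
  then obtain u a where f: "cmod u = 1" "f = (\<lambda>z. u * z + a)" using assms by auto
  have "(f has_field_derivative u) (at z)" unfolding f by (auto intro!: derivative_eq_intros)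
  then show ?thesis using that f by fastforce
next
  case Hyperbolic
  then obtain \<alpha> \<beta> \<gamma> \<delta> where f: "\<alpha> * \<delta> - \<beta> * \<gamma> = 1" "\<And>z. Im z > 0 \<Longrightarrow> f z = moebius_real \<alpha> \<beta> \<gamma> \<delta> z"
    using assms by auto
  have z: "Im z > 0" using assms Hyperbolic by simp
  let ?D = "of_real \<gamma> * z + of_real \<delta>"
  have d: "?D \<noteq> 0" using moebius_real_denominator[OF f(1) z] .
  have c: "complex_of_real \<alpha> * of_real \<delta> - of_real \<beta> * of_real \<gamma> = 1"
    using f(1) by (metis of_real_1 of_real_diff of_real_mult)
  have "((\<lambda>z. (of_real \<alpha> * z + of_real \<beta>) / (of_real \<gamma> * z + of_real \<delta>)) has_field_derivative
      (of_real \<alpha> * ?D - (of_real \<alpha> * z + of_real \<beta>) * of_real \<gamma>) / (?D * ?D)) (at z)"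
    using d by (auto intro!: derivative_eq_intros)
  also have "of_real \<alpha> * ?D - (of_real \<alpha> * z + of_real \<beta>) * of_real \<gamma> = 1"
    using c by (simp add: algebra_simps)
  finally have "((\<lambda>z. moebius_real \<alpha> \<beta> \<gamma> \<delta> z) has_field_derivative 1 / (?D * ?D)) (at z)"
    unfolding moebius_real_def .
  then have "(f has_field_derivative 1 / (?D * ?D)) (at z)"
    by (rule has_field_derivative_transform_within_open[of _ _ _ "{z. Im z > 0}"])
       (use z f(2) in \<open>auto simp: open_halfspace_Im_gt\<close>)
  then show ?thesis using that d by (metis divide_eq_0_iff mult_eq_0_iff zero_neq_one)
qed

lemma motion_holomorphic: "motion G f \<Longrightarrow> f holomorphic_on plane G"
  using motion_has_field_derivative by (metis field_differentiable_at_within field_differentiable_def holomorphic_on_def)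

section \<open>Distance-preserving maps on open sets\<close>

lemma planar_isometry_fixing_0:
  assumes S: "open S" "0 \<in> S" and n: "\<And>w. w \<in> S \<Longrightarrow> cmod (h w) = cmod w"
    and d: "\<And>v w. v \<in> S \<Longrightarrow> w \<in> S \<Longrightarrow> cmod (h v - h w) = cmod (v - w)"
  obtains u where "cmod u = 1" "(\<forall>w\<in>S. h w = u * w) \<or> (\<forall>w\<in>S. h w = u * cnj w)"
proof -
  obtain e where e: "e > 0" "ball 0 e \<subseteq> S" using S open_contains_ball by blast
  define r where "r = e / 2"
  have r: "r > 0" "of_real r \<in> S" "\<i> * of_real r \<in> S" using e unfolding r_def by (auto simp: subset_iff norm_mult)
  define u where "u = h (of_real r) / of_real r"
  have u1: "cmod u = 1" using n[OF r(2)] r(1) by (simp add: u_def norm_divide)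
  then have u0: "u \<noteq> 0" by auto
  \<comment> \<open>Dividing by \<open>u\<close> makes \<open>r\<close> a fixed point. The distances
    from 0 and from \<open>r\<close> then fix the real part of \<open>k w\<close>, the image of
    \<open>\<i> * r\<close> can only be itself or its conjugate, and this choice fixes all imaginary
    parts.\<close>
  define k where "k w = h w / u" for w
  have kr: "k (of_real r) = of_real r" using u0 r(1) by (simp add: k_def u_def)
  have kn: "cmod (k w) = cmod w" if "w \<in> S" for w using n that u1 by (simp add: k_def norm_divide)
  have kd: "cmod (k v - k w) = cmod (v - w)" if "v \<in> S" "w \<in> S" for v w
    using d[OF that] u1 by (simp add: k_def norm_divide flip: diff_divide_distrib)
  have sq: "(Re (k w))\<^sup>2 + (Im (k w))\<^sup>2 = (Re w)\<^sup>2 + (Im w)\<^sup>2" if "w \<in> S" for w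
    using kn[OF that] by (metis cmod_power2)
  have re: "Re (k w) = Re w" if w: "w \<in> S" for w
  proof -
    have "(cmod (k w - of_real r))\<^sup>2 = (cmod (w - of_real r))\<^sup>2"
      using kd[OF w r(2)] kr by simp
    then have "(Re (k w) - r)\<^sup>2 + (Im (k w))\<^sup>2 = (Re w - r)\<^sup>2 + (Im w)\<^sup>2" by (simp add: cmod_power2)
    then have "2 * Re (k w) * r = 2 * Re w * r" using sq[OF w] unfolding power2_diff by linarith
    then show ?thesis using r(1) by simp
  qed
  have ki: "Re (k (\<i> * of_real r)) = 0" "(Im (k (\<i> * of_real r)))\<^sup>2 = r\<^sup>2"
    using re[OF r(3)] sq[OF r(3)] by auto
  have im: "Im (k (\<i> * of_real r)) * Im (k w) = r * Im w" if w: "w \<in> S" for w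
  proof -
    have "(cmod (k w - k (\<i> * of_real r)))\<^sup>2 = (cmod (w - \<i> * of_real r))\<^sup>2"
      using kd[OF w r(3)] by simp
    then have "(Im (k w) - Im (k (\<i> * of_real r)))\<^sup>2 + (Re w)\<^sup>2 = (Im w - r)\<^sup>2 + (Re w)\<^sup>2"
      using ki re[OF w] by (simp add: cmod_power2)
    then show ?thesis using sq[OF w] re[OF w] ki(2) by (simp add: power2_diff mult.commute)
  qed
  have hk: "h w = u * k w" for w using u0 by (simp add: k_def)
  have "Im (k (\<i> * of_real r)) = r \<or> Im (k (\<i> * of_real r)) = - r"
    using ki(2) by (simp add: power2_eq_iff)
  then have "(\<forall>w\<in>S. k w = w) \<or> (\<forall>w\<in>S. k w = cnj w)"
  proof
    assume "Im (k (\<i> * of_real r)) = r"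
    then have "\<forall>w\<in>S. k w = w" using im re r(1) by (auto simp: complex_eq_iff)
    then show ?thesis by blast
  next
    assume "Im (k (\<i> * of_real r)) = - r"
    then have "\<forall>w\<in>S. k w = cnj w" using im re r(1) by (auto simp: complex_eq_iff) (metis minus_mult_minus minus_minus mult_left_cancel mult_minus_left less_irrefl)
    then show ?thesis by blast
  qed
  then show ?thesis using that[OF u1] hk by auto
qed

text \<open>As \<open>mirror\<close> is an involution, the second case says that \<open>f\<close> is
  a motion applied after \<open>mirror\<close>.\<close>

definition rigid :: "geometry \<Rightarrow> (complex \<Rightarrow> complex) \<Rightarrow> bool" where
  "rigid G f \<longleftrightarrow> motion G f \<or> motion G (\<lambda>z. f (mirror z))"

lemma motion_cong: "(\<And>z. z \<in> plane G \<Longrightarrow> f z = g z) \<Longrightarrow> motion G f \<longleftrightarrow> motion G g"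
  by (cases G) auto

lemma rigid_cong: "(\<And>z. z \<in> plane G \<Longrightarrow> f z = g z) \<Longrightarrow> rigid G f \<longleftrightarrow> rigid G g"
  unfolding rigid_def by (metis motion_cong mirror_in_plane)

lemma motion_iff_compose:
  assumes "motion G f \<longleftrightarrow> motion G g" "rigid G f" "rigid G g"
  shows "motion G (\<lambda>z. f (g z))"
proof (cases "motion G f")
  case True
  then show ?thesis using assms(1) motion_compose by blast
next
  case False
  then have "motion G (\<lambda>z. f (mirror z))" "motion G (\<lambda>z. g (mirror z))"
    using assms unfolding rigid_def by auto
  then show ?thesis using motion_compose[OF _ motion_mirror_conj] by fastforce
qed

lemma anti_motion_compose:
  assumes "motion G f \<longleftrightarrow> \<not> motion G g" "rigid G f" "rigid G g"
  shows "motion G (\<lambda>z. f (g (mirror z)))"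
proof (cases "motion G f")
  case True
  then have "motion G (\<lambda>z. g (mirror z))" using assms unfolding rigid_def by auto
  then show ?thesis using motion_compose True by blast
next
  case False
  then have "motion G (\<lambda>z. f (mirror z))" "motion G g" using assms unfolding rigid_def by auto
  then show ?thesis using motion_compose[OF _ motion_mirror_conj, of G "\<lambda>z. f (mirror z)" g] by simp
qed

section \<open>The Cayley transform to the unit disc\<close>

definition disc :: "complex \<Rightarrow> complex" where "disc z = (z - \<i>) / (z + \<i>)"
definition undisc :: "complex \<Rightarrow> complex" where "undisc w = \<i> * (1 + w) / (1 - w)"

lemma disc_denominator: "Im z > 0 \<Longrightarrow> z + \<i> \<noteq> 0"
  by (auto simp: complex_eq_iff)

lemma undisc_disc: "Im z > 0 \<Longrightarrow> undisc (disc z) = z"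
proof -
  assume "Im z > 0"
  then have d: "z + \<i> \<noteq> 0" by (rule disc_denominator)
  then have "1 + disc z = 2 * z / (z + \<i>)" "1 - disc z = 2 * \<i> / (z + \<i>)"
    by (simp_all add: disc_def field_simps)
  then show ?thesis using d by (simp add: undisc_def)
qed

lemma one_minus_disc:
  assumes "Im z > 0"
  shows "1 - (cmod (disc z))\<^sup>2 = 4 * Im z / (cmod (z + \<i>))\<^sup>2"
proof -
  have "(cmod (z + \<i>))\<^sup>2 - (cmod (z - \<i>))\<^sup>2 = 4 * Im z"
    unfolding cmod_power2 by (simp add: power2_eq_square algebra_simps)
  moreover have "(cmod (z + \<i>))\<^sup>2 \<noteq> 0" using disc_denominator[OF assms] by simp
  ultimately show ?thesis
    unfolding disc_def norm_divide power_divide by (metis diff_divide_distrib divide_self)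
qed

text \<open>Once the moduli of the two image points are known, their Euclidean distance in the disc
  is determined by the hyperbolic distance. This reduces hyperbolic isometries fixing
  \<open>\<i>\<close> to planar isometries fixing 0.\<close>

lemma disc_diff:
  assumes "Im z > 0" "Im w > 0"
  shows "4 * (cmod (disc z - disc w))\<^sup>2 =
    (cmod (z - w))\<^sup>2 / (Im z * Im w) * (1 - (cmod (disc z))\<^sup>2) * (1 - (cmod (disc w))\<^sup>2)"
proof -
  have d: "z + \<i> \<noteq> 0" "w + \<i> \<noteq> 0" using assms disc_denominator by auto
  have "disc z - disc w = 2 * \<i> * (z - w) / ((z + \<i>) * (w + \<i>))"
    unfolding disc_def diff_frac_eq[OF d] by (simp add: algebra_simps)
  then have "(cmod (disc z - disc w))\<^sup>2 = 4 * (cmod (z - w))\<^sup>2 / ((cmod (z + \<i>))\<^sup>2 * (cmod (w + \<i>))\<^sup>2)"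
    by (simp add: norm_divide norm_mult power_divide power_mult_distrib)
  then show ?thesis
    unfolding one_minus_disc[OF assms(1)] one_minus_disc[OF assms(2)] using assms d by (simp add: field_simps)
qed

lemma disc_less_1: "Im z > 0 \<Longrightarrow> cmod (disc z) < 1"
proof -
  assume z: "Im z > 0"
  then have "1 - (cmod (disc z))\<^sup>2 > 0"
    unfolding one_minus_disc[OF z] using disc_denominator[OF z] by simp
  then show ?thesis by (simp add: power_less_one_iff abs_square_less_1)
qed

lemma disc_undisc:
  assumes "cmod w < 1"
  shows "disc (undisc w) = w"
proof -
  have d: "1 - w \<noteq> 0" using assms by auto
  have "undisc w - \<i> = 2 * \<i> * w / (1 - w)" "undisc w + \<i> = 2 * \<i> / (1 - w)"
    using d by (simp_all add: undisc_def field_simps)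
  then show ?thesis using d by (simp add: disc_def)
qed

text \<open>Applying \<open>cosh\<close> removes \<open>arcosh\<close>: both sides are
  \<open>2 * (cosh d - 1)\<close> for the common distance \<open>d\<close>.\<close>

lemma hyperbolic_dist_eq:
  assumes "plane_dist Hyperbolic z w = plane_dist Hyperbolic z' w'"
    "Im z > 0" "Im w > 0" "Im z' > 0" "Im w' > 0"
  shows "(cmod (z - w))\<^sup>2 / (Im z * Im w) = (cmod (z' - w'))\<^sup>2 / (Im z' * Im w')"
proof -
  have "1 + (cmod (z - w))\<^sup>2 / (2 * Im z * Im w) = cosh (plane_dist Hyperbolic z w)"
    using assms(2-) by (simp add: cosh_arcosh_real)
  also have "\<dots> = 1 + (cmod (z' - w'))\<^sup>2 / (2 * Im z' * Im w')"
    unfolding assms(1) using assms(2-) by (simp add: cosh_arcosh_real)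
  finally show ?thesis using assms(2-) by (simp add: field_simps)
qed

lemma disc_i [simp]: "disc \<i> = 0" by (simp add: disc_def)

lemma disc_mirror: "Im z > 0 \<Longrightarrow> disc (mirror z) = cnj (disc z)"
proof -
  have "disc (mirror z) = (-(cnj z + \<i>)) / (-(cnj z - \<i>))" by (simp add: disc_def mirror_def)
  then show ?thesis unfolding minus_divide_divide by (simp add: disc_def)
qed

text \<open>The matrix is a rotation about \<open>\<i>\<close>. Numerator and denominator pick up
  the factors \<open>cis t\<close> and \<open>cis (- t)\<close>, whence the doubled angle.\<close>

lemma disc_rotation:
  assumes "Im z > 0"
  shows "disc (moebius_real (cos t) (sin t) (- sin t) (cos t) z) = cis (2 * t) * disc z"
proof -
  have d: "of_real (- sin t) * z + of_real (cos t) \<noteq> 0" (is "?d \<noteq> 0")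
    by (rule moebius_real_denominator[OF _ assms, of "cos t" _ "sin t"]) (simp add: power2_eq_square[symmetric])
  let ?n = "of_real (cos t) * z + of_real (sin t)"
  have c: "cis t = of_real (cos t) + \<i> * of_real (sin t)" by (simp add: complex_eq_iff)
  have "?n - \<i> * ?d = cis t * (z - \<i>)" "?n + \<i> * ?d = cis (- t) * (z + \<i>)"
    by (simp_all add: complex_eq_iff algebra_simps)
  moreover have "disc (moebius_real (cos t) (sin t) (- sin t) (cos t) z) = (?n / ?d - \<i>) / (?n / ?d + \<i>)"
    by (simp add: disc_def moebius_real_def)
  moreover have "(?n / ?d - \<i>) / (?n / ?d + \<i>) = (?n - \<i> * ?d) / (?n + \<i> * ?d)"
  proof -
    have "?n / ?d - \<i> = (?n - \<i> * ?d) / ?d" "?n / ?d + \<i> = (?n + \<i> * ?d) / ?d" using d by (simp_all add: field_simps)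
    then show ?thesis using d by simp
  qed
  moreover have "cis t * (z - \<i>) / (cis (- t) * (z + \<i>)) = cis (2 * t) * disc z"
  proof -
    have "cis t / cis (- t) = cis (2 * t)" by (simp add: cis_divide)
    then show ?thesis by (simp add: disc_def flip: times_divide_times_eq)
  qed
  ultimately show ?thesis by simp
qed

text \<open>In the disc, the distance from \<open>\<i>\<close> determines the modulus; with equal
  moduli, \<open>disc_diff\<close> turns preserved hyperbolic distances into preserved Euclidean
  ones. So the map is a rotation of the disc, possibly after conjugation.\<close>

lemma local_isometry_fixing_i:
  assumes U: "open U" "\<i> \<in> U" "U \<subseteq> plane Hyperbolic" "f ` U \<subseteq> plane Hyperbolic" and fi: "f \<i> = \<i>"
    and iso: "\<And>z w. z \<in> U \<Longrightarrow> w \<in> U \<Longrightarrow> plane_dist Hyperbolic (f z) (f w) = plane_dist Hyperbolic z w"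
  obtains R where "motion Hyperbolic R" "(\<forall>z\<in>U. f z = R z) \<or> (\<forall>z\<in>U. f z = R (mirror z))"
proof -
  have pos: "Im z > 0" "Im (f z) > 0" if "z \<in> U" for z using U that by auto
  have Q: "(cmod (f z - f w))\<^sup>2 / (Im (f z) * Im (f w)) = (cmod (z - w))\<^sup>2 / (Im z * Im w)" if "z \<in> U" "w \<in> U" for z w
    using hyperbolic_dist_eq[OF iso[OF that]] pos that by auto
  have n: "(cmod (disc (f z)))\<^sup>2 = (cmod (disc z))\<^sup>2" if z: "z \<in> U" for z
  proof -
    define q where "q = (cmod (z - \<i>))\<^sup>2 / Im z"
    have q: "(cmod (f z - \<i>))\<^sup>2 / Im (f z) = q" "q \<ge> 0" using Q[OF z U(2)] fi pos[OF z] by (auto simp: q_def)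
    have "4 * (cmod (disc (f z)))\<^sup>2 = q * (1 - (cmod (disc (f z)))\<^sup>2)"
      using disc_diff[of "f z" \<i>] pos[OF z] q by simp
    moreover have "4 * (cmod (disc z))\<^sup>2 = q * (1 - (cmod (disc z))\<^sup>2)"
      using disc_diff[of z \<i>] pos[OF z] by (simp add: q_def)
    ultimately have "(4 + q) * (cmod (disc (f z)))\<^sup>2 = (4 + q) * (cmod (disc z))\<^sup>2" by (simp add: algebra_simps)
    then show ?thesis using q(2) by simp
  qed
  have d: "cmod (disc (f z) - disc (f w)) = cmod (disc z - disc w)" if "z \<in> U" "w \<in> U" for z w
  proof -
    have "4 * (cmod (disc (f z) - disc (f w)))\<^sup>2 = 4 * (cmod (disc z - disc w))\<^sup>2"
      using disc_diff[OF pos(2)[OF that(1)] pos(2)[OF that(2)]] disc_diff[OF pos(1)[OF that(1)] pos(1)[OF that(2)]]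
        n[OF that(1)] n[OF that(2)] Q[OF that] by simp
    then show ?thesis by simp
  qed
  define S where "S = {w \<in> ball 0 1. undisc w \<in> U}"
  have S: "open S"
  proof -
    have "continuous_on (ball 0 1) undisc"
      unfolding undisc_def by (intro continuous_intros) auto
    then have "open (ball 0 1 \<inter> undisc -` U)" using continuous_open_preimage U(1) open_ball by blast
    then show ?thesis by (simp add: S_def Int_def vimage_def)
  qed
  have discS: "disc z \<in> S" if "z \<in> U" for z
    using that pos disc_less_1 undisc_disc by (simp add: S_def)
  have SU: "\<exists>z\<in>U. w = disc z" if "w \<in> S" for w
    using that disc_undisc[of w] unfolding S_def by force
  define h where "h w = disc (f (undisc w))" for w
  have hd: "h (disc z) = disc (f z)" if "z \<in> U" for z using undisc_disc pos that by (simp add: h_def)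
  obtain u where u: "cmod u = 1" "(\<forall>w\<in>S. h w = u * w) \<or> (\<forall>w\<in>S. h w = u * cnj w)"
  proof (rule planar_isometry_fixing_0[OF S])
    show "0 \<in> S" using discS[OF U(2)] by simp
    show "cmod (h w) = cmod w" if "w \<in> S" for w using SU[OF that] hd n by fastforce
    show "cmod (h v - h w) = cmod (v - w)" if "v \<in> S" "w \<in> S" for v w
      using SU[OF that(1)] SU[OF that(2)] hd d by fastforce
  qed blast
  \<comment> \<open>Half the argument, because the matrix with angle \<open>t\<close> rotates the
    disc by \<open>2 * t\<close>.\<close>
  define t where "t = Arg u / 2"
  have ut: "u = cis (2 * t)" using u(1) by (simp add: t_def cis_Arg_unique rcis_cmod_Arg[unfolded rcis_def, symmetric]) (metis mult_1 of_real_1 rcis_cmod_Arg rcis_def)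
  let ?R = "moebius_real (cos t) (sin t) (- sin t) (cos t)"
  have R: "motion Hyperbolic ?R"
  proof -
    have "cos t * cos t - sin t * (- sin t) = 1" by (simp add: power2_eq_square[symmetric])
    then show ?thesis unfolding motion.simps by blast
  qed
  have inj: "z = w" if "disc z = disc w" "Im z > 0" "Im w > 0" for z w
    using that undisc_disc by metis
  have Rpos: "Im (?R z) > 0" if "Im z > 0" for z using motion_in_plane[OF R, of z] that by simp
  have "(\<forall>z\<in>U. f z = ?R z) \<or> (\<forall>z\<in>U. f z = ?R (mirror z))"
    using u(2)
  proof
    assume *: "\<forall>w\<in>S. h w = u * w"
    have "f z = ?R z" if z: "z \<in> U" for z
    proof (rule inj)
      show "disc (f z) = disc (?R z)"
        using * discS[OF z] unfolding disc_rotation[OF pos(1)[OF z]] hd[OF z, symmetric] ut[symmetric] by blast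
    qed (use pos[OF z] Rpos in auto)
    then show ?thesis by blast
  next
    assume *: "\<forall>w\<in>S. h w = u * cnj w"
    have "f z = ?R (mirror z)" if z: "z \<in> U" for z
    proof -
      have m: "Im (mirror z) > 0" using pos[OF z] by (simp add: mirror_def)
      show ?thesis
      proof (rule inj)
        show "disc (f z) = disc (?R (mirror z))"
          using * discS[OF z] unfolding disc_rotation[OF m] hd[OF z, symmetric] ut[symmetric] disc_mirror[OF pos(1)[OF z]] by blast
      qed (use pos[OF z] Rpos[OF m] in auto)
    qed
    then show ?thesis by blast
  qed
  then show ?thesis using that[OF R] by blast
qed

lemma motion_to_i:
  assumes "Im w > 0"
  obtains A where "motion Hyperbolic A" "A w = \<i>"
proof -
  let ?s = "sqrt (Im w)"
  have s: "?s > 0" "?s * ?s = Im w" using assms by auto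
  let ?A = "moebius_real (1 / ?s) (- Re w / ?s) 0 ?s"
  have "(1 / ?s) * ?s - (- Re w / ?s) * 0 = 1" using s by simp
  then have "motion Hyperbolic ?A" unfolding motion.simps by blast
  moreover have "?A w = \<i>"
    using s by (simp add: moebius_real_def complex_eq_iff Re_divide_of_real Im_divide_of_real field_simps)
  ultimately show ?thesis using that by blast
qed

text \<open>Motions act transitively, so a point and its image can both be moved to a base point: 0
  by translations in the Euclidean case, \<open>\<i>\<close> by \<open>A\<close> and
  \<open>B\<close> in the hyperbolic one.\<close>

lemma local_isometry_rigid:
  assumes U: "open U" "U \<noteq> {}" "U \<subseteq> plane G" "f ` U \<subseteq> plane G"
    and iso: "\<And>z w. z \<in> U \<Longrightarrow> w \<in> U \<Longrightarrow> plane_dist G (f z) (f w) = plane_dist G z w"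
  obtains R where "rigid G R" "\<forall>z\<in>U. f z = R z"
proof (cases G)
  case Euclidean
  obtain z0 where z0: "z0 \<in> U" using U by blast
  define h where "h w = f (z0 + w) - f z0" for w
  let ?S = "{w. z0 + w \<in> U}"
  have eq: "f z = h (z - z0) + f z0" for z by (simp add: h_def)
  have "open ?S"
    using U(1) open_vimage[of U "\<lambda>w. z0 + w"] by (simp add: vimage_def continuous_intros)
  then obtain u where u: "cmod u = 1" "(\<forall>w\<in>?S. h w = u * w) \<or> (\<forall>w\<in>?S. h w = u * cnj w)"
  proof (rule planar_isometry_fixing_0[where h=h])
    have d: "cmod (f z - f w) = cmod (z - w)" if "z \<in> U" "w \<in> U" for z w
      using iso[OF that] Euclidean by (simp add: dist_norm)
    show "cmod (h w) = cmod w" if "w \<in> ?S" for w using d[of "z0 + w" z0] z0 that by (simp add: h_def)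
    show "cmod (h v - h w) = cmod (v - w)" if "v \<in> ?S" "w \<in> ?S" for v w
      using d[of "z0 + v" "z0 + w"] that by (simp add: h_def)
  qed (use z0 in auto)
  from u(2) show ?thesis
  proof
    assume *: "\<forall>w\<in>?S. h w = u * w"
    let ?R = "\<lambda>z. u * z + (f z0 - u * z0)"
    have "motion G ?R" unfolding Euclidean motion.simps using u(1) by blast
    moreover have "f z = ?R z" if "z \<in> U" for z
    proof -
      have "h (z - z0) = u * (z - z0)" using * that by simp
      then show ?thesis unfolding eq[of z] by (simp add: algebra_simps)
    qed
    ultimately show ?thesis by (intro that[of ?R]) (auto simp: rigid_def)
  next
    assume *: "\<forall>w\<in>?S. h w = u * cnj w"
    let ?R = "\<lambda>z. u * cnj z + (f z0 - u * cnj z0)"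
    have "cmod (- u) = 1 \<and> (\<forall>z. ?R (mirror z) = (-u) * z + (f z0 - u * cnj z0))" using u(1) by (simp add: mirror_def)
    then have "motion G (\<lambda>z. ?R (mirror z))" unfolding Euclidean motion.simps by blast
    moreover have "f z = ?R z" if "z \<in> U" for z
    proof -
      have "h (z - z0) = u * cnj (z - z0)" using * that by simp
      then show ?thesis unfolding eq[of z] by (simp add: algebra_simps)
    qed
    ultimately show ?thesis by (intro that[of ?R]) (auto simp: rigid_def)
  qed
next
  case Hyperbolic
  obtain z0 where z0: "z0 \<in> U" using U by blast
  have pos: "z \<in> plane G" "f z \<in> plane G" if "z \<in> U" for z using U that by auto
  obtain A where A: "motion G A" "A z0 = \<i>" by (rule motion_to_i[of z0]) (use pos[OF z0] Hyperbolic in auto)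
  obtain B where B: "motion G B" "B (f z0) = \<i>" by (rule motion_to_i[of "f z0"]) (use pos[OF z0] Hyperbolic in auto)
  obtain A' where A': "motion G A'" "\<And>z. z \<in> plane G \<Longrightarrow> A' (A z) = z" "\<And>z. z \<in> plane G \<Longrightarrow> A (A' z) = z"
    using motion_inverse[OF A(1)] by blast
  obtain B' where B': "motion G B'" "\<And>z. z \<in> plane G \<Longrightarrow> B' (B z) = z" "\<And>z. z \<in> plane G \<Longrightarrow> B (B' z) = z"
    using motion_inverse[OF B(1)] by blast
  let ?V = "plane G \<inter> A' -` U"
  have V: "open ?V"
    using continuous_open_preimage[OF holomorphic_on_imp_continuous_on[OF motion_holomorphic[OF A'(1)]] open_plane U(1)] .
  have VI: "A z \<in> ?V" if "z \<in> U" for z using that pos A A' motion_in_plane by auto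
  define g where "g z = B (f (A' z))" for z
  obtain R where R: "motion G R" "(\<forall>z\<in>?V. g z = R z) \<or> (\<forall>z\<in>?V. g z = R (mirror z))"
  proof (rule local_isometry_fixing_i[of ?V g])
    show "\<i> \<in> ?V" using VI[OF z0] A by simp
    show "g \<i> = \<i>" using A'(2)[of z0] pos[OF z0] A B by (simp add: g_def)
    show "g ` ?V \<subseteq> plane Hyperbolic" using pos motion_in_plane[OF B(1)] Hyperbolic by (auto simp: g_def)
    show "plane_dist Hyperbolic (g z) (g w) = plane_dist Hyperbolic z w" if "z \<in> ?V" "w \<in> ?V" for z w
    proof -
      have "plane_dist G (g z) (g w) = plane_dist G (f (A' z)) (f (A' w))"
        unfolding g_def using motion_dist[OF B(1)] pos that by auto
      also have "\<dots> = plane_dist G z w" using iso motion_dist[OF A'(1)] that by auto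
      finally show ?thesis using Hyperbolic by simp
    qed
  qed (use V Hyperbolic in auto)
  have f: "f z = B' (g (A z))" if "z \<in> U" for z
    using that A' B' pos by (simp add: g_def)
  from R(2) show ?thesis
  proof
    assume *: "\<forall>z\<in>?V. g z = R z"
    have "motion G (\<lambda>z. B' (R (A z)))" using motion_compose[OF B'(1) motion_compose[OF R(1) A(1)]] .
    then show ?thesis using that[of "\<lambda>z. B' (R (A z))"] f * VI unfolding rigid_def by auto
  next
    assume *: "\<forall>z\<in>?V. g z = R (mirror z)"
    let ?R = "\<lambda>z. B' (R (mirror (A z)))"
    have "motion G (\<lambda>z. ?R (mirror z))"
      using motion_compose[OF B'(1) motion_compose[OF R(1) motion_mirror_conj[OF A(1)]]] .
    then show ?thesis using that[of ?R] f * VI unfolding rigid_def by auto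
  qed
qed

section \<open>Orientation and unique continuation of rigid maps\<close>

lemma motion_orientation:
  assumes "motion G f" "z \<in> plane G"
  shows "orientation_preserving_at f z"
proof -
  obtain d where d: "(f has_field_derivative d) (at z)" "d \<noteq> 0" using motion_has_field_derivative[OF assms] .
  have "planar_det (d * 1) (d * \<i>) = (cmod d)\<^sup>2" unfolding cmod_power2 by (simp add: planar_det_def power2_eq_square)
  then show ?thesis using d unfolding orientation_preserving_at_def has_field_derivative_def
    by (intro exI[of _ "(*) d"]) auto
qed

lemma anti_motion_derivative:
  assumes "motion G (\<lambda>z. f (mirror z))" "z \<in> plane G"
  obtains d where "(f has_derivative (\<lambda>v. d * cnj v)) (at z)" "d \<noteq> 0"
proof -
  obtain d where d: "((\<lambda>z. f (mirror z)) has_field_derivative d) (at (mirror z))" "d \<noteq> 0"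
    using motion_has_field_derivative[OF assms(1), of "mirror z"] assms(2) by auto
  have m: "(mirror has_derivative mirror) (at z)"
    unfolding mirror_def[abs_def] by (intro derivative_intros)
  have "((\<lambda>w. f (mirror (mirror w))) has_derivative (\<lambda>v. d * mirror v)) (at z)"
    using has_derivative_compose[OF m d(1)[unfolded has_field_derivative_def]] .
  then have "(f has_derivative (\<lambda>v. (- d) * cnj v)) (at z)" by (simp add: mirror_def)
  then show ?thesis using that d(2) by (metis neg_equal_0_iff_equal)
qed

lemma anti_motion_orientation:
  assumes "motion G (\<lambda>z. f (mirror z))" "z \<in> plane G"
  shows "\<not> orientation_preserving_at f z"
proof
  obtain d where d: "(f has_derivative (\<lambda>v. d * cnj v)) (at z)" "d \<noteq> 0" using anti_motion_derivative[OF assms] .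
  assume "orientation_preserving_at f z"
  then obtain D where "(f has_derivative D) (at z)" "planar_det (D 1) (D \<i>) > 0"
    unfolding orientation_preserving_at_def by blast
  then have "planar_det d (- (d * \<i>)) > 0" using has_derivative_unique[OF d(1)] by force
  moreover have "planar_det d (- (d * \<i>)) = - (cmod d)\<^sup>2" unfolding cmod_power2 by (simp add: planar_det_def power2_eq_square)
  ultimately show False by simp
qed

text \<open>A rigid map that is not a motion reverses orientation at every point of the plane, so
  the test at the single point \<open>\<i>\<close> refutes the quantified condition.\<close>

lemma deck_sign_rigid:
  assumes "rigid G f"
  shows "deck_sign G f = (if motion G f then 1 else -1)"
proof (cases "motion G f")
  case True
  then show ?thesis using motion_orientation by (simp add: deck_sign_def)
next
  case False
  then have "\<not> orientation_preserving_at f \<i>"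
    using assms anti_motion_orientation[OF _ i_in_plane] unfolding rigid_def by blast
  then have "\<not> (\<forall>z\<in>plane G. orientation_preserving_at f z)" using i_in_plane by blast
  then show ?thesis using False by (simp add: deck_sign_def)
qed

lemma not_motion_anti_motion: "motion G f \<Longrightarrow> \<not> motion G (\<lambda>z. f (mirror z))"
  using motion_orientation[OF _ i_in_plane] anti_motion_orientation[OF _ i_in_plane] by blast

lemma orientation_preserving_cong:
  assumes "open V" "z \<in> V" "\<And>w. w \<in> V \<Longrightarrow> f w = g w" "orientation_preserving_at f z"
  shows "orientation_preserving_at g z"
proof -
  obtain D where D: "(f has_derivative D) (at z)" "planar_det (D 1) (D \<i>) > 0"
    using assms(4) unfolding orientation_preserving_at_def by blast
  have "(g has_derivative D) (at z)"
    by (rule has_derivative_transform_within_open[OF D(1) assms(1,2,3)])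
  then show ?thesis using D(2) unfolding orientation_preserving_at_def by blast
qed

text \<open>The identity theorem: motions are holomorphic on the connected plane.\<close>

lemma motion_eqI:
  assumes V: "open V" "V \<noteq> {}" "V \<subseteq> plane G" and eq: "\<And>z. z \<in> V \<Longrightarrow> f z = g z"
    and "motion G f" "motion G g" "z \<in> plane G"
  shows "f z = g z"
  by (rule analytic_continuation_open[OF V(1) open_plane V(2) connected_plane V(3)])
     (use assms motion_holomorphic in auto)

text \<open>Agreement near one point forces the same orientation behaviour. So both maps are
  motions, or both become motions after composition with \<open>mirror\<close>, and
  \<open>motion_eqI\<close> applies.\<close>

lemma rigid_eqI:
  assumes V: "open V" "V \<noteq> {}" "V \<subseteq> plane G" and eq: "\<And>z. z \<in> V \<Longrightarrow> f z = g z"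
    and r: "rigid G f" "rigid G g" and z: "z \<in> plane G"
  shows "f z = g z"
proof -
  obtain v where v: "v \<in> V" "v \<in> plane G" using V by blast
  have o: "orientation_preserving_at f v \<longleftrightarrow> orientation_preserving_at g v"
    using orientation_preserving_cong[OF V(1) v(1)] eq by metis
  consider "motion G f" "motion G g" | "motion G (\<lambda>z. f (mirror z))" "motion G (\<lambda>z. g (mirror z))"
    using r o motion_orientation[OF _ v(2)] anti_motion_orientation[OF _ v(2)] unfolding rigid_def by blast
  then show ?thesis
  proof cases
    case 1
    then show ?thesis using motion_eqI[of V G f g] V eq z by blast
  next
    case 2
    have "open (mirror -` V)"
      using V(1) unfolding mirror_def[abs_def] by (intro open_vimage continuous_intros)
    moreover have "mirror v \<in> mirror -` V" using v by simp
    moreover have "mirror -` V \<subseteq> plane G" using V(3) mirror_in_plane by blast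
    ultimately have "f (mirror (mirror z)) = g (mirror (mirror z))"
      using v motion_eqI[of "mirror -` V" G "\<lambda>z. f (mirror z)" "\<lambda>z. g (mirror z)" "mirror z"] eq 2 z by fastforce
    then show ?thesis by simp
  qed
qed

text \<open>Each point has a neighbourhood on which \<open>f\<close> agrees with a global rigid map
  \<open>R z\<close>. Neighbouring choices agree on an overlap, hence everywhere by
  \<open>rigid_eqI\<close>, and connectedness makes them all equal to \<open>R \<i>\<close>.\<close>

lemma locally_isometric_rigid:
  assumes "\<And>z. z \<in> plane G \<Longrightarrow> \<exists>U. open U \<and> z \<in> U \<and> U \<subseteq> plane G \<and> f ` U \<subseteq> plane G \<and>
     (\<forall>x\<in>U. \<forall>y\<in>U. plane_dist G (f x) (f y) = plane_dist G x y)"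
  shows "rigid G f"
proof -
  have "\<forall>z\<in>plane G. \<exists>R. rigid G R \<and> (\<exists>U. open U \<and> z \<in> U \<and> U \<subseteq> plane G \<and> (\<forall>x\<in>U. f x = R x))"
  proof
    fix z assume z: "z \<in> plane G"
    obtain U where U: "open U" "z \<in> U" "U \<subseteq> plane G" "f ` U \<subseteq> plane G"
     "\<forall>x\<in>U. \<forall>y\<in>U. plane_dist G (f x) (f y) = plane_dist G x y" using assms[OF z] by metis
    have "U \<noteq> {}" using U(2) by blast
    obtain R where "rigid G R" "\<forall>z\<in>U. f z = R z"
      by (rule local_isometry_rigid[OF U(1) \<open>U \<noteq> {}\<close> U(3,4)]) (use U(5) in auto)
    then show "\<exists>R. rigid G R \<and> (\<exists>U. open U \<and> z \<in> U \<and> U \<subseteq> plane G \<and> (\<forall>x\<in>U. f x = R x))"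
      using U by blast
  qed
  then obtain R where R: "\<And>z. z \<in> plane G \<Longrightarrow> rigid G (R z)"
    "\<And>z. z \<in> plane G \<Longrightarrow> \<exists>U. open U \<and> z \<in> U \<and> U \<subseteq> plane G \<and> (\<forall>x\<in>U. f x = R z x)"
    by metis
  have "\<forall>w\<in>plane G. R \<i> w = R z w" if z: "z \<in> plane G" for z
  proof (rule connected_equivalence_relation[OF connected_plane[of G], where a=\<i> and b=z and R="\<lambda>a b. \<forall>w\<in>plane G. R a w = R b w"])
    show "\<exists>T. openin (top_of_set (plane G)) T \<and> a \<in> T \<and> (\<forall>x\<in>T. \<forall>w\<in>plane G. R a w = R x w)" if a: "a \<in> plane G" for a
    proof -
      obtain U where U: "open U" "a \<in> U" "U \<subseteq> plane G" "\<forall>x\<in>U. f x = R a x" using R(2)[OF a] by blast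
      have "R a w = R x w" if x: "x \<in> U" and w: "w \<in> plane G" for x w
      proof -
        have xp: "x \<in> plane G" using x U by blast
        obtain V where V: "open V" "x \<in> V" "V \<subseteq> plane G" "\<forall>y\<in>V. f y = R x y" using R(2)[OF xp] by blast
        show ?thesis
          by (rule rigid_eqI[of "U \<inter> V" G]) (use U V x xp a w R(1) in auto)
      qed
      then show ?thesis using U open_subset by (intro exI[of _ U]) (auto simp: openin_open_eq)
    qed
  qed (use z in auto)
  then have "f z = R \<i> z" if "z \<in> plane G" for z
    using R(2)[OF that] that by auto
  then show ?thesis using rigid_cong R(1)[OF i_in_plane] by blast
qed

section \<open>Translation coordinates\<close>

lemma motion_plane_isometry:
  assumes "motion G f"
  shows "plane_isometry G f"
proof -
  obtain g where g: "motion G g" "\<And>z. z \<in> plane G \<Longrightarrow> g (f z) = z" "\<And>z. z \<in> plane G \<Longrightarrow> f (g z) = z"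
    using motion_inverse[OF assms] by blast
  have "bij_betw f (plane G) (plane G)"
    by (rule bij_betw_byWitness[where f'=g]) (use g assms motion_in_plane in auto)
  then show ?thesis using motion_dist[OF assms] by (simp add: plane_isometry_def)
qed

lemma plane_isometry_rigid:
  assumes "plane_isometry G f"
  shows "rigid G f"
proof -
  have f: "f ` plane G \<subseteq> plane G" using assms by (auto simp: plane_isometry_def bij_betw_def)
  have ne: "plane G \<noteq> {}" using i_in_plane by blast
  obtain R where "rigid G R" "\<forall>z\<in>plane G. f z = R z"
    by (rule local_isometry_rigid[OF open_plane ne order_refl f]) (use assms in \<open>auto simp: plane_isometry_def\<close>)
  then show ?thesis using rigid_cong by blast
qed

text \<open>The group law gives that \<open>\<phi> 0\<close> is idempotent, and an injective
  idempotent map is the identity.\<close>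

lemma one_parameter_group_0:
  assumes "one_parameter_group G \<phi> X" "z \<in> plane G"
  shows "\<phi> 0 z = z"
proof -
  have b: "bij_betw (\<phi> 0) (plane G) (plane G)"
    using assms(1) unfolding one_parameter_group_def plane_isometry_def by blast
  have "\<phi> (0 + 0) z = \<phi> 0 (\<phi> 0 z)"
    using assms unfolding one_parameter_group_def by blast
  then have "\<phi> 0 (\<phi> 0 z) = \<phi> 0 z" by simp
  moreover have "\<phi> 0 z \<in> plane G" using b assms(2) by (auto simp: bij_betw_def)
  ultimately show ?thesis using b assms(2) by (auto simp: bij_betw_def inj_on_def)
qed

text \<open>\<open>\<phi> s\<close> is the square of \<open>\<phi> (s / 2)\<close>, and the square
  of a rigid map preserves orientation.\<close>

lemma one_parameter_group_motion:
  assumes "one_parameter_group G \<phi> X"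
  shows "motion G (\<phi> s)"
proof -
  have r: "rigid G (\<phi> t)" for t
    using assms plane_isometry_rigid unfolding one_parameter_group_def by blast
  have "\<phi> s z = \<phi> (s / 2) (\<phi> (s / 2) z)" if "z \<in> plane G" for z
  proof -
    have "\<phi> (s / 2 + s / 2) z = \<phi> (s / 2) (\<phi> (s / 2) z)"
      using assms that unfolding one_parameter_group_def by blast
    then show ?thesis by simp
  qed
  then show ?thesis
    using motion_iff_compose[OF refl r r] motion_cong[of G "\<phi> s" "\<lambda>z. \<phi> (s / 2) (\<phi> (s / 2) z)"] by simp
qed

text \<open>Differentiate \<open>L (\<phi> s z) = L z + m s\<close> at \<open>s = 0\<close>. The
  chain rule on the left provides the derivative of \<open>m\<close>, which cannot depend on
  \<open>z\<close>.\<close>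

lemma generator_constant:
  assumes \<phi>: "one_parameter_group G \<phi> X" and L: "L holomorphic_on plane G"
    and m: "\<And>s z. z \<in> plane G \<Longrightarrow> L (\<phi> s z) = L z + m s"
  shows "\<exists>\<kappa>. \<forall>z\<in>plane G. deriv L z * X z = \<kappa>"
proof -
  have "(m has_vector_derivative deriv L z * X z) (at 0)" if z: "z \<in> plane G" for z
  proof -
    have "((\<lambda>s. \<phi> s z) has_vector_derivative X z) (at 0)"
      using \<phi> z unfolding one_parameter_group_def by blast
    moreover have "(L has_field_derivative deriv L (\<phi> 0 z)) (at (\<phi> 0 z))"
      using holomorphic_derivI[OF L open_plane z] one_parameter_group_0[OF \<phi> z] by simp
    ultimately have "(L \<circ> (\<lambda>s. \<phi> s z) has_vector_derivative X z * deriv L (\<phi> 0 z)) (at 0)"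
      by (rule field_vector_diff_chain_at)
    then have "((\<lambda>s. L z + m s) has_vector_derivative deriv L z * X z) (at 0)"
      using m[OF z] one_parameter_group_0[OF \<phi> z] by (simp add: o_def mult.commute)
    then have "((\<lambda>s. (L z + m s) - L z) has_vector_derivative deriv L z * X z - 0) (at 0)"
      by (rule has_vector_derivative_diff[OF _ has_vector_derivative_const])
    then show ?thesis by simp
  qed
  then show ?thesis using vector_derivative_unique_at i_in_plane by metis
qed

text \<open>Transports the explicit group of a normal form back to the original coordinates; this
  supplies the existence of a group through \<open>T\<close> with nowhere vanishing field.\<close>

lemma one_parameter_group_conjugate:
  assumes A: "motion Hyperbolic A" and B: "motion Hyperbolic B"
    "\<And>z. z \<in> plane Hyperbolic \<Longrightarrow> B (A z) = z" "\<And>z. z \<in> plane Hyperbolic \<Longrightarrow> A (B z) = z"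
    and N: "\<And>s. motion Hyperbolic (N s)" "\<And>s t z. z \<in> plane Hyperbolic \<Longrightarrow> N (s + t) z = N s (N t z)"
    "\<And>z. z \<in> plane Hyperbolic \<Longrightarrow> ((\<lambda>s. N s z) has_vector_derivative Y z) (at 0)"
    "\<And>z. z \<in> plane Hyperbolic \<Longrightarrow> Y z \<noteq> 0"
  obtains X where "one_parameter_group Hyperbolic (\<lambda>s z. B (N s (A z))) X" "\<And>z. z \<in> plane Hyperbolic \<Longrightarrow> X z \<noteq> 0"
proof
  let ?H = "plane Hyperbolic"
  define X where "X z = Y (A z) * deriv B (A z)" for z
  have in_H: "A z \<in> ?H" "B z \<in> ?H" "N s z \<in> ?H" if "z \<in> ?H" for z s
    using that motion_in_plane A B(1) N(1) by blast+
  have N0: "N 0 z = z" if z: "z \<in> ?H" for z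
  proof -
    have b: "bij_betw (N 0) ?H ?H"
      using motion_plane_isometry[OF N(1)] unfolding plane_isometry_def by blast
    have "N 0 (N 0 z) = N 0 z" using N(2)[OF z, of 0 0] by simp
    then show ?thesis using b z in_H(3)[OF z] by (auto simp: bij_betw_def inj_on_def)
  qed
  show "one_parameter_group Hyperbolic (\<lambda>s z. B (N s (A z))) X"
    unfolding one_parameter_group_def
  proof (intro conjI allI ballI impI)
    show "plane_isometry Hyperbolic (\<lambda>z. B (N s (A z)))" for s
      by (intro motion_plane_isometry motion_compose[OF B(1)] motion_compose[OF N(1) A])
    fix z assume z: "z \<in> ?H"
    show "B (N (s + t) (A z)) = B (N s (A (B (N t (A z)))))" for s t
      using N(2) in_H z B(3) by simp
    have "(B has_field_derivative deriv B (N 0 (A z))) (at (N 0 (A z)))"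
      using holomorphic_derivI[OF motion_holomorphic[OF B(1)] open_plane] N0 in_H z by simp
    from field_vector_diff_chain_at[OF N(3)[OF in_H(1)[OF z]] this]
    show "((\<lambda>s. B (N s (A z))) has_vector_derivative X z) (at 0)"
      using N0[OF in_H(1)[OF z]] by (simp add: o_def X_def)
  qed simp
  show "X z \<noteq> 0" if z: "z \<in> ?H" for z
  proof -
    obtain d where d: "(B has_field_derivative d) (at (A z))" "d \<noteq> 0"
      using motion_has_field_derivative[OF B(1) in_H(1)[OF z]] .
    then show ?thesis using N(4)[OF in_H(1)[OF z]] DERIV_imp_deriv[OF d(1)] by (simp add: X_def)
  qed
qed

section \<open>Normal forms of hyperbolic motions without fixed points, and their
  centralizers\<close>

lemma motion_translation: "motion Hyperbolic (\<lambda>z. z + of_real b)"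
proof -
  have "1 * 1 - b * 0 = 1 \<and> (\<forall>z. Im z > 0 \<longrightarrow> z + of_real b = moebius_real 1 b 0 1 z)"
    by (simp add: moebius_real_def)
  then show ?thesis unfolding motion.simps by blast
qed

lemma motion_scaling:
  assumes "k > 0"
  shows "motion Hyperbolic (\<lambda>z. of_real k * z)"
proof -
  have s: "sqrt k > 0" "sqrt k * sqrt k = k" using assms by auto
  then have "of_real k = complex_of_real (sqrt k) * of_real (sqrt k)" by (metis of_real_mult)
  then have "sqrt k * (1 / sqrt k) - 0 * 0 = 1 \<and> (\<forall>z. Im z > 0 \<longrightarrow> of_real k * z = moebius_real (sqrt k) 0 0 (1 / sqrt k) z)"
    using s by (simp add: moebius_real_def)
  then show ?thesis unfolding motion.simps by blast
qed

text \<open>With \<open>\<gamma> = 0\<close> the map is affine with slope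
  \<open>\<alpha>\<^sup>2\<close>. Slope 1 gives a translation; otherwise the real fixed point
  \<open>q\<close> is moved to 0 and a scaling remains.\<close>

lemma affine_normal_form:
  assumes T: "\<alpha> * \<delta> = 1" "\<And>z. Im z > 0 \<Longrightarrow> T z = moebius_real \<alpha> \<beta> 0 \<delta> z" "\<And>z. Im z > 0 \<Longrightarrow> T z \<noteq> z"
  obtains A where "motion Hyperbolic A"
    "(\<exists>k>0. k \<noteq> 1 \<and> (\<forall>z. Im z > 0 \<longrightarrow> A (T z) = of_real k * A z)) \<or>
     (\<exists>b::real. b \<noteq> 0 \<and> (\<forall>z. Im z > 0 \<longrightarrow> A (T z) = A z + of_real b))"
proof -
  have nz: "\<alpha> \<noteq> 0" "\<delta> \<noteq> 0" using T(1) by auto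
  then have inv: "\<delta> = 1 / \<alpha>" using T(1) by (simp add: field_simps)
  have Tz: "T z = of_real (\<alpha>\<^sup>2) * z + of_real (\<alpha> * \<beta>)" if "Im z > 0" for z
    using T(2)[OF that] nz by (simp add: moebius_real_def power2_eq_square inv field_simps)
  show ?thesis
  proof (cases "\<alpha>\<^sup>2 = 1")
    case True
    have "\<alpha> * \<beta> \<noteq> 0" using T(3)[of \<i>] Tz[of \<i>] True by auto
    then show ?thesis
      using Tz True motion_translation[of 0] by (intro that[of "\<lambda>z. z"] disjI2 exI[of _ "\<alpha> * \<beta>"]) auto
  next
    case False
    define q where "q = \<alpha> * \<beta> / (1 - \<alpha>\<^sup>2)"
    have q: "\<alpha> * \<beta> - q = - (\<alpha>\<^sup>2 * q)" using False by (simp add: q_def field_simps)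
    have "T z + of_real (-q) = of_real (\<alpha>\<^sup>2) * (z + of_real (-q))" if "Im z > 0" for z
    proof -
      have "T z + of_real (-q) = of_real (\<alpha>\<^sup>2) * z + of_real (\<alpha> * \<beta> - q)" unfolding Tz[OF that] by simp
      then show ?thesis unfolding q by (simp add: algebra_simps)
    qed
    then show ?thesis
      using motion_translation[of "-q"] False nz by (intro that[of "\<lambda>z. z + of_real (-q)"] disjI1 exI[of _ "\<alpha>\<^sup>2"]) auto
  qed
qed

text \<open>Fixed points solve a quadratic equation with real coefficients and discriminant
  \<open>(\<alpha> + \<delta>)\<^sup>2 - 4\<close>. Having none in the half-plane, \<open>T\<close>
  fixes a boundary point; moving that point to infinity makes \<open>T\<close> affine.\<close>

lemma hyperbolic_normal_form:
  assumes T: "motion Hyperbolic T" "\<And>z. Im z > 0 \<Longrightarrow> T z \<noteq> z"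
  obtains A where "motion Hyperbolic A"
    "(\<exists>k>0. k \<noteq> 1 \<and> (\<forall>z. Im z > 0 \<longrightarrow> A (T z) = of_real k * A z)) \<or>
     (\<exists>b::real. b \<noteq> 0 \<and> (\<forall>z. Im z > 0 \<longrightarrow> A (T z) = A z + of_real b))"
proof -
  obtain \<alpha> \<beta> \<gamma> \<delta> where f: "\<alpha> * \<delta> - \<beta> * \<gamma> = 1" "\<And>z. Im z > 0 \<Longrightarrow> T z = moebius_real \<alpha> \<beta> \<gamma> \<delta> z"
    using T(1) by auto
  show ?thesis
  proof (cases "\<gamma> = 0")
    case True
    show ?thesis by (rule affine_normal_form[of \<alpha> \<delta> T \<beta>]) (use f True T(2) that in auto)
  next
    case g: False
    have "(\<alpha> + \<delta>)\<^sup>2 \<ge> 4"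
    proof (rule ccontr)
      assume "\<not> (\<alpha> + \<delta>)\<^sup>2 \<ge> 4"
      then have neg: "4 - (\<alpha> + \<delta>)\<^sup>2 > 0" by simp
      \<comment> \<open>Real and imaginary part of the root of
        \<open>\<gamma> z\<^sup>2 + (\<delta> - \<alpha>) z - \<beta> = 0\<close> in the upper
        half-plane, which exists for negative discriminant.\<close>
      define x y where "x = (\<alpha> - \<delta>) / (2 * \<gamma>)" and "y = sqrt (4 - (\<alpha> + \<delta>)\<^sup>2) / (2 * \<bar>\<gamma>\<bar>)"
      have y: "y > 0" using neg g by (simp add: y_def)
      have y2: "4 * \<gamma>\<^sup>2 * y\<^sup>2 = 4 - (\<alpha> + \<delta>)\<^sup>2"
        using neg g by (simp add: y_def power_divide power_mult_distrib)
      have x: "2 * \<gamma> * x = \<alpha> - \<delta>" using g by (simp add: x_def)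
      have "4 * \<gamma> * (\<gamma> * (x\<^sup>2 - y\<^sup>2) + (\<delta> - \<alpha>) * x - \<beta>) = (2 * \<gamma> * x)\<^sup>2 - 4 * \<gamma>\<^sup>2 * y\<^sup>2 + 2 * (\<delta> - \<alpha>) * (2 * \<gamma> * x) - 4 * (\<beta> * \<gamma>)"
        by (simp add: algebra_simps power2_eq_square)
      also have "\<dots> = 4 * (\<alpha> * \<delta> - \<beta> * \<gamma>) - 4"
        unfolding x y2 by (simp add: algebra_simps power2_eq_square)
      finally have re: "\<gamma> * (x\<^sup>2 - y\<^sup>2) + (\<delta> - \<alpha>) * x - \<beta> = 0" using f(1) g by simp
      let ?z = "Complex x y"
      have "of_real \<alpha> * ?z + of_real \<beta> = ?z * (of_real \<gamma> * ?z + of_real \<delta>)"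
      proof (rule complex_eqI)
        show "Re (of_real \<alpha> * ?z + of_real \<beta>) = Re (?z * (of_real \<gamma> * ?z + of_real \<delta>))"
          using re by (simp add: algebra_simps power2_eq_square)
        have "(\<alpha> - \<delta>) * y = 2 * \<gamma> * x * y" unfolding x by simp
        then show "Im (of_real \<alpha> * ?z + of_real \<beta>) = Im (?z * (of_real \<gamma> * ?z + of_real \<delta>))"
          by (simp add: algebra_simps)
      qed
      then have "T ?z = ?z"
        using f(2)[of ?z] y moebius_real_denominator[OF f(1), of ?z] by (simp add: moebius_real_def)
      then show False using T(2) y by simp
    qed
    \<comment> \<open>A real root of the same quadratic equation, that is, a fixed point of
      \<open>T\<close> on the boundary line.\<close>
    define q where "q = (\<alpha> - \<delta> + sqrt ((\<alpha> + \<delta>)\<^sup>2 - 4)) / (2 * \<gamma>)"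
    have q1: "(2 * \<gamma> * q - (\<alpha> - \<delta>))\<^sup>2 = (\<alpha> + \<delta>)\<^sup>2 - 4"
      using \<open>(\<alpha> + \<delta>)\<^sup>2 \<ge> 4\<close> g by (simp add: q_def)
    have "4 * \<gamma> * (\<gamma> * q\<^sup>2 + (\<delta> - \<alpha>) * q - \<beta>) = (2 * \<gamma> * q - (\<alpha> - \<delta>))\<^sup>2 - (\<alpha> - \<delta>)\<^sup>2 - 4 * (\<beta> * \<gamma>)"
      by (simp add: algebra_simps power2_eq_square)
    also have "\<dots> = 0" unfolding q1 using f(1) by (simp add: algebra_simps power2_eq_square)
    finally have q: "\<gamma> * q\<^sup>2 + (\<delta> - \<alpha>) * q - \<beta> = 0" using g by simp
    \<comment> \<open>\<open>?A\<close> is \<open>-1 / (z - q)\<close>, which takes \<open>q\<close>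
      to infinity; \<open>?T'\<close> is the matrix of the conjugate of \<open>T\<close> by
      \<open>?A\<close>, now with lower left entry 0.\<close>
    let ?A = "moebius_real 0 (-1) 1 (-q)" and ?T' = "moebius_real (\<gamma> * q + \<delta>) (-\<gamma>) 0 (\<alpha> - \<gamma> * q)"
    have dA: "0 * (-q) - (-1) * 1 = (1::real)" by simp
    have det: "(\<gamma> * q + \<delta>) * (\<alpha> - \<gamma> * q) = 1"
    proof -
      have "(\<gamma> * q + \<delta>) * (\<alpha> - \<gamma> * q) = - \<gamma> * (\<gamma> * q\<^sup>2 + (\<delta> - \<alpha>) * q - \<beta>) + (\<alpha> * \<delta> - \<beta> * \<gamma>)"
        by (simp add: algebra_simps power2_eq_square)
      then show ?thesis using q f(1) by simp
    qed
    have A: "motion Hyperbolic ?A" unfolding motion.simps using dA by blast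
    have conj: "?A (T z) = ?T' (?A z)" if z: "Im z > 0" for z
    proof -
      have "?A (T z) = moebius_real (-\<gamma>) (-\<delta>) (\<alpha> - q * \<gamma>) (\<beta> - q * \<delta>) z"
        unfolding f(2)[OF z] moebius_real_compose[OF dA f(1) z] by simp
      moreover have "?T' (?A z) = moebius_real (-\<gamma>) (-\<delta>) (\<alpha> - q * \<gamma>) (- q * (\<alpha> - \<gamma> * q)) z"
        using moebius_real_compose[of "\<gamma> * q + \<delta>" "\<alpha> - \<gamma> * q" "-\<gamma>" 0, OF _ dA z] det by (simp add: algebra_simps)
      moreover have "\<beta> - q * \<delta> = - q * (\<alpha> - \<gamma> * q)" using q by (simp add: algebra_simps power2_eq_square)
      ultimately show ?thesis by simp
    qed
    obtain B where B: "motion Hyperbolic B" "\<And>z. z \<in> plane Hyperbolic \<Longrightarrow> B (?A z) = z" "\<And>z. z \<in> plane Hyperbolic \<Longrightarrow> ?A (B z) = z"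
      using motion_inverse[OF A] by blast
    have ApH: "Im (?A z) > 0" if "Im z > 0" for z using motion_in_plane[OF A, of z] that by simp
    have nofix: "?T' z \<noteq> z" if z: "Im z > 0" for z
    proof
      assume "?T' z = z"
      have Bz: "Im (B z) > 0" using motion_in_plane[OF B(1), of z] z by simp
      have TB: "Im (T (B z)) > 0" using motion_in_plane[OF T(1), of "B z"] Bz by simp
      have "?A (T (B z)) = ?A (B z)" using conj[OF Bz] B(3)[of z] z \<open>?T' z = z\<close> by simp
      then have "T (B z) = B z" using B(2)[of "T (B z)"] B(2)[of "B z"] Bz TB by simp
      then show False using T(2) Bz by blast
    qed
    obtain C where C: "motion Hyperbolic C"
      "(\<exists>k>0. k \<noteq> 1 \<and> (\<forall>z. Im z > 0 \<longrightarrow> C (?T' z) = of_real k * C z)) \<or>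
       (\<exists>b::real. b \<noteq> 0 \<and> (\<forall>z. Im z > 0 \<longrightarrow> C (?T' z) = C z + of_real b))"
      by (rule affine_normal_form[OF det refl nofix])
    show ?thesis
      by (rule that[OF motion_compose[OF C(1) A]]) (use C(2) conj ApH in fastforce)
  qed
qed

text \<open>Compare both sides at \<open>\<i> * y\<close>. The real parts give an equation in
  \<open>y\<^sup>2\<close>, and two values of \<open>y\<close> separate its coefficients; the
  imaginary parts give \<open>\<beta> * \<gamma> = 0\<close>. Only a diagonal matrix is
  left.\<close>

lemma motion_commuting_scaling:
  assumes f: "motion Hyperbolic f" and k: "k > 0" "k \<noteq> 1"
    and c: "\<And>w. Im w > 0 \<Longrightarrow> f (of_real k * w) = of_real k * f w"
  obtains \<mu> where "\<mu> > 0" "\<And>w. Im w > 0 \<Longrightarrow> f w = of_real \<mu> * w"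
proof -
  obtain \<alpha> \<beta> \<gamma> \<delta> where m: "\<alpha> * \<delta> - \<beta> * \<gamma> = 1" "\<And>z. Im z > 0 \<Longrightarrow> f z = moebius_real \<alpha> \<beta> \<gamma> \<delta> z"
    using f by auto
  have id: "\<beta> * \<delta> - \<alpha> * \<gamma> * k * y\<^sup>2 = k * (\<beta> * \<delta> - \<alpha> * \<gamma> * k * y\<^sup>2)"
    "y * (\<alpha> * k * \<delta> + \<beta> * \<gamma>) = y * (k * (\<alpha> * \<delta> + \<beta> * \<gamma> * k))" if y: "y > 0" for y
  proof -
    let ?w = "\<i> * of_real y"
    have p: "Im ?w > 0" "Im (of_real k * ?w) > 0" using y k by auto
    have d: "of_real \<gamma> * ?w + of_real \<delta> \<noteq> 0" "of_real \<gamma> * (of_real k * ?w) + of_real \<delta> \<noteq> 0"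
      using moebius_real_denominator[OF m(1)] p by blast+
    have "(of_real \<alpha> * (of_real k * ?w) + of_real \<beta>) / (of_real \<gamma> * (of_real k * ?w) + of_real \<delta>) =
      (of_real k * (of_real \<alpha> * ?w + of_real \<beta>)) / (of_real \<gamma> * ?w + of_real \<delta>)"
      using c[OF p(1)] unfolding m(2)[OF p(1)] m(2)[OF p(2)] moebius_real_def by simp
    note iffD1[OF frac_eq_eq[OF d(2,1)] this]
    then show "\<beta> * \<delta> - \<alpha> * \<gamma> * k * y\<^sup>2 = k * (\<beta> * \<delta> - \<alpha> * \<gamma> * k * y\<^sup>2)"
      "y * (\<alpha> * k * \<delta> + \<beta> * \<gamma>) = y * (k * (\<alpha> * \<delta> + \<beta> * \<gamma> * k))"
      by (auto simp: complex_eq_iff algebra_simps power2_eq_square)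
  qed
  have z: "\<beta> * \<delta> - \<alpha> * \<gamma> * k * y\<^sup>2 = 0" if "y > 0" for y
    using id(1)[OF that] k by (metis mult_cancel_right1)
  have "\<alpha> * \<gamma> * k = 0" "\<beta> * \<delta> = 0" using z[of 1] z[of 2] by auto
  then have ag: "\<alpha> * \<gamma> = 0" using k by simp
  have "\<beta> * \<gamma> * (1 - k * k) = 0" using id(2)[of 1] by (simp add: algebra_simps)
  moreover have "1 - k * k \<noteq> 0" using k by (metis abs_of_pos eq_iff_diff_eq_0 power2_eq_square real_sqrt_abs2 real_sqrt_one)
  ultimately have "\<beta> * \<gamma> = 0" by simp
  then have ad: "\<alpha> * \<delta> = 1" using m(1) by linarith
  then have nz: "\<alpha> \<noteq> 0" "\<delta> \<noteq> 0" by auto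
  then have inv: "\<delta> = 1 / \<alpha>" using ad by (simp add: field_simps)
  have "\<gamma> = 0" "\<beta> = 0" using ag \<open>\<beta> * \<delta> = 0\<close> nz by auto
  then have "f w = of_real (\<alpha>\<^sup>2) * w" if "Im w > 0" for w
    using m(2)[OF that] nz \<open>\<gamma> = 0\<close> \<open>\<beta> = 0\<close> by (simp add: moebius_real_def power2_eq_square inv)
  then show ?thesis using that[of "\<alpha>\<^sup>2"] nz by simp
qed

text \<open>By \<open>moebius_real_diff\<close> the increment over \<open>b\<close> is
  \<open>b\<close> divided by the product \<open>?d\<close> of the two denominators, so
  \<open>?d = 1\<close>. Its real part along the imaginary axis contains
  \<open>\<gamma>\<^sup>2 * y\<^sup>2\<close>, which forces \<open>\<gamma> = 0\<close>.\<close>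

lemma motion_commuting_translation:
  assumes f: "motion Hyperbolic f" and b: "b \<noteq> 0"
    and c: "\<And>w. Im w > 0 \<Longrightarrow> f (w + of_real b) = f w + of_real b"
  obtains t :: real where "\<And>w. Im w > 0 \<Longrightarrow> f w = w + of_real t"
proof -
  obtain \<alpha> \<beta> \<gamma> \<delta> where m: "\<alpha> * \<delta> - \<beta> * \<gamma> = 1" "\<And>z. Im z > 0 \<Longrightarrow> f z = moebius_real \<alpha> \<beta> \<gamma> \<delta> z"
    using f by auto
  have id: "(\<gamma> * b + \<delta>) * \<delta> - \<gamma>\<^sup>2 * y\<^sup>2 = 1" if y: "y > 0" for y
  proof -
    let ?w = "\<i> * of_real y"
    have p: "Im ?w > 0" "Im (?w + of_real b) > 0" using y by auto
    let ?d = "(of_real \<gamma> * (?w + of_real b) + of_real \<delta>) * (of_real \<gamma> * ?w + of_real \<delta>)"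
    have d: "?d \<noteq> 0" using moebius_real_denominator[OF m(1)] p by (metis mult_eq_0_iff)
    have "of_real b = of_real b / ?d"
      using moebius_real_diff[OF m(1) p(2,1)] c[OF p(1)] unfolding m(2)[OF p(1)] m(2)[OF p(2)] by simp
    then have "?d = 1" using d b by (metis divide_cancel_left div_by_1 of_real_eq_0_iff)
    then have "Re ?d = 1" by simp
    then show ?thesis by (simp add: algebra_simps power2_eq_square)
  qed
  have "\<gamma>\<^sup>2 = 0" using id[of 1, simplified] id[of 2, simplified] by linarith
  then have g: "\<gamma> = 0" by simp
  then have d: "\<delta> * \<delta> = 1" "\<alpha> * \<delta> = 1" using id[of 1] m(1) by auto
  then have "\<delta> \<noteq> 0" by auto
  then have "\<alpha> = \<delta>" using d by (metis mult_right_cancel)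
  then have "f w = w + of_real (\<beta> / \<delta>)" if "Im w > 0" for w
    using m(2)[OF that] g \<open>\<delta> \<noteq> 0\<close> \<open>\<alpha> = \<delta>\<close> by (simp add: moebius_real_def add_divide_distrib)
  then show ?thesis using that by blast
qed

lemma has_vector_derivative_powr_0:
  assumes "k > 0"
  shows "((\<lambda>s. of_real (k powr s) * z) has_vector_derivative of_real (ln k) * (z::complex)) (at 0)"
proof -
  have "((\<lambda>s. k powr s) has_real_derivative ln k) (at 0)"
    using assms by (auto intro!: derivative_eq_intros)
  then have "((\<lambda>s. complex_of_real (k powr s)) has_vector_derivative of_real (ln k)) (at 0)"
    by (simp add: has_real_derivative_iff_has_vector_derivative has_vector_derivative_of_real)
  then show ?thesis by (rule has_vector_derivative_mult_left)
qed

text \<open>\<open>L\<close> is a conformal coordinate in which \<open>T\<close> and every one-parameter group through \<open>T\<close> act by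
  translations, so the generating vector field becomes constant.\<close>

proposition straightening:
  assumes T: "motion G T" "\<And>z. z \<in> plane G \<Longrightarrow> T z \<noteq> z"
  obtains L b where "L holomorphic_on plane G" "inj_on L (plane G)" "b \<noteq> 0"
    "\<And>z. z \<in> plane G \<Longrightarrow> L (T z) = L z + b"
    "\<And>\<phi> X. one_parameter_group G \<phi> X \<Longrightarrow> (\<And>z. z \<in> plane G \<Longrightarrow> \<phi> 1 z = T z) \<Longrightarrow> \<exists>\<kappa>. \<forall>z\<in>plane G. deriv L z * X z = \<kappa>"
    "\<exists>\<phi> X. one_parameter_group G \<phi> X \<and> (\<forall>z\<in>plane G. \<phi> 1 z = T z) \<and> (\<forall>z\<in>plane G. X z \<noteq> 0)"
proof (cases G)
  case Euclidean
  obtain u a where f: "cmod u = 1" "\<And>z. T z = u * z + a" using T(1) Euclidean by auto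
  have "u = 1"
  proof (rule ccontr)
    assume "u \<noteq> 1"
    then have "T (a / (1 - u)) = a / (1 - u)" unfolding f(2) by (simp add: field_simps)
    then show False using T(2) Euclidean by auto
  qed
  have a: "a \<noteq> 0" using T(2)[of 0] f(2)[of 0] Euclidean by simp
  show ?thesis
  proof (rule that[of "\<lambda>z. z" a])
    show "\<exists>\<kappa>. \<forall>z\<in>plane G. deriv (\<lambda>z. z) z * X z = \<kappa>" if "one_parameter_group G \<phi> X" for \<phi> X
    proof -
      have "\<forall>s. \<exists>a. \<forall>z. \<phi> s z = z + a"
        using that Euclidean unfolding one_parameter_group_def by blast
      then obtain m where m: "\<And>s z. \<phi> s z = z + m s" by metis
      show ?thesis by (rule generator_constant[OF that, of "\<lambda>z. z" m]) (simp_all add: m)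
    qed
    have "one_parameter_group G (\<lambda>s z. z + of_real s * a) (\<lambda>_. a)"
      unfolding one_parameter_group_def
    proof (intro conjI allI impI ballI)
      show "plane_isometry G (\<lambda>z. z + of_real s * a)" for s
      proof -
        have "cmod 1 = 1 \<and> (\<forall>z. z + of_real s * a = 1 * z + of_real s * a)" by simp
        then show ?thesis unfolding Euclidean by (intro motion_plane_isometry) (metis motion.simps(1))
      qed
      show "((\<lambda>s. z + of_real s * a) has_vector_derivative a) (at 0)" for z
        by (auto intro!: derivative_eq_intros)
    qed (auto simp: algebra_simps)
    then show "\<exists>\<phi> X. one_parameter_group G \<phi> X \<and> (\<forall>z\<in>plane G. \<phi> 1 z = T z) \<and> (\<forall>z\<in>plane G. X z \<noteq> 0)"
      using f(2) \<open>u = 1\<close> a by (intro exI[of _ "\<lambda>s z. z + of_real s * a"] exI[of _ "\<lambda>_. a"]) auto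
  qed (use f \<open>u = 1\<close> a in \<open>auto simp: holomorphic_on_ident\<close>)
next
  case Hyperbolic
  let ?H = "plane Hyperbolic"
  have TH: "motion Hyperbolic T" "\<And>z. Im z > 0 \<Longrightarrow> T z \<noteq> z" using T Hyperbolic by auto
  obtain A where A: "motion Hyperbolic A" and
    nf: "(\<exists>k>0. k \<noteq> 1 \<and> (\<forall>z. Im z > 0 \<longrightarrow> A (T z) = of_real k * A z)) \<or>
     (\<exists>b::real. b \<noteq> 0 \<and> (\<forall>z. Im z > 0 \<longrightarrow> A (T z) = A z + of_real b))"
    using hyperbolic_normal_form[OF TH] by blast
  obtain B where B: "motion Hyperbolic B" "\<And>z. z \<in> ?H \<Longrightarrow> B (A z) = z" "\<And>z. z \<in> ?H \<Longrightarrow> A (B z) = z"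
    using motion_inverse[OF A] by blast
  have in_H: "Im (A z) > 0" "Im (B z) > 0" "Im (T z) > 0" if "Im z > 0" for z
    using that motion_in_plane[OF A, of z] motion_in_plane[OF B(1), of z] motion_in_plane[OF TH(1), of z] by auto
  have AB: "B (A z) = z" "A (B z) = z" if "Im z > 0" for z using B that by auto
  have injA: "inj_on A ?H" using AB(1) by (metis inj_onI mem_Collect_eq plane.simps(2))
  have holA: "A holomorphic_on ?H" using motion_holomorphic[OF A] .
  \<comment> \<open>\<open>\<phi> s\<close> commutes with \<open>\<phi> 1 = T\<close> because
    addition is commutative; in the coordinate \<open>A\<close> it therefore commutes with the
    normal form \<open>N\<close> of \<open>T\<close>, and the two centralizer lemmas apply.\<close>
  have comm: "A (\<phi> s (B (N w))) = N (A (\<phi> s (B w)))"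
    if \<phi>: "one_parameter_group G \<phi> X" "\<And>z. z \<in> plane G \<Longrightarrow> \<phi> 1 z = T z" and w: "Im w > 0"
      and N: "\<And>z. Im z > 0 \<Longrightarrow> A (T z) = N (A z)" for \<phi> X s w N
  proof -
    have Bw: "Im (B w) > 0" using in_H w by blast
    have ps: "Im (\<phi> s z) > 0" if "Im z > 0" for s z
      using motion_in_plane[OF one_parameter_group_motion[OF \<phi>(1), of s], of z] Hyperbolic that by simp
    have add: "\<phi> (s + t) z = \<phi> s (\<phi> t z)" if "Im z > 0" for s t z
      using \<phi>(1) that Hyperbolic unfolding one_parameter_group_def by auto
    have one: "\<phi> 1 z = T z" if "Im z > 0" for z using \<phi>(2) that Hyperbolic by simp
    have "N w = A (T (B w))" using N[OF Bw] AB(2)[OF w] by simp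
    then have "A (\<phi> s (B (N w))) = A (\<phi> s (T (B w)))" using AB(1)[OF in_H(3)[OF Bw]] by simp
    also have "\<phi> s (T (B w)) = T (\<phi> s (B w))"
      using add[OF Bw, of s 1] add[OF Bw, of 1 s] one Bw ps[OF Bw] by (simp add: add.commute)
    also have "A (T (\<phi> s (B w))) = N (A (\<phi> s (B w)))" using N ps[OF Bw] by blast
    finally show ?thesis .
  qed
  have mot: "motion Hyperbolic (\<lambda>w. A (\<phi> s (B w)))" if "one_parameter_group G \<phi> X" for \<phi> X s
    using motion_compose[OF A motion_compose[OF _ B(1)]] one_parameter_group_motion[OF that] Hyperbolic by auto
  from nf show ?thesis
  proof
    assume "\<exists>k>0. k \<noteq> 1 \<and> (\<forall>z. Im z > 0 \<longrightarrow> A (T z) = of_real k * A z)"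
    then obtain k where k: "k > 0" "k \<noteq> 1" "\<And>z. Im z > 0 \<Longrightarrow> A (T z) = of_real k * A z" by blast
    \<comment> \<open>The logarithm turns scaling by \<open>k\<close> into translation by
      \<open>ln k\<close>. It is holomorphic here, since \<open>A\<close> takes values in the upper
      half-plane, away from the branch cut.\<close>
    let ?L = "\<lambda>z. Ln (A z)"
    have Anz: "A z \<noteq> 0" "A z \<notin> \<real>\<^sub>\<le>\<^sub>0" if "Im z > 0" for z
      using in_H(1)[OF that] by (auto simp: complex_nonpos_Reals_iff)
    have Ln_scale: "Ln (of_real r * A z) = Ln (A z) + of_real (ln r)" if "r > 0" "Im z > 0" for r z
      using Ln_times_of_real[OF that(1) Anz(1)[OF that(2)]] Ln_of_real[OF that(1)] by (simp add: add.commute)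
    show ?thesis
    proof (rule that[of ?L "of_real (ln k)"])
      show holL: "?L holomorphic_on plane G"
        using holA Anz Hyperbolic by (intro holomorphic_intros) auto
      show "inj_on ?L (plane G)"
        using injA Anz Hyperbolic unfolding inj_on_def by (metis exp_Ln mem_Collect_eq plane.simps(2))
      show "?L (T z) = ?L z + of_real (ln k)" if "z \<in> plane G" for z
        using that Hyperbolic k Ln_scale[OF k(1), of z] by simp
      show "\<exists>\<kappa>. \<forall>z\<in>plane G. deriv ?L z * X z = \<kappa>"
        if \<phi>: "one_parameter_group G \<phi> X" "\<And>z. z \<in> plane G \<Longrightarrow> \<phi> 1 z = T z" for \<phi> X
      proof -
        have "\<exists>\<mu>>0. \<forall>w. Im w > 0 \<longrightarrow> A (\<phi> s (B w)) = of_real \<mu> * w" for s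
          using motion_commuting_scaling[OF mot[OF \<phi>(1)] k(1,2) comm[OF \<phi> _ k(3)]] by metis
        then obtain \<mu> where \<mu>: "\<And>s. \<mu> s > 0" "\<And>s w. Im w > 0 \<Longrightarrow> A (\<phi> s (B w)) = of_real (\<mu> s) * w" by metis
        show ?thesis
        proof (rule generator_constant[OF \<phi>(1) holL, of "\<lambda>s. of_real (ln (\<mu> s))"])
          fix s z assume "z \<in> plane G"
          then have z: "Im z > 0" using Hyperbolic by simp
          show "?L (\<phi> s z) = ?L z + of_real (ln (\<mu> s))"
            using \<mu>(2)[OF in_H(1)[OF z], of s] AB(1)[OF z] Ln_scale[OF \<mu>(1) z] by simp
        qed
      qed
      obtain X where X: "one_parameter_group Hyperbolic (\<lambda>s z. B (of_real (k powr s) * A z)) X" "\<And>z. z \<in> ?H \<Longrightarrow> X z \<noteq> 0"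
        by (rule one_parameter_group_conjugate[OF A B, of "\<lambda>s z. of_real (k powr s) * z" "\<lambda>z. of_real (ln k) * z"])
           (use k motion_scaling has_vector_derivative_powr_0 in \<open>auto simp: powr_add\<close>)
      have "B (of_real (k powr 1) * A z) = T z" if "Im z > 0" for z
        using k(1) k(3)[OF that] AB(1)[OF in_H(3)[OF that]] by simp
      then show "\<exists>\<phi> X. one_parameter_group G \<phi> X \<and> (\<forall>z\<in>plane G. \<phi> 1 z = T z) \<and> (\<forall>z\<in>plane G. X z \<noteq> 0)"
        using X Hyperbolic by (intro exI[of _ "\<lambda>s z. B (of_real (k powr s) * A z)"] exI[of _ X]) auto
    qed (use k in auto)
  next
    assume "\<exists>b::real. b \<noteq> 0 \<and> (\<forall>z. Im z > 0 \<longrightarrow> A (T z) = A z + of_real b)"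
    then obtain b :: real where b: "b \<noteq> 0" "\<And>z. Im z > 0 \<Longrightarrow> A (T z) = A z + of_real b" by blast
    show ?thesis
    proof (rule that[of A "of_real b"])
      show holL: "A holomorphic_on plane G" "inj_on A (plane G)" using holA injA Hyperbolic by auto
      show "\<exists>\<kappa>. \<forall>z\<in>plane G. deriv A z * X z = \<kappa>"
        if \<phi>: "one_parameter_group G \<phi> X" "\<And>z. z \<in> plane G \<Longrightarrow> \<phi> 1 z = T z" for \<phi> X
      proof -
        have "\<exists>\<mu>::real. \<forall>w. Im w > 0 \<longrightarrow> A (\<phi> s (B w)) = w + of_real \<mu>" for s
          using motion_commuting_translation[OF mot[OF \<phi>(1)] b(1) comm[OF \<phi> _ b(2)]] by metis
        then obtain \<mu> :: "real \<Rightarrow> real" where \<mu>: "\<And>s w. Im w > 0 \<Longrightarrow> A (\<phi> s (B w)) = w + of_real (\<mu> s)" by metis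
        show ?thesis
        proof (rule generator_constant[OF \<phi>(1) holL(1), of "\<lambda>s. of_real (\<mu> s)"])
          fix s z assume "z \<in> plane G"
          then have z: "Im z > 0" using Hyperbolic by simp
          show "A (\<phi> s z) = A z + of_real (\<mu> s)"
            using \<mu>[OF in_H(1)[OF z], of s] AB(1)[OF z] by simp
        qed
      qed
      have d: "((\<lambda>s. z + of_real (s * b)) has_vector_derivative of_real b) (at 0)" for z :: complex
        by (auto intro!: derivative_eq_intros)
      obtain X where X: "one_parameter_group Hyperbolic (\<lambda>s z. B (A z + of_real (s * b))) X" "\<And>z. z \<in> ?H \<Longrightarrow> X z \<noteq> 0"
      proof (rule one_parameter_group_conjugate[OF A B, of "\<lambda>s z. z + of_real (s * b)" "\<lambda>z. of_real b"])
        show "motion Hyperbolic (\<lambda>z. z + of_real (s * b))" for s :: real by (rule motion_translation)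
        show "((\<lambda>s. z + of_real (s * b)) has_vector_derivative of_real b) (at 0)" for z :: complex by (rule d)
      qed (use b(1) in \<open>auto simp: distrib_right\<close>)
      have "B (A z + of_real (1 * b)) = T z" if "Im z > 0" for z
        using b(2)[OF that] AB(1)[OF in_H(3)[OF that]] by simp
      then show "\<exists>\<phi> X. one_parameter_group G \<phi> X \<and> (\<forall>z\<in>plane G. \<phi> 1 z = T z) \<and> (\<forall>z\<in>plane G. X z \<noteq> 0)"
        using X Hyperbolic by (intro exI[of _ "\<lambda>s z. B (A z + of_real (s * b))"] exI[of _ X]) auto
    qed (use b Hyperbolic in auto)
  qed
qed

section \<open>Coverings by a model plane\<close>

text \<open>The lifting theorems of the library are stated for coverings of subsets of normed spaces. Every
  metric space is a subset of one by Kuratowski's embedding.\<close>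

lemma kuratowski_embedding:
  obtains e :: "'m::metric_space \<Rightarrow> 'm \<Rightarrow>\<^sub>C real" where "\<And>x y. dist (e x) (e y) = dist x y"
proof -
  obtain a :: 'm where True by blast
  define e where "e x = Bcontfun (\<lambda>y. dist x y - dist a y)" for x :: 'm
  have e: "apply_bcontfun (e x) y = dist x y - dist a y" for x y
  proof -
    have "(\<lambda>y. dist x y - dist a y) \<in> bcontfun"
    proof (rule bcontfun_normI)
      show "continuous_on UNIV (\<lambda>y. dist x y - dist a y)" by (intro continuous_intros)
      show "norm (dist x y - dist a y) \<le> dist x a" for y
        using dist_triangle[of x y a] dist_triangle[of a y x] by (simp add: dist_commute abs_le_iff)
    qed
    then show ?thesis by (simp add: e_def Bcontfun_inverse)
  qed
  have "dist (e x) (e y) = dist x y" for x y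
  proof (rule antisym)
    show "dist (e x) (e y) \<le> dist x y"
    proof (rule dist_bound)
      show "dist (apply_bcontfun (e x) z) (apply_bcontfun (e y) z) \<le> dist x y" for z
        using dist_triangle[of x z y] dist_triangle[of y z x] by (simp add: e dist_real_def dist_commute abs_le_iff)
    qed
    show "dist x y \<le> dist (e x) (e y)"
      using dist_bounded[of "e x" y "e y"] by (simp add: e dist_real_def)
  qed
  then show ?thesis using that by blast
qed

lemma covering_space_isometric_image:
  fixes p :: "'a::topological_space \<Rightarrow> 'b::metric_space" and e :: "'b \<Rightarrow> 'c::metric_space"
  assumes cov: "covering_space C p S" and e: "\<And>x y. dist (e x) (e y) = dist x y"
  shows "covering_space C (e \<circ> p) (e ` S)"
proof -
  have inj: "inj e" using e by (metis dist_eq_0_iff injI)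
  have ce: "continuous_on A e" for A
    unfolding continuous_on_iff using e by metis
  have hom: "homeomorphism T (e ` T) e (inv e)" for T
  proof (rule homeomorphismI)
    show "continuous_on (e ` T) (inv e)"
      unfolding continuous_on_iff using e inj by (metis (no_types, lifting) imageE inv_f_f)
  qed (use ce inj in auto)
  have op: "openin (top_of_set (e ` S)) (e ` T)" if "openin (top_of_set S) T" for T
    using homeomorphism_imp_open_map[OF hom that] .
  have surj: "p ` C = S" using covering_space_imp_surjective[OF cov] .
  show ?thesis
  proof
    show "continuous_on C (e \<circ> p)"
      using covering_space_imp_continuous[OF cov] ce continuous_on_compose by blast
    show "(e \<circ> p) ` C = e ` S" using surj by (metis image_comp)
    fix x assume "x \<in> e ` S"
    then obtain y where y: "y \<in> S" "x = e y" by blast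
    then obtain T v where T: "y \<in> T" "openin (top_of_set S) T" "\<Union>v = C \<inter> p -` T"
      "\<forall>u\<in>v. openin (top_of_set C) u" "pairwise disjnt v" "\<forall>u\<in>v. \<exists>q. homeomorphism u T p q"
      using cov unfolding covering_space_def by metis
    have "C \<inter> (e \<circ> p) -` (e ` T) = C \<inter> p -` T" using inj by (auto dest: injD)
    moreover have "\<forall>u\<in>v. \<exists>q. homeomorphism u (e ` T) (e \<circ> p) q"
      using T(6) hom homeomorphism_compose by blast
    ultimately show "\<exists>T. x \<in> T \<and> openin (top_of_set (e ` S)) T \<and>
       (\<exists>v. \<Union> v = C \<inter> (e \<circ> p) -` T \<and> (\<forall>u\<in>v. openin (top_of_set C) u) \<and> disjoint v \<and>
          (\<forall>u\<in>v. \<exists>q. homeomorphism u T (e \<circ> p) q))"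
      using T y op by (intro exI[of _ "e ` T"]) auto
  qed
qed

lemma metric_covering_lift:
  fixes p :: "'a::real_normed_vector \<Rightarrow> 'b::metric_space" and f :: "'c::real_normed_vector \<Rightarrow> 'b"
  assumes cov: "covering_space C p S" and U: "simply_connected U" "locally path_connected U" "z \<in> U"
    and f: "continuous_on U f" "f ` U \<subseteq> S" and a: "a \<in> C" "f z = p a"
  obtains g where "continuous_on U g" "g ` U \<subseteq> C" "g z = a" "\<And>y. y \<in> U \<Longrightarrow> p (g y) = f y"
proof -
  obtain e :: "'b \<Rightarrow> 'b \<Rightarrow>\<^sub>C real" where e: "\<And>x y. dist (e x) (e y) = dist x y"
    using kuratowski_embedding by blast
  have inj: "inj e" using e by (metis dist_eq_0_iff injI)
  have ce: "continuous_on A e" for A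
    unfolding continuous_on_iff using e by metis
  obtain g where g: "continuous_on U g" "g \<in> U \<rightarrow> C" "g z = a" "\<And>y. y \<in> U \<Longrightarrow> (e \<circ> p) (g y) = (e \<circ> f) y"
  proof (rule covering_space_lift_strong[OF covering_space_isometric_image[OF cov e] a(1) U(3,1,2)])
    show "continuous_on U (e \<circ> f)" using f(1) ce continuous_on_compose by blast
    show "e \<circ> f \<in> U \<rightarrow> e ` S" using f(2) by auto
    show "(e \<circ> f) z = (e \<circ> p) a" using a(2) by simp
  qed blast
  have "p (g y) = f y" if "y \<in> U" for y using g(4)[OF that] inj by (auto dest: injD)
  then show ?thesis using that g by blast
qed

lemma metric_covering_monodromy:
  fixes p :: "'a::real_normed_vector \<Rightarrow> 'b::metric_space"
  assumes cov: "covering_space C p S" and hom: "homotopic_paths S g1 g2"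
    and h1: "path h1" "path_image h1 \<subseteq> C" "\<And>t. t \<in> {0..1} \<Longrightarrow> p (h1 t) = g1 t"
    and h2: "path h2" "path_image h2 \<subseteq> C" "\<And>t. t \<in> {0..1} \<Longrightarrow> p (h2 t) = g2 t"
    and start: "pathstart h1 = pathstart h2"
  shows "pathfinish h1 = pathfinish h2"
proof -
  obtain e :: "'b \<Rightarrow> 'b \<Rightarrow>\<^sub>C real" where e: "\<And>x y. dist (e x) (e y) = dist x y"
    using kuratowski_embedding by blast
  have ce: "continuous_on A e" for A
    unfolding continuous_on_iff using e by metis
  have hom': "homotopic_paths (e ` S) (e \<circ> g1) (e \<circ> g2)"
    by (rule homotopic_paths_continuous_image[OF hom ce]) auto
  note paths = homotopic_paths_imp_path[OF hom'] homotopic_paths_imp_subset[OF hom']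
  show ?thesis
    by (rule covering_space_monodromy[OF covering_space_isometric_image[OF cov e],
          of "e \<circ> g1" "e \<circ> g2" h1 h2, OF _ _ _ _ hom'])
       (use paths h1 h2 start in \<open>simp_all only: o_apply\<close>)
qed

section \<open>Deck transformations and the orientation character\<close>

locale geometric_covering =
  fixes G :: geometry and M :: "'m::metric_space set" and p :: "complex \<Rightarrow> 'm"
  assumes universal: "universal_covering G M p"
begin

lemma cov: "covering_space (plane G) p M"
  using universal by (simp add: universal_covering_def)

lemma continuous_p: "continuous_on (plane G) p"
  using covering_space_imp_continuous[OF cov] .

lemma p_in_M: "z \<in> plane G \<Longrightarrow> p z \<in> M"
  using covering_space_imp_surjective[OF cov] by blast

lemma lift_eqI:
  fixes f g :: "'a::topological_space \<Rightarrow> complex"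
  assumes "connected A" "continuous_on A f" "continuous_on A g" "f ` A \<subseteq> plane G" "g ` A \<subseteq> plane G"
    and "\<And>x. x \<in> A \<Longrightarrow> p (f x) = p (g x)" "a \<in> A" "f a = g a" "x \<in> A"
  shows "f x = g x"
proof (rule covering_space_lift_unique[OF cov, where ?g1.0=f and ?g2.0=g and a=a and T=A and f="\<lambda>x. p (f x)"])
  show "continuous_on A (\<lambda>x. p (f x))"
    using continuous_on_compose2[OF continuous_p assms(2,4)] .
qed (use assms p_in_M in auto)

lemma deck_continuous:
  assumes "deck_transformation G p T"
  shows "continuous_on (plane G) T" "z \<in> plane G \<Longrightarrow> T z \<in> plane G" "z \<in> plane G \<Longrightarrow> p (T z) = p z"
  using assms unfolding deck_transformation_def homeomorphism_def by blast+

lemma deck_inj: "deck_transformation G p T \<Longrightarrow> inj_on T (plane G)"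
  unfolding deck_transformation_def homeomorphism_def by (metis inj_on_inverseI)

lemma plane_topology: "simply_connected (plane G)" "locally path_connected (plane G)"
  by (auto intro: convex_imp_simply_connected convex_imp_locally_path_connected)

text \<open>Lift \<open>p\<close> through itself, once from \<open>z\<close> to \<open>w\<close> and
  once from \<open>w\<close> to \<open>z\<close>. Uniqueness of lifts makes the two lifts inverse to
  each other.\<close>

lemma deck_exists:
  assumes "z \<in> plane G" "w \<in> plane G" "p z = p w"
  obtains T where "deck_transformation G p T" "T z = w"
proof -
  have im: "p ` plane G \<subseteq> M" using p_in_M by blast
  obtain T where T: "continuous_on (plane G) T" "T ` plane G \<subseteq> plane G" "T z = w" "\<And>y. y \<in> plane G \<Longrightarrow> p (T y) = p y"
    using metric_covering_lift[OF cov plane_topology assms(1) continuous_p im assms(2,3)] by blast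
  obtain S where S: "continuous_on (plane G) S" "S ` plane G \<subseteq> plane G" "S w = z" "\<And>y. y \<in> plane G \<Longrightarrow> p (S y) = p y"
    using metric_covering_lift[OF cov plane_topology assms(2) continuous_p im assms(1) assms(3)[symmetric]] by blast
  have ST: "S (T y) = y" if "y \<in> plane G" for y
  proof (rule lift_eqI[OF connected_plane _ _ _ _ _ assms(1) _ that, of "\<lambda>y. S (T y)" "\<lambda>y. y"])
    show "continuous_on (plane G) (\<lambda>y. S (T y))" using continuous_on_compose2[OF S(1) T(1,2)] .
  qed (use S T in \<open>auto simp: image_subset_iff\<close>)
  have TS: "T (S y) = y" if "y \<in> plane G" for y
  proof (rule lift_eqI[OF connected_plane _ _ _ _ _ assms(2) _ that, of "\<lambda>y. T (S y)" "\<lambda>y. y"])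
    show "continuous_on (plane G) (\<lambda>y. T (S y))" using continuous_on_compose2[OF T(1) S(1,2)] .
  qed (use S T in \<open>auto simp: image_subset_iff\<close>)
  have "homeomorphism (plane G) (plane G) T S"
    by (rule homeomorphismI) (use S T ST TS in auto)
  then show ?thesis using that T unfolding deck_transformation_def by blast
qed

text \<open>Both maps are lifts of \<open>p\<close> through \<open>p\<close>. In particular a deck
  transformation with a fixed point is the identity.\<close>

lemma deck_eqI:
  assumes T: "deck_transformation G p T" "deck_transformation G p T'" and a: "a \<in> plane G" "T a = T' a" and z: "z \<in> plane G"
  shows "T z = T' z"
  by (rule lift_eqI[OF connected_plane deck_continuous(1)[OF T(1)] deck_continuous(1)[OF T(2)] _ _ _ a z])
     (use deck_continuous(2,3)[OF T(1)] deck_continuous(2,3)[OF T(2)] in auto)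

lemma deck_id: "deck_transformation G p (\<lambda>z. z)"
  unfolding deck_transformation_def using homeomorphism_ident by auto

lemma deck_compose:
  assumes "deck_transformation G p S" "deck_transformation G p T"
  shows "deck_transformation G p (\<lambda>z. S (T z))"
proof -
  obtain S' T' where "homeomorphism (plane G) (plane G) S S'" "homeomorphism (plane G) (plane G) T T'"
    using assms unfolding deck_transformation_def by blast
  then have "homeomorphism (plane G) (plane G) (S \<circ> T) (T' \<circ> S')"
    using homeomorphism_compose by blast
  then show ?thesis using assms deck_continuous unfolding deck_transformation_def o_def by auto
qed

lemma local_isometry:
  assumes "z \<in> plane G"
  obtains U where "open U" "z \<in> U" "U \<subseteq> plane G" "\<And>x y. x \<in> U \<Longrightarrow> y \<in> U \<Longrightarrow> dist (p x) (p y) = plane_dist G x y"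
  using universal assms unfolding universal_covering_def by metis

text \<open>\<open>p\<close> is isometric near \<open>z\<close> and near \<open>T z\<close>, and
  \<open>T\<close> does not change the image under \<open>p\<close>; so \<open>T\<close> preserves
  distances near \<open>z\<close>.\<close>

lemma deck_rigid:
  assumes T: "deck_transformation G p T"
  shows "rigid G T"
proof (rule locally_isometric_rigid)
  fix z assume z: "z \<in> plane G"
  obtain U1 where U1: "open U1" "z \<in> U1" "U1 \<subseteq> plane G" "\<And>x y. x \<in> U1 \<Longrightarrow> y \<in> U1 \<Longrightarrow> dist (p x) (p y) = plane_dist G x y"
    using local_isometry[OF z] by blast
  obtain U2 where U2: "open U2" "T z \<in> U2" "U2 \<subseteq> plane G" "\<And>x y. x \<in> U2 \<Longrightarrow> y \<in> U2 \<Longrightarrow> dist (p x) (p y) = plane_dist G x y"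
    using local_isometry[OF deck_continuous(2)[OF T z]] by blast
  let ?U = "U1 \<inter> (plane G \<inter> T -` U2)"
  have o: "open ?U"
    using continuous_open_preimage[OF deck_continuous(1)[OF T] open_plane U2(1)] U1(1) by blast
  have iso: "plane_dist G (T x) (T y) = plane_dist G x y" if "x \<in> ?U" "y \<in> ?U" for x y
  proof -
    have "plane_dist G (T x) (T y) = dist (p (T x)) (p (T y))" using U2(4) that by simp
    also have "\<dots> = dist (p x) (p y)" using deck_continuous(3)[OF T] that by simp
    also have "\<dots> = plane_dist G x y" using U1(4) that by simp
    finally show ?thesis .
  qed
  show "\<exists>U. open U \<and> z \<in> U \<and> U \<subseteq> plane G \<and> T ` U \<subseteq> plane G \<and>
     (\<forall>x\<in>U. \<forall>y\<in>U. plane_dist G (T x) (T y) = plane_dist G x y)"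
    by (intro exI[of _ ?U] conjI o) (use iso z U1 U2 in auto)
qed

lemma motion_compose_iff:
  assumes "rigid H f" "rigid H g"
  shows "motion H (\<lambda>z. f (g z)) \<longleftrightarrow> (motion H f \<longleftrightarrow> motion H g)"
  using motion_iff_compose[OF _ assms] anti_motion_compose[OF _ assms] not_motion_anti_motion by blast

text \<open>Unique lifting spreads the conjugation relation from \<open>a\<close> to the whole
  plane, and the sign is multiplicative with values in a commutative group.\<close>

lemma deck_sign_conjugate:
  assumes D: "deck_transformation G p D" and T: "deck_transformation G p T" "deck_transformation G p T'"
    and eq: "a \<in> plane G" "D (T a) = T' (D a)"
  shows "deck_sign G T = deck_sign G T'"
proof -
  have "D (T z) = T' (D z)" if "z \<in> plane G" for z
    using deck_eqI[OF deck_compose[OF D T(1)] deck_compose[OF T(2) D] eq that] .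
  then have "motion G (\<lambda>z. D (T z)) \<longleftrightarrow> motion G (\<lambda>z. T' (D z))" by (rule motion_cong)
  then have "motion G T \<longleftrightarrow> motion G T'"
    using motion_compose_iff deck_rigid D T by metis
  then show ?thesis using deck_sign_rigid deck_rigid T by simp
qed

text \<open>Shows that the \<open>THE\<close> is well defined: a second lift of the loop is a deck
  image of the first, which conjugates the deck transformation and keeps its sign.\<close>

lemma orientation_character_eq:
  assumes \<beta>: "path \<beta>" "path_image \<beta> \<subseteq> plane G" "\<And>t. t \<in> {0..1} \<Longrightarrow> p (\<beta> t) = \<alpha> t"
    and T: "deck_transformation G p T" "T (pathstart \<beta>) = pathfinish \<beta>"
  shows "orientation_character G p \<alpha> = deck_sign G T"
  unfolding orientation_character_def
proof (rule the_equality)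
  show "\<exists>\<beta> T'. path \<beta> \<and> path_image \<beta> \<subseteq> plane G \<and> (\<forall>t\<in>{0..1}. p (\<beta> t) = \<alpha> t) \<and>
     deck_transformation G p T' \<and> T' (pathstart \<beta>) = pathfinish \<beta> \<and> deck_sign G T = deck_sign G T'"
    using assms by blast
  fix e
  assume "\<exists>\<beta> T. path \<beta> \<and> path_image \<beta> \<subseteq> plane G \<and> (\<forall>t\<in>{0..1}. p (\<beta> t) = \<alpha> t) \<and>
     deck_transformation G p T \<and> T (pathstart \<beta>) = pathfinish \<beta> \<and> e = deck_sign G T"
  then obtain \<beta>' T' where \<beta>': "path \<beta>'" "path_image \<beta>' \<subseteq> plane G" "\<And>t. t \<in> {0..1} \<Longrightarrow> p (\<beta>' t) = \<alpha> t"
    and T': "deck_transformation G p T'" "T' (pathstart \<beta>') = pathfinish \<beta>'" "e = deck_sign G T'" by blast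
  have pl: "\<beta> t \<in> plane G" "\<beta>' t \<in> plane G" if "t \<in> {0..1}" for t
    using \<beta>(2) \<beta>'(2) that by (auto simp: path_image_def)
  have "p (\<beta> 0) = p (\<beta>' 0)" using \<beta>(3) \<beta>'(3) by simp
  then obtain D where D: "deck_transformation G p D" "D (\<beta> 0) = \<beta>' 0" using deck_exists pl by (metis atLeastAtMost_iff le_numeral_extra(3) zero_le_one)
  have "D (\<beta> t) = \<beta>' t" if t: "t \<in> {0..1}" for t
  proof (rule lift_eqI[where A="{0..1::real}" and a=0])
    show "continuous_on {0..1} (\<lambda>t. D (\<beta> t))"
      using continuous_on_compose2[OF deck_continuous(1)[OF D(1)], of "{0..1}" \<beta>] \<beta>(1) pl(1) by (auto simp: path_def image_subset_iff)
    show "continuous_on {0..1} \<beta>'" using \<beta>'(1) by (simp add: path_def)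
  qed (use D deck_continuous(2,3)[OF D(1)] pl \<beta>(3) \<beta>'(3) t in auto)
  then have "D (T (\<beta> 0)) = T' (D (\<beta> 0))"
    using T(2) T'(2) by (simp add: pathstart_def pathfinish_def)
  then have "deck_sign G T = deck_sign G T'"
    using deck_sign_conjugate[OF D(1) T(1) T'(1)] pl(1)[of 0] by simp
  then show "e = deck_sign G T" using T'(3) by simp
qed

lemma plane_dist_zero:
  assumes "plane_dist G x y = 0" "x \<in> plane G" "y \<in> plane G"
  shows "x = y"
proof (cases G)
  case Hyperbolic
  then have pos: "Im x > 0" "Im y > 0" using assms by auto
  have "plane_dist Hyperbolic x y = plane_dist Hyperbolic x x" using assms Hyperbolic by simp
  from hyperbolic_dist_eq[OF this pos pos(1) pos(1)] show ?thesis using pos by simp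
qed (use assms in simp)

text \<open>Local inverses of \<open>p\<close> are isometric charts of \<open>M\<close>. Regularity
  and genericity are stated for all isometric charts, so they can be read off directly on a
  cover.\<close>

lemma covering_chart:
  assumes "z \<in> plane G"
  obtains U where "open U" "z \<in> U" "U \<subseteq> plane G" "inj_on p U" "isometric_chart G M (p ` U) (inv_into U p)"
proof -
  obtain U where U: "open U" "z \<in> U" "U \<subseteq> plane G" "\<And>x y. x \<in> U \<Longrightarrow> y \<in> U \<Longrightarrow> dist (p x) (p y) = plane_dist G x y"
    using local_isometry[OF assms] by blast
  have inj: "inj_on p U"
  proof (rule inj_onI)
    fix x y assume xy: "x \<in> U" "y \<in> U" "p x = p y"
    then have "plane_dist G x y = 0" using U(4)[OF xy(1,2)] by simp
    then show "x = y" using plane_dist_zero xy U(3) by blast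
  qed
  have "openin (top_of_set (plane G)) U" using U(1,3) by (simp add: openin_open_eq)
  then have "openin (top_of_set M) (p ` U)" using covering_space_open_map[OF cov] by blast
  moreover have "inv_into U p ` p ` U = U" using inj by simp
  ultimately have "isometric_chart G M (p ` U) (inv_into U p)"
    using U inj unfolding isometric_chart_def by auto
  then show ?thesis using that U inj by blast
qed

end

section \<open>Covers of a closed curve\<close>

lemma circle_param_eq_iff: "circle_param s = circle_param t \<longleftrightarrow> (\<exists>n::int. t = s + of_int n)"
proof
  assume "circle_param s = circle_param t"
  then have "exp (\<i> * of_real (2 * pi * t)) = exp (\<i> * of_real (2 * pi * s))"
    by (simp add: circle_param_def cis_conv_exp)
  then obtain n :: int where n: "\<i> * of_real (2 * pi * t) = \<i> * of_real (2 * pi * s) + (of_int (2 * n) * pi) * \<i>"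
    unfolding exp_eq by blast
  have "Im (\<i> * of_real (2 * pi * t)) = Im (\<i> * of_real (2 * pi * s) + (of_int (2 * n) * pi) * \<i>)"
    unfolding n ..
  then have "pi * (2 * t) = pi * (2 * (s + of_int n))" by (simp add: algebra_simps)
  then have "2 * t = 2 * (s + of_int n)" using mult_left_cancel[OF pi_neq_zero] by blast
  then show "\<exists>n::int. t = s + of_int n" by (intro exI[of _ n]) simp
next
  assume "\<exists>n::int. t = s + of_int n"
  then obtain n :: int where n: "t = s + of_int n" by blast
  have "cis (2 * pi * of_int n) = 1" by (simp add: cis_conv_exp exp_eq_1)
  then show "circle_param s = circle_param t"
    unfolding n circle_param_def distrib_left by (simp flip: cis_mult)
qed

lemma circle_param_sphere [simp]: "circle_param t \<in> sphere 0 1"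
  by (simp add: circle_param_def)

lemma circle_param_neq: "s < t \<Longrightarrow> t < s + 1 \<Longrightarrow> circle_param s \<noteq> circle_param t"
  unfolding circle_param_eq_iff by auto

lemma circle_param_shift [simp]: "circle_param (t + of_int n) = circle_param t"
  using circle_param_eq_iff by metis

lemma circle_param_shift_1 [simp]: "circle_param (t + 1) = circle_param t"
  using circle_param_shift[of t 1] by simp

lemma continuous_circle_param: "continuous_on A circle_param"
  unfolding circle_param_def by (intro continuous_intros)

locale closed_curve = geometric_covering G M p
  for G and M :: "'m::metric_space set" and p +
  fixes \<gamma> :: "complex \<Rightarrow> 'm"
  assumes regular: "regular_closed_curve G M \<gamma>" and generic: "generic_curve G M \<gamma>"
begin

lemma curve_in_M: "\<gamma> (circle_param t) \<in> M"
  using regular circle_param_sphere unfolding regular_closed_curve_def by blast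

lemma continuous_curve: "continuous_on A (\<lambda>t. \<gamma> (circle_param t))"
  by (rule continuous_on_compose2[OF _ continuous_circle_param, of "sphere 0 1" \<gamma>])
     (use regular in \<open>auto simp: regular_closed_curve_def circle_param_def\<close>)

lemma cover_exists:
  obtains c where "is_cover G p \<gamma> c"
proof -
  obtain a where a: "a \<in> plane G" "\<gamma> (circle_param 0) = p a"
    using curve_in_M covering_space_imp_surjective[OF cov] by blast
  obtain c where "continuous_on (UNIV :: real set) c" "c ` UNIV \<subseteq> plane G" "c 0 = a" "\<And>t. t \<in> UNIV \<Longrightarrow> p (c t) = \<gamma> (circle_param t)"
    by (rule metric_covering_lift[OF cov _ _ _ continuous_curve[of UNIV] _ a(1), of 0])
       (use a curve_in_M in \<open>auto intro: convex_imp_simply_connected convex_imp_locally_path_connected\<close>)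
  then show ?thesis using that unfolding is_cover_def by blast
qed

lemma cover_continuous: "is_cover G p \<gamma> c \<Longrightarrow> continuous_on A c"
  unfolding is_cover_def using continuous_on_subset by blast

lemma cover_in_plane: "is_cover G p \<gamma> c \<Longrightarrow> c t \<in> plane G"
  unfolding is_cover_def by blast

lemma p_cover: "is_cover G p \<gamma> c \<Longrightarrow> p (c t) = \<gamma> (circle_param t)"
  unfolding is_cover_def by blast

lemma cover_transfer:
  assumes c: "is_cover G p \<gamma> c" and T: "deck_transformation G p T"
  shows "is_cover G p \<gamma> (\<lambda>t. T (c t))"
  unfolding is_cover_def
  using continuous_on_compose2[OF deck_continuous(1)[OF T] cover_continuous[OF c, of UNIV]]
    cover_in_plane[OF c] deck_continuous[OF T] p_cover[OF c] by auto

lemma covers_related: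
  assumes "is_cover G p \<gamma> c" "is_cover G p \<gamma> c'"
  obtains D where "deck_transformation G p D" "\<And>t. c' t = D (c t)"
proof -
  obtain D where D: "deck_transformation G p D" "D (c 0) = c' 0"
    using deck_exists[of "c 0" "c' 0"] assms cover_in_plane p_cover by metis
  have c'': "is_cover G p \<gamma> (\<lambda>t. D (c t))" using cover_transfer assms D by blast
  have "D (c t) = c' t" for t
    by (rule lift_eqI[where A=UNIV and a=0, OF _ cover_continuous[OF c''] cover_continuous[OF assms(2)]])
       (use D(2) cover_in_plane[OF c''] cover_in_plane[OF assms(2)] p_cover[OF c''] p_cover[OF assms(2)] in auto)
  then show ?thesis using that D by metis
qed

lemma cover_shift:
  assumes c: "is_cover G p \<gamma> c"
  shows "is_cover G p \<gamma> (\<lambda>t. c (t + 1))"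
proof -
  have "continuous_on UNIV (\<lambda>t::real. t + 1)" by (intro continuous_intros)
  from continuous_on_compose2[OF cover_continuous[OF c, of UNIV] this] show ?thesis
    unfolding is_cover_def using cover_in_plane[OF c] p_cover[OF c] by auto
qed

text \<open>In the chart given by the local inverse of \<open>p\<close>, the coordinate expression
  of the curve is locally the cover itself.\<close>

lemma cover_chart:
  assumes c: "is_cover G p \<gamma> c"
  obtains U where "open U" "c t \<in> U" "isometric_chart G M (p ` U) (inv_into U p)"
    "\<And>s d. c s \<in> U \<Longrightarrow> ((inv_into U p \<circ> \<gamma> \<circ> circle_param) has_vector_derivative d) (at s) \<longleftrightarrow> (c has_vector_derivative d) (at s)"
proof -
  obtain U where U: "open U" "c t \<in> U" "U \<subseteq> plane G" "inj_on p U" "isometric_chart G M (p ` U) (inv_into U p)"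
    using covering_chart[OF cover_in_plane[OF c]] by blast
  let ?h = "inv_into U p \<circ> \<gamma> \<circ> circle_param"
  have o: "open (c -` U)" using open_vimage[OF U(1) cover_continuous[OF c]] .
  have eq: "?h s = c s" if "s \<in> c -` U" for s
    using that inv_into_f_f[OF U(4), of "c s"] p_cover[OF c, of s] by simp
  have "(?h has_vector_derivative d) (at s) \<longleftrightarrow> (c has_vector_derivative d) (at s)" if "c s \<in> U" for s d
    using has_vector_derivative_transform_within_open[OF _ o, of ?h d s c]
      has_vector_derivative_transform_within_open[OF _ o, of c d s ?h] eq that by auto
  then show ?thesis using that U by blast
qed

lemma cover_C1:
  assumes c: "is_cover G p \<gamma> c"
  shows "(c has_vector_derivative vector_derivative c (at t)) (at t)"
    "vector_derivative c (at t) \<noteq> 0"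
    "continuous_on UNIV (\<lambda>t. vector_derivative c (at t))"
proof -
  have loc: "(c has_vector_derivative vector_derivative c (at t)) (at t) \<and> vector_derivative c (at t) \<noteq> 0 \<and>
      isCont (\<lambda>t. vector_derivative c (at t)) t" for t
  proof -
    obtain U where U: "open U" "c t \<in> U" "isometric_chart G M (p ` U) (inv_into U p)"
      "\<And>s d. c s \<in> U \<Longrightarrow> ((inv_into U p \<circ> \<gamma> \<circ> circle_param) has_vector_derivative d) (at s) \<longleftrightarrow> (c has_vector_derivative d) (at s)"
      using cover_chart[OF c] by blast
    let ?h = "inv_into U p \<circ> \<gamma> \<circ> circle_param" and ?S = "{t. \<gamma> (circle_param t) \<in> p ` U}"
    have sub: "c -` U \<subseteq> ?S" using p_cover[OF c] by (auto simp: image_iff) metis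
    have h: "?h C1_differentiable_on ?S" "\<And>t. t \<in> ?S \<Longrightarrow> vector_derivative ?h (at t) \<noteq> 0"
      using regular U(3) unfolding regular_closed_curve_def by blast+
    have hd: "(?h has_vector_derivative vector_derivative ?h (at s)) (at s)" if "c s \<in> U" for s
      using h(1) sub that unfolding C1_differentiable_on_eq vector_derivative_works[symmetric] by blast
    then have cd: "(c has_vector_derivative vector_derivative ?h (at s)) (at s)" if "c s \<in> U" for s
      using U(4) that by blast
    have vd: "vector_derivative c (at s) = vector_derivative ?h (at s)" if "c s \<in> U" for s
      using vector_derivative_at[OF cd[OF that]] .
    have o: "open (c -` U)" using open_vimage[OF U(1) cover_continuous[OF c]] .
    have "continuous_on (c -` U) (\<lambda>x. vector_derivative ?h (at x))"
      using h(1) sub continuous_on_subset unfolding C1_differentiable_on_eq by blast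
    then have "continuous_on (c -` U) (\<lambda>x. vector_derivative c (at x))"
      using vd by (simp cong: continuous_on_cong_simp)
    then have "isCont (\<lambda>t. vector_derivative c (at t)) t"
      using o U(2) continuous_on_eq_continuous_at by (metis vimageI)
    then show ?thesis using cd[OF U(2)] vd[OF U(2)] h(2) sub U(2) by auto
  qed
  then show "(c has_vector_derivative vector_derivative c (at t)) (at t)" "vector_derivative c (at t) \<noteq> 0"
    "continuous_on UNIV (\<lambda>t. vector_derivative c (at t))"
    by (auto simp: continuous_on_eq_continuous_at)
qed

lemma cover_transversal:
  assumes c: "is_cover G p \<gamma> c" and eq: "c s = c t" "circle_param s \<noteq> circle_param t"
  shows "planar_det (vector_derivative c (at s)) (vector_derivative c (at t)) \<noteq> 0"
proof -
  obtain U where U: "open U" "c s \<in> U" "isometric_chart G M (p ` U) (inv_into U p)"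
    "\<And>s d. c s \<in> U \<Longrightarrow> ((inv_into U p \<circ> \<gamma> \<circ> circle_param) has_vector_derivative d) (at s) \<longleftrightarrow> (c has_vector_derivative d) (at s)"
    using cover_chart[OF c] by blast
  let ?h = "inv_into U p \<circ> \<gamma> \<circ> circle_param"
  have "vector_derivative ?h (at r) = vector_derivative c (at r)" if "c r \<in> U" for r
    using vector_derivative_at U(4)[OF that] cover_C1(1)[OF c] by blast
  moreover have "\<gamma> (circle_param s) = \<gamma> (circle_param t)" "\<gamma> (circle_param s) \<in> p ` U"
    using p_cover[OF c] eq(1) U(2) by (metis, metis imageI)
  then have "planar_det (vector_derivative ?h (at s)) (vector_derivative ?h (at t)) \<noteq> 0"
    using generic U(3) eq(2) unfolding generic_curve_def by blast
  ultimately show ?thesis using U(2) eq(1) by simp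
qed

lemma triple_point:
  assumes "\<gamma> (circle_param a) = \<gamma> (circle_param b)" "circle_param a \<noteq> circle_param b"
    "\<gamma> (circle_param x) = \<gamma> (circle_param a)"
  shows "circle_param x = circle_param a \<or> circle_param x = circle_param b"
proof -
  have "\<And>a b c. a \<in> sphere 0 1 \<Longrightarrow> b \<in> sphere 0 1 \<Longrightarrow> c \<in> sphere 0 1 \<Longrightarrow> \<gamma> a = \<gamma> b \<Longrightarrow> \<gamma> b = \<gamma> c \<Longrightarrow> a = b \<or> b = c \<or> a = c"
    using generic unfolding generic_curve_def by blast
  from this[OF circle_param_sphere[of x] circle_param_sphere[of a] circle_param_sphere[of b]] show ?thesis using assms by auto
qed

text \<open>Contract the closed lift in the simply connected plane and project.
  \<open>Arg2pi\<close> turns the homotopy of loops on [0,1] into one of maps on the circle, the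
  form that \<open>null_homotopic_curve\<close> asks for.\<close>

lemma null_homotopic_of_closed_cover:
  assumes c: "is_cover G p \<gamma> c" and closed: "c 1 = c 0"
  shows "null_homotopic_curve M \<gamma>"
proof -
  have pc: "path c" "path_image c \<subseteq> plane G"
    using cover_continuous[OF c] cover_in_plane[OF c] by (auto simp: path_def path_image_def)
  have "homotopic_loops (plane G) c (linepath (c 0) (c 0))"
    using plane_topology(1) pc closed cover_in_plane[OF c]
    unfolding simply_connected_def by (auto simp: pathfinish_def pathstart_def)
  then have "homotopic_loops M (p \<circ> c) (p \<circ> linepath (c 0) (c 0))"
    by (rule homotopic_loops_continuous_image[OF _ continuous_p]) (use p_in_M in auto)
  then have hom: "homotopic_with_canon (\<lambda>h. True) (sphere 0 1) M ((p \<circ> c) \<circ> (\<lambda>z. Arg2pi z / (2 * pi)))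
      ((p \<circ> linepath (c 0) (c 0)) \<circ> (\<lambda>z. Arg2pi z / (2 * pi)))"
    by (rule homotopic_loops_imp_homotopic_circlemaps)
  have "homotopic_with_canon (\<lambda>h. True) (sphere 0 1) M \<gamma> (\<lambda>_. p (c 0))"
  proof (rule homotopic_with_eq[OF hom])
    fix z :: complex assume "z \<in> topspace (top_of_set (sphere 0 1))"
    then have "cmod z = 1" by simp
    then have "circle_param (Arg2pi z / (2 * pi)) = z"
      using Arg2pi_eq[of z] by (simp add: circle_param_def cis_conv_exp)
    then show "\<gamma> z = ((p \<circ> c) \<circ> (\<lambda>z. Arg2pi z / (2 * pi))) z"
      using p_cover[OF c, of "Arg2pi z / (2 * pi)"] by simp
  qed (auto simp: linepath_refl)
  then show ?thesis unfolding null_homotopic_curve_def by blast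
qed

end

lemma planar_det_mult: "planar_det (a * u) (a * v) = (cmod a)\<^sup>2 * planar_det u v"
  unfolding cmod_power2 by (simp add: planar_det_def algebra_simps power2_eq_square)

lemma planar_det_mult_cnj: "planar_det (a * cnj u) (a * cnj v) = - (cmod a)\<^sup>2 * planar_det u v"
  unfolding cmod_power2 by (simp add: planar_det_def algebra_simps power2_eq_square)

lemma of_int_crossing_sign:
  "real_of_int (crossing_sign c s t) = - sgn (planar_det (vector_derivative c (at s)) (vector_derivative c (at t)))"
  by (simp add: crossing_sign_def Let_def sgn_if)

section \<open>Crossings of one cover in the straightened coordinate\<close>

locale lifted_curve = closed_curve G M p \<gamma>
  for G and M :: "'m::metric_space set" and p \<gamma> +
  fixes c :: "real \<Rightarrow> complex" and T L :: "complex \<Rightarrow> complex" and b :: complex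
  assumes cover: "is_cover G p \<gamma> c" and T: "deck_transformation G p T" "\<And>t. T (c t) = c (t + 1)"
    and L: "L holomorphic_on plane G" "inj_on L (plane G)" "b \<noteq> 0" "\<And>z. z \<in> plane G \<Longrightarrow> L (T z) = L z + b"
begin

lemma deriv_L_nonzero: "z \<in> plane G \<Longrightarrow> deriv L z \<noteq> 0"
  using holomorphic_injective_imp_regular[OF L(1) open_plane L(2)] .

definition g :: "real \<Rightarrow> complex" where "g t = L (c t)"

definition g' :: "real \<Rightarrow> complex" where "g' t = deriv L (c t) * vector_derivative c (at t)"

lemma g_has_vector_derivative: "(g has_vector_derivative g' t) (at t)"
proof -
  have "(L has_field_derivative deriv L (c t)) (at (c t))"
    using holomorphic_derivI[OF L(1) open_plane cover_in_plane[OF cover]] .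
  from field_vector_diff_chain_at[OF cover_C1(1)[OF cover] this]
  show ?thesis by (simp add: g_def[abs_def] g'_def o_def mult.commute)
qed

lemma continuous_g': "continuous_on UNIV g'"
proof -
  have "continuous_on (plane G) (deriv L)"
    using holomorphic_deriv[OF L(1) open_plane] holomorphic_on_imp_continuous_on by blast
  then have "continuous_on UNIV (\<lambda>t. deriv L (c t))"
    by (rule continuous_on_compose2[OF _ cover_continuous[OF cover]]) (use cover_in_plane[OF cover] in auto)
  then show ?thesis unfolding g'_def[abs_def] using cover_C1(3)[OF cover] by (rule continuous_on_mult)
qed

lemma g'_nonzero: "g' t \<noteq> 0"
  using deriv_L_nonzero cover_in_plane[OF cover] cover_C1(2)[OF cover] by (simp add: g'_def)

lemma g_shift_1: "g (t + 1) = g t + b"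
  using L(4) T(2) cover_in_plane[OF cover] by (simp add: g_def flip: T(2))

lemma g_shift: "g (t + of_int n) = g t + of_int n * b"
proof -
  \<comment> \<open>Subtracting the drift \<open>t * b\<close> leaves a function of period
    1.\<close>
  interpret h: periodic_fun_simple' "\<lambda>t. g t - of_real t * b"
    by standard (simp add: g_shift_1 algebra_simps)
  show ?thesis using h.plus_of_int[of t n] by (simp add: algebra_simps)
qed

lemma g'_shift: "g' (t + of_int n) = g' t"
proof -
  have "((\<lambda>t::real. t + of_int n) has_vector_derivative 1) (at t)" by (auto intro!: derivative_eq_intros)
  from vector_diff_chain_at[OF this g_has_vector_derivative]
  have "((\<lambda>t. g t + of_int n * b) has_vector_derivative g' (t + of_int n)) (at t)" by (simp add: o_def g_shift)
  moreover have "((\<lambda>t. g t + of_int n * b) has_vector_derivative g' t) (at t)"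
    using has_vector_derivative_add[OF g_has_vector_derivative has_vector_derivative_const] by simp
  ultimately show ?thesis using vector_derivative_unique_at by blast
qed

lemma g_eq_iff: "g s = g t \<longleftrightarrow> c s = c t"
  using L(2) cover_in_plane[OF cover] unfolding g_def inj_on_def by metis

lemma cover_shift_eq_iff: "c (s + of_int n) = c (t + of_int n) \<longleftrightarrow> c s = c t"
  unfolding g_eq_iff[symmetric] by (simp add: g_shift)

text \<open>Each period adds \<open>b \<noteq> 0\<close> to \<open>g\<close>, so two branches that
  meet can meet again only after equal shifts.\<close>

lemma cover_shift_eqD:
  assumes "c s = c t" "c (s + of_int k) = c (t + of_int l)"
  shows "k = l"
proof -
  have "of_int k * b = of_int l * b"
    using assms unfolding g_eq_iff[symmetric] by (simp add: g_shift)
  then show ?thesis using L(3) by simp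
qed

lemma self_crossings_g: "self_crossings g s0 = self_crossings c s0"
  by (simp add: self_crossings_def g_eq_iff)

text \<open>At a common point both velocities are multiplied by the same nonzero complex number,
  which scales the determinant by a positive factor.\<close>

lemma sgn_det_g':
  assumes "c s = c t"
  shows "sgn (planar_det (g' s) (g' t)) = sgn (planar_det (vector_derivative c (at s)) (vector_derivative c (at t)))"
  using deriv_L_nonzero[OF cover_in_plane[OF cover], of t] assms
  by (simp add: g'_def planar_det_mult sgn_mult)

lemma crossing_sign_g':
  "c s = c t \<Longrightarrow> real_of_int (crossing_sign c s t) = - sgn (planar_det (g' s) (g' t))"
  by (simp add: of_int_crossing_sign sgn_det_g')

lemma crossing_sign_shift:
  assumes "c s = c t"
  shows "crossing_sign c (s + of_int k) (t + of_int k) = crossing_sign c s t"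
proof -
  have "real_of_int (crossing_sign c (s + of_int k) (t + of_int k)) = real_of_int (crossing_sign c s t)"
    using crossing_sign_g'[of "s + of_int k" "t + of_int k"] crossing_sign_g'[OF assms] assms
    by (simp add: cover_shift_eq_iff g'_shift)
  then show ?thesis by simp
qed

text \<open>Without triple points, \<open>t1\<close> and \<open>t2\<close> project to the two
  parameters of the crossing \<open>(s, t)\<close> on the circle, and \<open>cover_shift_eqD\<close>
  makes their integer shifts equal.\<close>

lemma double_point_shift:
  assumes st: "(s, t) \<in> self_crossings c s0" and e: "double_point_at c e t1 t2" "p e = p (c s)"
  obtains k :: int where "t1 = s + of_int k" "t2 = t + of_int k"
proof -
  have st': "s < t" "t < s + 1" "c s = c t" using st by (auto simp: self_crossings_def)
  have t12: "t1 < t2" "c t1 = c t2" using e by (auto simp: double_point_at_def)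
  have ne: "circle_param s \<noteq> circle_param t" using circle_param_neq st' by blast
  have pc: "\<gamma> (circle_param s) = \<gamma> (circle_param t)" "\<gamma> (circle_param t1) = \<gamma> (circle_param s)" "\<gamma> (circle_param t2) = \<gamma> (circle_param s)"
    using st' e p_cover[OF cover] by (metis double_point_at_def)+
  have ne': "circle_param t1 \<noteq> circle_param t2"
  proof
    assume "circle_param t1 = circle_param t2"
    then obtain n :: int where n: "t2 = t1 + of_int n" using circle_param_eq_iff by blast
    then have "0 = n" using cover_shift_eqD[of t1 t1 0 n] t12 by simp
    then show False using n t12 by simp
  qed
  have "circle_param t1 = circle_param s \<and> circle_param t2 = circle_param t \<or>
        circle_param t1 = circle_param t \<and> circle_param t2 = circle_param s"
    using triple_point[OF pc(1) ne pc(2)] triple_point[OF pc(1) ne pc(3)] ne' by auto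
  then show ?thesis
  proof
    assume "circle_param t1 = circle_param s \<and> circle_param t2 = circle_param t"
    then obtain k l :: int where "t1 = s + of_int k" "t2 = t + of_int l"
      using circle_param_eq_iff by metis
    then show ?thesis using that cover_shift_eqD[OF st'(3)] t12(2) by blast
  \<comment> \<open>The swapped assignment with a common shift would put \<open>t2\<close> before
    \<open>t1\<close>.\<close>
  next
    assume "circle_param t1 = circle_param t \<and> circle_param t2 = circle_param s"
    then obtain k l :: int where kl: "t1 = t + of_int k" "t2 = s + of_int l"
      using circle_param_eq_iff by metis
    then have "k = l" using cover_shift_eqD[OF st'(3)[symmetric]] t12(2) by blast
    then show ?thesis using kl t12(1) st'(1) by simp
  qed
qed

text \<open>Removes the choices in the definition of the index: whichever double point
  \<open>SOME\<close> picks, and whichever parameters it has, they are a common integer shift of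
  \<open>(s, t)\<close>, which does not change the sign.\<close>

lemma double_point_sign_eq:
  assumes st: "(s, t) \<in> self_crossings c s0"
  shows "double_point_sign c (SOME e. p e = p (c s) \<and> (\<exists>t1 t2. double_point_at c e t1 t2)) = crossing_sign c s t"
proof -
  let ?P = "\<lambda>e. p e = p (c s) \<and> (\<exists>t1 t2. double_point_at c e t1 t2)"
  define e where "e = (SOME e. ?P e)"
  have st': "s < t" "t < s + 1" "c s = c t" using st by (auto simp: self_crossings_def)
  have "?P (c s)" using st' by (metis double_point_at_def)
  then have e: "?P e" unfolding e_def by (rule someI[of ?P])
  have sign: "crossing_sign c t1 t2 = crossing_sign c s t" if t12: "double_point_at c e t1 t2" for t1 t2
  proof -
    obtain k :: int where "t1 = s + of_int k" "t2 = t + of_int k"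
      using double_point_shift[OF st t12] e by blast
    then show ?thesis using crossing_sign_shift[OF st'(3)] by simp
  qed
  have "double_point_sign c e = crossing_sign c s t"
    unfolding double_point_sign_def
    by (rule the_equality) (use e sign in \<open>metis, metis\<close>)
  then show ?thesis by (simp add: e_def)
qed

text \<open>The arc of \<open>c\<close> from \<open>s\<close> to \<open>t\<close> lifts the
  sub-loop. If the loop is null-homotopic, monodromy closes this arc; a closed arc contracts in the
  plane, and the contraction projects to \<open>M\<close>.\<close>

lemma sub_loop_null_homotopic_iff:
  assumes "s < t" "\<gamma> (circle_param s) = d" "\<gamma> (circle_param t) = d"
  shows "homotopic_paths M (sub_loop \<gamma> s t) (\<lambda>_. d) \<longleftrightarrow> c s = c t"
proof
  let ?r = "\<lambda>u. c (s + u * (t - s))"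
  have r: "path ?r" "path_image ?r \<subseteq> plane G"
    using cover_in_plane[OF cover] unfolding path_def path_image_def
    by (auto intro!: continuous_on_compose2[OF cover_continuous[OF cover, of UNIV]] continuous_intros)
  have pr: "p (?r u) = sub_loop \<gamma> s t u" for u
    using p_cover[OF cover] by (simp add: sub_loop_def)
  {
    assume h: "homotopic_paths M (sub_loop \<gamma> s t) (\<lambda>_. d)"
    have "pathfinish ?r = pathfinish (\<lambda>_::real. c s)"
      by (rule metric_covering_monodromy[OF cov h r pr])
         (use cover_in_plane[OF cover] p_cover[OF cover] assms in \<open>auto simp: path_def path_image_def pathstart_def\<close>)
    then show "c s = c t" by (simp add: pathfinish_def)
  next
    assume eq: "c s = c t"
    have "homotopic_paths (plane G) ?r (linepath (c s) (c s))"
      using plane_topology(1) r eq unfolding simply_connected_eq_contractible_path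
      by (auto simp: pathstart_def pathfinish_def)
    then have "homotopic_paths M (p \<circ> ?r) (p \<circ> linepath (c s) (c s))"
      by (rule homotopic_paths_continuous_image[OF _ continuous_p]) (use p_in_M in auto)
    moreover have "p \<circ> ?r = sub_loop \<gamma> s t" using pr by auto
    moreover have "p \<circ> linepath (c s) (c s) = (\<lambda>_. d)"
      using p_cover[OF cover] assms by (auto simp: linepath_refl)
    ultimately show "homotopic_paths M (sub_loop \<gamma> s t) (\<lambda>_. d)" by simp
  }
qed

text \<open>Double points of the cover over the same point differ by integer shifts, and the window
  of length 1 for \<open>s\<close> selects exactly one of them.\<close>

lemma bij_self_crossings: "bij_betw (\<lambda>(s, t). p (c s)) (self_crossings c s0) (null_double_points M \<gamma>)"
  unfolding bij_betw_def
proof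
  show "inj_on (\<lambda>(s, t). p (c s)) (self_crossings c s0)"
  proof (rule inj_onI, clarify)
    fix s t s' t'
    assume st: "(s, t) \<in> self_crossings c s0" "(s', t') \<in> self_crossings c s0" and "p (c s) = p (c s')"
    then have "double_point_at c (c s') s' t'" "p (c s') = p (c s)"
      by (auto simp: self_crossings_def double_point_at_def)
    then obtain k :: int where k: "s' = s + of_int k" "t' = t + of_int k"
      using double_point_shift[OF st(1)] by metis
    have "k = 0" using st k(1) by (auto simp: self_crossings_def)
    then show "s = s' \<and> t = t'" using k by simp
  qed
  show "(\<lambda>(s, t). p (c s)) ` self_crossings c s0 = null_double_points M \<gamma>"
  proof (intro set_eqI iffI)
    fix d assume "d \<in> (\<lambda>(s, t). p (c s)) ` self_crossings c s0"
    then obtain s t where st: "(s, t) \<in> self_crossings c s0" "d = p (c s)" by auto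
    then have st': "s < t" "t < s + 1" "c s = c t" by (auto simp: self_crossings_def)
    have "\<gamma> (circle_param s) = d" "\<gamma> (circle_param t) = d"
      using st(2) st'(3) p_cover[OF cover] by metis+
    then show "d \<in> null_double_points M \<gamma>"
      using st' sub_loop_null_homotopic_iff unfolding null_double_points_def by blast
  next
    fix d assume "d \<in> null_double_points M \<gamma>"
    then obtain s t where st: "s < t" "t < s + 1" "\<gamma> (circle_param s) = d" "\<gamma> (circle_param t) = d"
      "homotopic_paths M (sub_loop \<gamma> s t) (\<lambda>_. d)"
      unfolding null_double_points_def by blast
    then have eq: "c s = c t" using sub_loop_null_homotopic_iff by blast
    \<comment> \<open>The integer shift that moves \<open>s\<close> into the half-open window from
      \<open>s0\<close> to \<open>s0 + 1\<close>.\<close>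
    define n where "n = - \<lfloor>s - s0\<rfloor>"
    have "s0 \<le> s + of_int n" "s + of_int n < s0 + 1" unfolding n_def by linarith+
    then have "(s + of_int n, t + of_int n) \<in> self_crossings c s0"
      using st eq cover_shift_eq_iff by (auto simp: self_crossings_def)
    moreover have "p (c (s + of_int n)) = d" using p_cover[OF cover] st(3) by simp
    ultimately show "d \<in> (\<lambda>(s, t). p (c s)) ` self_crossings c s0" by force
  qed
qed

text \<open>The freedom in \<open>s0\<close> matters: \<open>turning_eq_crossings\<close> dictates
  its own \<open>s0\<close>, whereas different covers are compared with one common window.\<close>

lemma cover_index_eq: "cover_index M p \<gamma> c = (\<Sum>(s, t)\<in>self_crossings c s0. crossing_sign c s t)"
proof -
  have "cover_index M p \<gamma> c = (\<Sum>x\<in>self_crossings c s0.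
     double_point_sign c (SOME e. p e = (case x of (s, t) \<Rightarrow> p (c s)) \<and> (\<exists>t1 t2. double_point_at c e t1 t2)))"
    unfolding cover_index_def by (rule sum.reindex_bij_betw[OF bij_self_crossings, symmetric])
  also have "\<dots> = (\<Sum>(s, t)\<in>self_crossings c s0. crossing_sign c s t)"
    by (rule sum.cong) (auto simp: double_point_sign_eq)
  finally show ?thesis .
qed

lemma transversal_g':
  assumes "s < t" "t < s + 1" "g s = g t"
  shows "planar_det (g' s) (g' t) \<noteq> 0"
proof -
  have eq: "c s = c t" using assms g_eq_iff by blast
  have "planar_det (vector_derivative c (at s)) (vector_derivative c (at t)) \<noteq> 0"
    using cover_transversal[OF cover eq circle_param_neq[OF assms(1,2)]] .
  then show ?thesis using sgn_det_g'[OF eq] by (metis sgn_0_0)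
qed

lemma turning_g_eq_index:
  assumes "continuous_on UNIV \<theta>" "\<And>t. sgn (g' t) = cis (\<theta> t) * u"
  shows "(\<theta> 1 - \<theta> 0) / (2 * pi) = of_int (cover_index M p \<gamma> c)"
proof -
  obtain s0 where "(\<theta> 1 - \<theta> 0) / (2 * pi) = (\<Sum>(s,t)\<in>self_crossings g s0. - sgn (planar_det (g' s) (g' t)))"
    using turning_eq_crossings[OF g_has_vector_derivative continuous_g' g'_nonzero g_shift_1 L(3) transversal_g' assms]
    by blast
  also have "\<dots> = (\<Sum>(s,t)\<in>self_crossings c s0. of_int (crossing_sign c s t))"
    unfolding self_crossings_g by (rule sum.cong) (auto simp: self_crossings_def crossing_sign_g')
  also have "\<dots> = of_int (cover_index M p \<gamma> c)"
    unfolding cover_index_eq[of s0] by (simp add: case_prod_beta)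
  finally show ?thesis .
qed

lemma turning_eq_index:
  assumes const: "\<forall>\<phi> X. one_parameter_group G \<phi> X \<and> (\<forall>z\<in>plane G. \<phi> 1 z = T z) \<longrightarrow> (\<exists>\<kappa>. \<forall>z\<in>plane G. deriv L z * X z = \<kappa>)"
    and v: "cover_turning G p c v"
  shows "v = of_int (cover_index M p \<gamma> c)"
proof -
  obtain S \<phi> X \<theta> where S: "deck_transformation G p S" "\<And>t. S (c t) = c (t + 1)"
    and \<phi>: "one_parameter_group G \<phi> X" "\<And>z. z \<in> plane G \<Longrightarrow> \<phi> 1 z = S z"
    and \<theta>: "continuous_on UNIV \<theta>" "\<And>t. sgn (vector_derivative c (at t)) = cis (\<theta> t) * sgn (X (c t))"
    and veq: "v = (\<theta> 1 - \<theta> 0) / (2 * pi)"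
    using v unfolding cover_turning_def by blast
  \<comment> \<open>\<open>cover_turning\<close> brings its own deck transformation
    \<open>S\<close>; it agrees with \<open>T\<close> at \<open>c 0\<close>, hence
    everywhere.\<close>
  have "S z = T z" if "z \<in> plane G" for z
    using deck_eqI[OF S(1) T(1) cover_in_plane[OF cover, of 0] _ that] S(2) T(2) by simp
  then obtain \<kappa> where \<kappa>: "\<And>z. z \<in> plane G \<Longrightarrow> deriv L z * X z = \<kappa>" using const \<phi> by metis
  \<comment> \<open>Multiplying the angle equation by \<open>sgn (deriv L (c t))\<close> turns the
    velocity of \<open>c\<close> into that of \<open>g\<close> and the field into the constant
    \<open>\<kappa>\<close>.\<close>
  have "sgn (g' t) = cis (\<theta> t) * sgn \<kappa>" for t
    using \<theta>(2)[of t] \<kappa>[OF cover_in_plane[OF cover, of t]]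
    by (simp add: g'_def sgn_mult mult.left_commute flip: \<kappa>[OF cover_in_plane[OF cover, of t]])
  then show ?thesis using turning_g_eq_index[OF \<theta>(1)] veq by simp
qed

text \<open>The angle function is the imaginary part of a continuous logarithm of
  \<open>g' / \<kappa>\<close>; the group with nowhere vanishing field ensures
  \<open>\<kappa> \<noteq> 0\<close>.\<close>

lemma turning_exists:
  assumes const: "\<forall>\<phi> X. one_parameter_group G \<phi> X \<and> (\<forall>z\<in>plane G. \<phi> 1 z = T z) \<longrightarrow> (\<exists>\<kappa>. \<forall>z\<in>plane G. deriv L z * X z = \<kappa>)"
    and exist: "\<exists>\<phi> X. one_parameter_group G \<phi> X \<and> (\<forall>z\<in>plane G. \<phi> 1 z = T z) \<and> (\<forall>z\<in>plane G. X z \<noteq> 0)"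
  shows "\<exists>v. cover_turning G p c v"
proof -
  obtain \<phi> X where \<phi>: "one_parameter_group G \<phi> X" "\<And>z. z \<in> plane G \<Longrightarrow> \<phi> 1 z = T z" "\<And>z. z \<in> plane G \<Longrightarrow> X z \<noteq> 0"
    using exist by blast
  obtain \<kappa> where \<kappa>: "\<And>z. z \<in> plane G \<Longrightarrow> deriv L z * X z = \<kappa>" using const \<phi>(1,2) by metis
  have \<kappa>0: "\<kappa> \<noteq> 0" using \<kappa>[OF i_in_plane] \<phi>(3)[OF i_in_plane] deriv_L_nonzero[OF i_in_plane] by auto
  obtain l where l: "continuous_on (UNIV :: real set) l" "\<And>t. t \<in> UNIV \<Longrightarrow> g' t / \<kappa> = exp (l t)"
    by (rule continuous_logarithm_on_contractible[of "UNIV :: real set" "\<lambda>t. g' t / \<kappa>"])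
       (use continuous_g' g'_nonzero \<kappa>0 in \<open>auto intro!: continuous_intros convex_imp_contractible\<close>)
  have "sgn (vector_derivative c (at t)) = cis (Im (l t)) * sgn (X (c t))" for t
  proof -
    have z: "c t \<in> plane G" by (rule cover_in_plane[OF cover])
    have "vector_derivative c (at t) = g' t / deriv L (c t)" using deriv_L_nonzero[OF z] by (simp add: g'_def)
    also have "\<dots> = exp (l t) * X (c t)"
      using l(2)[of t] \<kappa>[OF z] \<kappa>0 deriv_L_nonzero[OF z] by (simp add: field_simps)
    moreover have "sgn (exp (l t)) = cis (Im (l t))" by (simp add: sgn_eq exp_eq_polar[of "l t"] norm_mult)
    ultimately show ?thesis by (simp add: sgn_mult)
  qed
  moreover have "continuous_on UNIV (\<lambda>t. Im (l t))" using l(1) by (intro continuous_intros)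
  ultimately show ?thesis
    unfolding cover_turning_def using T \<phi>(1,2) by blast
qed

end

section \<open>Independence of the cover\<close>

context closed_curve
begin

text \<open>The shift transformation is a motion because the curve preserves orientation. If it
  fixed a point it would be the identity, the cover would close up, and the curve would be
  null-homotopic.\<close>

lemma lifted_curve_exists:
  assumes w: "orientation_character G p (\<gamma> \<circ> circle_param) = 1" and nonnull: "\<not> null_homotopic_curve M \<gamma>"
    and c: "is_cover G p \<gamma> c"
  obtains T L b where "lifted_curve G M p \<gamma> c T L b"
    "\<forall>\<phi> X. one_parameter_group G \<phi> X \<and> (\<forall>z\<in>plane G. \<phi> 1 z = T z) \<longrightarrow> (\<exists>\<kappa>. \<forall>z\<in>plane G. deriv L z * X z = \<kappa>)"
    "\<exists>\<phi> X. one_parameter_group G \<phi> X \<and> (\<forall>z\<in>plane G. \<phi> 1 z = T z) \<and> (\<forall>z\<in>plane G. X z \<noteq> 0)"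
proof -
  obtain T where T: "deck_transformation G p T" "\<And>t. c (t + 1) = T (c t)"
    using covers_related[OF c cover_shift[OF c]] by blast
  have "orientation_character G p (\<gamma> \<circ> circle_param) = deck_sign G T"
  proof (rule orientation_character_eq[of c])
    show "T (pathstart c) = pathfinish c" using T(2)[of 0] by (simp add: pathstart_def pathfinish_def)
  qed (use cover_continuous[OF c] cover_in_plane[OF c] p_cover[OF c] T(1) in \<open>auto simp: path_def path_image_def\<close>)
  then have mot: "motion G T" using w deck_sign_rigid[OF deck_rigid[OF T(1)]] by (metis one_neq_neg_one)
  have nofix: "T z \<noteq> z" if z: "z \<in> plane G" for z
  proof
    assume "T z = z"
    then have "T (c 0) = c 0" using deck_eqI[OF T(1) deck_id z] cover_in_plane[OF c] by blast
    then have "c 1 = c 0" using T(2)[of 0] by simp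
    then show False using null_homotopic_of_closed_cover[OF c] nonnull by blast
  qed
  obtain L b where L: "L holomorphic_on plane G" "inj_on L (plane G)" "b \<noteq> 0"
    "\<And>z. z \<in> plane G \<Longrightarrow> L (T z) = L z + b"
    "\<And>\<phi> X. one_parameter_group G \<phi> X \<Longrightarrow> (\<And>z. z \<in> plane G \<Longrightarrow> \<phi> 1 z = T z) \<Longrightarrow> \<exists>\<kappa>. \<forall>z\<in>plane G. deriv L z * X z = \<kappa>"
    "\<exists>\<phi> X. one_parameter_group G \<phi> X \<and> (\<forall>z\<in>plane G. \<phi> 1 z = T z) \<and> (\<forall>z\<in>plane G. X z \<noteq> 0)"
    using straightening[OF mot nofix] by blast
  have "lifted_curve G M p \<gamma> c T L b"
    by unfold_locales (use c T L in auto)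
  moreover have "\<forall>\<phi> X. one_parameter_group G \<phi> X \<and> (\<forall>z\<in>plane G. \<phi> 1 z = T z) \<longrightarrow> (\<exists>\<kappa>. \<forall>z\<in>plane G. deriv L z * X z = \<kappa>)"
    using L(5) by blast
  ultimately show ?thesis using that L(6) by blast
qed

text \<open>At a crossing the derivative of \<open>D\<close> multiplies both velocities, or both
  their conjugates, by one nonzero number. Which case occurs depends on \<open>D\<close> only, so
  \<open>\<epsilon>\<close> is the same for all crossings.\<close>

lemma crossing_sign_deck:
  assumes c: "is_cover G p \<gamma> c" and D: "deck_transformation G p D"
  obtains \<epsilon> :: int where "\<bar>\<epsilon>\<bar> = 1" "\<And>s t. c s = c t \<Longrightarrow> crossing_sign (\<lambda>t. D (c t)) s t = \<epsilon> * crossing_sign c s t"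
proof -
  let ?v = "\<lambda>t. vector_derivative c (at t)"
  have cd: "(c has_derivative (\<lambda>h. h *\<^sub>R ?v t)) (at t)" for t
    using cover_C1(1)[OF c] by (simp add: has_vector_derivative_def)
  show ?thesis
  proof (cases "motion G D")
    case True
    have vd: "\<exists>d. d \<noteq> 0 \<and> (\<forall>t. c t = z \<longrightarrow> vector_derivative (\<lambda>t. D (c t)) (at t) = d * ?v t)" if z: "z \<in> plane G" for z
    proof -
      obtain d where d: "(D has_field_derivative d) (at z)" "d \<noteq> 0" using motion_has_field_derivative[OF True z] .
      have "vector_derivative (\<lambda>t. D (c t)) (at t) = d * ?v t" if "c t = z" for t
        using field_vector_diff_chain_at[OF cover_C1(1)[OF c], of D d t] d(1) that
        by (intro vector_derivative_at) (simp add: o_def mult.commute)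
      then show ?thesis using d(2) by blast
    qed
    have "crossing_sign (\<lambda>t. D (c t)) s t = 1 * crossing_sign c s t" if eq: "c s = c t" for s t
    proof -
      obtain d where "d \<noteq> 0" "vector_derivative (\<lambda>t. D (c t)) (at s) = d * ?v s" "vector_derivative (\<lambda>t. D (c t)) (at t) = d * ?v t"
        using vd[OF cover_in_plane[OF c, of s]] eq by metis
      then have "real_of_int (crossing_sign (\<lambda>t. D (c t)) s t) = real_of_int (crossing_sign c s t)"
        by (simp add: of_int_crossing_sign planar_det_mult sgn_mult)
      then show ?thesis by simp
    qed
    then show ?thesis using that[of 1] by simp
  next
    case False
    then have anti: "motion G (\<lambda>z. D (mirror z))" using deck_rigid[OF D] unfolding rigid_def by blast
    have vd: "\<exists>d. d \<noteq> 0 \<and> (\<forall>t. c t = z \<longrightarrow> vector_derivative (\<lambda>t. D (c t)) (at t) = d * cnj (?v t))" if z: "z \<in> plane G" for z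
    proof -
      obtain d where d: "(D has_derivative (\<lambda>v. d * cnj v)) (at z)" "d \<noteq> 0" using anti_motion_derivative[OF anti z] .
      have "vector_derivative (\<lambda>t. D (c t)) (at t) = d * cnj (?v t)" if "c t = z" for t
        using has_derivative_compose[OF cd, of D "\<lambda>v. d * cnj v" t] d(1) that
        by (intro vector_derivative_at) (simp add: has_vector_derivative_def scaleR_conv_of_real mult.left_commute)
      then show ?thesis using d(2) by blast
    qed
    have "crossing_sign (\<lambda>t. D (c t)) s t = (-1) * crossing_sign c s t" if eq: "c s = c t" for s t
    proof -
      obtain d where "d \<noteq> 0" "vector_derivative (\<lambda>t. D (c t)) (at s) = d * cnj (?v s)" "vector_derivative (\<lambda>t. D (c t)) (at t) = d * cnj (?v t)"
        using vd[OF cover_in_plane[OF c, of s]] eq by metis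
      then have "real_of_int (crossing_sign (\<lambda>t. D (c t)) s t) = real_of_int (- crossing_sign c s t)"
        by (simp add: of_int_crossing_sign planar_det_mult_cnj sgn_mult)
      then show ?thesis by linarith
    qed
    then show ?thesis using that[of "-1"] by simp
  qed
qed

text \<open>The covers differ by an injective deck transformation, so they have the same crossing
  parameters, and all signs change by the common factor \<open>\<epsilon>\<close>.\<close>

lemma abs_cover_index_unique:
  assumes w: "orientation_character G p (\<gamma> \<circ> circle_param) = 1" and nonnull: "\<not> null_homotopic_curve M \<gamma>"
    and c: "is_cover G p \<gamma> c" and c': "is_cover G p \<gamma> c'"
  shows "\<bar>cover_index M p \<gamma> c'\<bar> = \<bar>cover_index M p \<gamma> c\<bar>"
proof -
  obtain D where D: "deck_transformation G p D" "\<And>t. c' t = D (c t)" using covers_related[OF c c'] by blast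
  then have c'D: "c' = (\<lambda>t. D (c t))" by auto
  obtain T L b where 1: "lifted_curve G M p \<gamma> c T L b" by (rule lifted_curve_exists[OF w nonnull c]) (rule that)
  obtain T' L' b' where 2: "lifted_curve G M p \<gamma> c' T' L' b'" by (rule lifted_curve_exists[OF w nonnull c']) (rule that)
  obtain \<epsilon> :: int where \<epsilon>: "\<bar>\<epsilon>\<bar> = 1" "\<And>s t. c s = c t \<Longrightarrow> crossing_sign c' s t = \<epsilon> * crossing_sign c s t"
    using crossing_sign_deck[OF c D(1)] unfolding c'D by blast
  have "c' s = c' t \<longleftrightarrow> c s = c t" for s t
    using deck_inj[OF D(1)] cover_in_plane[OF c] unfolding c'D inj_on_def by metis
  then have sc: "self_crossings c' 0 = self_crossings c 0" by (simp add: self_crossings_def)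
  have "cover_index M p \<gamma> c' = (\<Sum>(s, t)\<in>self_crossings c 0. crossing_sign c' s t)"
    using lifted_curve.cover_index_eq[OF 2, of 0] sc by simp
  also have "\<dots> = (\<Sum>(s, t)\<in>self_crossings c 0. \<epsilon> * crossing_sign c s t)"
    by (rule sum.cong) (auto simp: self_crossings_def \<epsilon>(2))
  also have "\<dots> = \<epsilon> * cover_index M p \<gamma> c"
    unfolding lifted_curve.cover_index_eq[OF 1, of 0] by (simp add: sum_distrib_left case_prod_beta)
  finally show ?thesis using \<epsilon>(1) by (simp add: abs_mult)
qed

end

theorem theorem6:
  fixes G :: geometry
    and M :: "'m::metric_space set"
    and p :: "complex \<Rightarrow> 'm"
    and \<gamma> :: "complex \<Rightarrow> 'm"
  assumes "complete_geometric_surface G M"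
    and "\<not> orientable G M"
    and "universal_covering G M p"
    and "regular_closed_curve G M \<gamma>"
    and "generic_curve G M \<gamma>"
    and "orientation_character G p (\<gamma> \<circ> circle_param) = 1"
    and "\<not> null_homotopic_curve M \<gamma>"
    and "reversible_loop G M p (\<gamma> \<circ> circle_param)"
  shows "curve_winding G p \<gamma> = of_int (curve_index G M p \<gamma>)
    \<and> curve_winding G p \<gamma> \<in> \<int>
    \<and> (\<forall>c. is_cover G p \<gamma> c \<longrightarrow> curve_index G M p \<gamma> = \<bar>cover_index M p \<gamma> c\<bar>)"
proof -
  interpret closed_curve G M p \<gamma> by unfold_locales (use assms in auto)
  obtain c where c: "is_cover G p \<gamma> c" using cover_exists by blast
  define n where "n = \<bar>cover_index M p \<gamma> c\<bar>"
  have index: "\<bar>cover_index M p \<gamma> c'\<bar> = n" if "is_cover G p \<gamma> c'" for c'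
    using abs_cover_index_unique[OF assms(6,7) c that] by (simp add: n_def)
  \<comment> \<open>Existence and uniqueness together: \<open>THE\<close> in
    \<open>curve_winding\<close> needs a turning value for some cover and the same absolute value
    for every cover and every choice of group and angle.\<close>
  have turn: "(\<exists>v. cover_turning G p c' v) \<and> (\<forall>v. cover_turning G p c' v \<longrightarrow> \<bar>v\<bar> = of_int n)"
    if c': "is_cover G p \<gamma> c'" for c'
  proof -
    obtain T L b where LC: "lifted_curve G M p \<gamma> c' T L b"
      and T: "\<forall>\<phi> X. one_parameter_group G \<phi> X \<and> (\<forall>z\<in>plane G. \<phi> 1 z = T z) \<longrightarrow> (\<exists>\<kappa>. \<forall>z\<in>plane G. deriv L z * X z = \<kappa>)"
      "\<exists>\<phi> X. one_parameter_group G \<phi> X \<and> (\<forall>z\<in>plane G. \<phi> 1 z = T z) \<and> (\<forall>z\<in>plane G. X z \<noteq> 0)"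
      by (rule lifted_curve_exists[OF assms(6,7) c']) (rule that)
    have "\<bar>v\<bar> = of_int n" if v: "cover_turning G p c' v" for v
    proof -
      have "v = of_int (cover_index M p \<gamma> c')"
        by (rule lifted_curve.turning_eq_index[OF LC T(1) v])
      then show ?thesis using index[OF c'] by simp
    qed
    moreover have "\<exists>v. cover_turning G p c' v"
      by (rule lifted_curve.turning_exists[OF LC T])
    ultimately show ?thesis by blast
  qed
  have ci: "curve_index G M p \<gamma> = n"
    unfolding curve_index_def by (rule the_equality) (use c index in \<open>metis, metis\<close>)
  have "curve_winding G p \<gamma> = of_int n"
    unfolding curve_winding_def by (rule the_equality) (use c turn in \<open>metis, metis\<close>)
  then show ?thesis using ci index by simp
qed

end
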